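(* Let $\mathbb{K}$ be a field of characteristic zero. (i) For every $n\ge 5$, the set of all invariants $\mathcal{O}(\mathbf g)$, where $\mathbf g$ ranges over the simple graphs on $n$ vertices, does not generate the $\mathbb{K}$-algebra $\mathcal{I}_n$. (ii) For every $n$ with $11\le n\le 18$, the set of all invariants $\mathcal{O}(\mathbf g)$, where $\mathbf g$ ranges over the multigraphs on $n$ vertices having at least one isolated vertex, does not generate the $\mathbb{K}$-algebra $\mathcal{I}_n$.
   Context: Let $\mathbb{K}[x_{\{i,j\}}]$ be the polynomial ring in $\binom n2$ variables indexed by the pairs $\{i,j\}$, $1\le i<j\le n$. The symmetric group $\mathfrak{S}_n$ acts on it by $\mathbb{K}$-algebra automorphisms with $\sigma\cdot x_{\{i,j\}}=x_{\{\sigma(i),\sigma(j)\}}$, and $\mathcal{I}_n:=\mathbb{K}[x_{\{i,j\}}]^{\mathfrak{S}_n}$ is the ring of invariant polynomials. A multigraph $\mathbf g$ on the vertices $\{1,\dots,n\}$ (undirected, no loops) is a family $(g_{\{i,j\}})$ of non-negative integers (edge multiplicities); it is a simple graph if all $g_{\{i,j\}}\in\{0,1\}$. A vertex $i$ is isolated in $\mathbf g$ if $g_{\{i,j\}}=0$ for all $j\ne i$. Write $x^{\mathbf g}:=\prod x_{\{i,j\}}^{g_{\{i,j\}}}$ and $\mathcal{O}(\mathbf g):=\sum_{\mathbf h}x^{\mathbf h}$, the sum being over all distinct multigraphs $\mathbf h$ in the $\mathfrak{S}_n$-orbit of $\mathbf g$ (i.e. isomorphic to $\mathbf g$). *)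

theory Defs
  imports Complex_Main "HOL-Library.Poly_Mapping" "HOL-Combinatorics.Permutations"
begin

text \<open>
  The multivariate polynomial ring is the convolution ring of finitely supported functions from
  exponent families to coefficients. Variables are indexed by sets of vertices; membership in
  \<open>poly_ring n\<close> restricts them to the two-element subsets of \<open>{1..n}\<close>.
\<close>

type_synonym multigraph = "nat set \<Rightarrow>\<^sub>0 nat"

type_synonym 'k edge_poly = "multigraph \<Rightarrow>\<^sub>0 'k"

definition pairs :: "nat \<Rightarrow> nat set set" where
  "pairs n = {{i, j} | i j. 1 \<le> i \<and> i < j \<and> j \<le> n}"

definition multigraphs :: "nat \<Rightarrow> multigraph set" where
  "multigraphs n = {g. Poly_Mapping.keys g \<subseteq> pairs n}"

definition simple_graphs :: "nat \<Rightarrow> multigraph set" where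
  "simple_graphs n = {g \<in> multigraphs n. \<forall>e \<in> pairs n. Poly_Mapping.lookup g e \<in> {0, 1}}"

definition isolated :: "nat \<Rightarrow> multigraph \<Rightarrow> nat \<Rightarrow> bool" where
  "isolated n g i \<longleftrightarrow> (\<forall>j \<in> {1..n}. j \<noteq> i \<longrightarrow> Poly_Mapping.lookup g {i, j} = 0)"

definition isomorphic :: "nat \<Rightarrow> multigraph \<Rightarrow> multigraph \<Rightarrow> bool" where
  "isomorphic n g h \<longleftrightarrow>
    (\<exists>\<sigma>. \<sigma> permutes {1..n} \<and>
      (\<forall>e \<in> pairs n. Poly_Mapping.lookup h (\<sigma> ` e) = Poly_Mapping.lookup g e))"

definition Const :: "'k \<Rightarrow> 'k::comm_ring_1 edge_poly" where
  "Const c = Poly_Mapping.single 0 c"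

definition Var :: "nat set \<Rightarrow> 'k::comm_ring_1 edge_poly" where
  "Var e = Poly_Mapping.single (Poly_Mapping.single e 1) 1"

definition poly_ring :: "nat \<Rightarrow> 'k::comm_ring_1 edge_poly set" where
  "poly_ring n = {p. Poly_Mapping.keys p \<subseteq> multigraphs n}"

text \<open>
  The algebra endomorphism given by substituting \<open>Var (\<sigma> ` e)\<close> for \<open>Var e\<close>, where
  \<open>\<sigma> ` {i, j} = {\<sigma> i, \<sigma> j}\<close>.
\<close>

definition act :: "(nat \<Rightarrow> nat) \<Rightarrow> 'k edge_poly \<Rightarrow> 'k::comm_ring_1 edge_poly" where
  "act \<sigma> p =
    (\<Sum>m \<in> Poly_Mapping.keys p.
       Const (Poly_Mapping.lookup p m) *
       (\<Prod>e \<in> Poly_Mapping.keys m. Var (\<sigma> ` e) ^ Poly_Mapping.lookup m e))"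

definition invariants :: "nat \<Rightarrow> 'k::comm_ring_1 edge_poly set" where
  "invariants n = {p \<in> poly_ring n. \<forall>\<sigma>. \<sigma> permutes {1..n} \<longrightarrow> act \<sigma> p = p}"

definition graph_monomial :: "nat \<Rightarrow> multigraph \<Rightarrow> 'k::comm_ring_1 edge_poly" where
  "graph_monomial n g = (\<Prod>e \<in> pairs n. Var e ^ Poly_Mapping.lookup g e)"

definition orbit_sum :: "nat \<Rightarrow> multigraph \<Rightarrow> 'k::comm_ring_1 edge_poly" where
  "orbit_sum n g = (\<Sum>h \<in> {h \<in> multigraphs n. isomorphic n g h}. graph_monomial n h)"

definition is_subalgebra :: "'k::comm_ring_1 edge_poly set \<Rightarrow> bool" where
  "is_subalgebra A \<longleftrightarrow>
    (\<forall>c. Const c \<in> A) \<and> (\<forall>p \<in> A. \<forall>q \<in> A. p + q \<in> A \<and> p * q \<in> A)"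

definition generates_algebra ::
    "'k::comm_ring_1 edge_poly set \<Rightarrow> 'k edge_poly set \<Rightarrow> bool" where
  "generates_algebra S A \<longleftrightarrow> is_subalgebra hull S = A"

text \<open>The index set of \<open>orbit_sum\<close> is finite, so the sum does not collapse to 0.\<close>

lemma finite_orbit: "finite {h \<in> multigraphs n. isomorphic n g h}"
proof -
  let ?F = "\<lambda>\<sigma>. {h \<in> multigraphs n.
    \<forall>e \<in> pairs n. Poly_Mapping.lookup h (\<sigma> ` e) = Poly_Mapping.lookup g e}"
  have fin: "finite (?F \<sigma>)" if s: "\<sigma> permutes {1..n}" for \<sigma>
  proof -
    have "h = h'" if h: "h \<in> ?F \<sigma>" and h': "h' \<in> ?F \<sigma>" for h h'
    proof (rule poly_mapping_eqI)
      fix e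
      show "Poly_Mapping.lookup h e = Poly_Mapping.lookup h' e"
      proof (cases "e \<in> pairs n")
        case False
        then have "e \<notin> Poly_Mapping.keys h" "e \<notin> Poly_Mapping.keys h'"
          using h h' by (auto simp: multigraphs_def)
        then show ?thesis
          by (simp add: in_keys_iff)
      next
        case True
        then obtain i j where e: "e = {i, j}" "i \<noteq> j" "i \<in> {1..n}" "j \<in> {1..n}"
          unfolding pairs_def by auto
        obtain a b where ab: "a \<in> {1..n}" "b \<in> {1..n}" "\<sigma> a = i" "\<sigma> b = j"
          using permutes_image[OF s] e(3,4) by (metis image_iff)
        have "{a, b} \<in> pairs n"
        proof (cases "a < b")
          case True
          then show ?thesis using ab by (auto simp: pairs_def)
        next
          case False
          then have "b < a" using ab e(2) by (metis linorder_neqE_nat)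
          then have "{b, a} \<in> pairs n" using ab by (auto simp: pairs_def)
          then show ?thesis by (simp add: insert_commute)
        qed
        moreover have "\<sigma> ` {a, b} = e" using ab e by simp
        ultimately show ?thesis using h h' by force
      qed
    qed
    then have "\<exists>k. ?F \<sigma> \<subseteq> {k}" by blast
    then show ?thesis by (meson finite.emptyI finite.insertI finite_subset)
  qed
  have "{h \<in> multigraphs n. isomorphic n g h} = (\<Union>\<sigma> \<in> {\<sigma>. \<sigma> permutes {1..n}}. ?F \<sigma>)"
    by (auto simp: isomorphic_def)
  then show ?thesis
    using fin by (simp add: finite_permutations)
qed

end

theory Submission
  imports Defs "HOL-Combinatorics.Cycles" "HOL-Combinatorics.Orbits" "HOL-Library.Code_Binary_Nat"
begin

text \<open>
  (i) There is a linear form \<open>L\<close> in the coefficients of multigraphs with four edges and a repeated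
  edge such that \<open>L (p q) = p(0) L q + q(0) L p\<close> for all invariants \<open>p\<close>, \<open>q\<close>. Its kernel is thus
  a subalgebra, which contains every orbit sum of a simple graph, but \<open>L\<close> does not vanish on
  the orbit sum of a triple edge with a disjoint simple edge.

  (ii) Modulo orbit sums of graphs on fewer vertices, the orbit sum of a disjoint union is a nonzero
  multiple of the product of the orbit sums of its parts. So, if the graphs with an isolated vertex
  sufficed, the invariants of degree \<open>d\<close> would be spanned by the products of orbit sums of connected
  multigraphs on at most \<open>n - 1\<close> vertices with \<open>d\<close> edges altogether. For \<open>11 \<le> n \<le> 18\<close> and a suitable \<open>d\<close>
  there are fewer such products than isomorphism classes of multigraphs on \<open>n\<close> vertices with \<open>d\<close>
  edges. The numbers of isomorphism classes come from Burnside's lemma, those of connected classes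
  from the fact that a multigraph is a multiset of connected ones, by comparing logarithmic
  derivatives of generating functions.
\<close>

text \<open>For (i), \<open>L\<close> is a derivation at the origin: it kills all products of two
  invariants without constant term, so its coefficients must balance the ways in which a multigraph
  with four edges splits into smaller ones. Two of the shapes involved have five vertices, whence
  \<open>5 \<le> n\<close>. For (ii), the products lose the connected multigraphs on all
  \<open>n\<close> vertices, but their factors may together have more than \<open>n\<close>
  vertices. The second effect dominates in low degrees, so \<open>d\<close> must be large; for
  \<open>n = 18\<close> more than 10^14 classes are compared, which excludes enumeration. Degrees up
  to 24 and factors with up to 17 vertices occur. The numbers are therefore given as explicit
  tables, each of which is pinned down either by Burnside's formula or by a linear recurrence in
  which the unknown entry has a nonzero coefficient. Verifying the formula or the recurrence is
  enough, and no power series has to be inverted or factored.\<close>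

abbreviation "lookup \<equiv> Poly_Mapping.lookup"
abbreviation "keys \<equiv> Poly_Mapping.keys"
abbreviation "single \<equiv> Poly_Mapping.single"

section \<open>Multisets of given weight\<close>

text \<open>The weight \<open>v\<close> is only bounded because a multigraph on \<open>m\<close>
  vertices may have isolated vertices, which belong to no component; the weight \<open>e\<close> is
  exact because every edge lies in a component.\<close>

definition wmsets ::
    "'c set \<Rightarrow> ('c \<Rightarrow> nat) \<Rightarrow> ('c \<Rightarrow> nat) \<Rightarrow> nat \<Rightarrow> nat \<Rightarrow> 'c multiset set" where
  "wmsets C v e m k =
    {M. set_mset M \<subseteq> C \<and> (\<Sum>c\<in>#M. v c) \<le> m \<and> (\<Sum>c\<in>#M. e c) = k}"

lemma count_mult_le_sum_mset:
  fixes e :: "'c \<Rightarrow> nat"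
  shows "count M c * e c \<le> (\<Sum>c\<in>#M. e c)"
  by (induction M) auto

lemma sum_mset_conv_sum:
  fixes e :: "'c \<Rightarrow> nat"
  assumes "finite C" "set_mset M \<subseteq> C"
  shows "(\<Sum>c\<in>#M. e c) = (\<Sum>c\<in>C. count M c * e c)"
  using assms(2)
proof (induction M)
  case (add x M)
  have "(\<Sum>c\<in>C. count (add_mset x M) c * e c) =
    (\<Sum>c\<in>C. (if c = x then e c else 0) + count M c * e c)"
    by (intro sum.cong) auto
  then show ?case using add assms(1) by (simp add: sum.distrib)
qed simp

text \<open>Since every element has weight at least 1 in \<open>e\<close>, no multiplicity exceeds
  \<open>k\<close>.\<close>

lemma finite_wmsets:
  assumes "finite C" "\<And>c. c \<in> C \<Longrightarrow> 1 \<le> e c"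
  shows "finite (wmsets C v e m k)"
proof -
  let ?f = "\<lambda>M c. if c \<in> C then count M c else undefined"
  have "?f ` wmsets C v e m k \<subseteq> C \<rightarrow>\<^sub>E {..k}"
  proof (intro image_subsetI PiE_I)
    fix M c assume M: "M \<in> wmsets C v e m k" and c: "c \<in> C"
    have "count M c * 1 \<le> count M c * e c" using assms(2)[OF c] by (intro mult_left_mono) auto
    also have "\<dots> \<le> k" using M count_mult_le_sum_mset[of M c e] by (simp add: wmsets_def)
    finally show "?f M c \<in> {..k}" using c by simp
  qed auto
  moreover have "inj_on ?f (wmsets C v e m k)"
  proof (intro inj_onI multiset_eqI)
    fix M N c assume M: "M \<in> wmsets C v e m k" "N \<in> wmsets C v e m k" and eq: "?f M = ?f N"
    show "count M c = count N c"
    proof (cases "c \<in> C")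
      case True then show ?thesis using fun_cong[OF eq, of c] by simp
    next
      case False
      then have "c \<notin># M" "c \<notin># N" using M by (auto simp: wmsets_def)
      then show ?thesis by (simp add: not_in_iff)
    qed
  qed
  ultimately show ?thesis
    using assms(1) by (meson finite_PiE finite_atMost finite_imageD finite_subset)
qed

lemma card_wmsets_count_ge:
  assumes "c \<in> C" "i * v c \<le> m" "i * e c \<le> k"
  shows "card {M \<in> wmsets C v e m k. i \<le> count M c} =
    card (wmsets C v e (m - i * v c) (k - i * e c))"
proof (rule bij_betw_same_card[symmetric])
  show "bij_betw (\<lambda>N. N + replicate_mset i c) (wmsets C v e (m - i * v c) (k - i * e c))
      {M \<in> wmsets C v e m k. i \<le> count M c}"
  proof (rule bij_betw_byWitness[where f' = "\<lambda>M. M - replicate_mset i c"])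
    show "\<forall>M\<in>{M \<in> wmsets C v e m k. i \<le> count M c}. M - replicate_mset i c + replicate_mset i c = M"
      by (auto simp: count_le_replicate_mset_subset_eq)
    show "(\<lambda>N. N + replicate_mset i c) ` wmsets C v e (m - i * v c) (k - i * e c) \<subseteq>
      {M \<in> wmsets C v e m k. i \<le> count M c}"
      using assms by (auto simp: wmsets_def in_replicate_mset split: if_splits)
    show "(\<lambda>M. M - replicate_mset i c) ` {M \<in> wmsets C v e m k. i \<le> count M c} \<subseteq>
      wmsets C v e (m - i * v c) (k - i * e c)"
    proof (intro image_subsetI)
      fix M assume M: "M \<in> {M \<in> wmsets C v e m k. i \<le> count M c}"
      define N where "N = M - replicate_mset i c"
      have MN: "M = N + replicate_mset i c"
        using M by (simp add: N_def count_le_replicate_mset_subset_eq)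
      show "M - replicate_mset i c \<in> wmsets C v e (m - i * v c) (k - i * e c)"
        using M unfolding N_def[symmetric] unfolding MN
        by (auto simp: wmsets_def)
    qed
  qed auto
qed

lemma card_wmsets_count_ge_empty:
  assumes "\<not> (i * v c \<le> m \<and> i * e c \<le> k)"
  shows "{M \<in> wmsets C v e m k. i \<le> count M c} = {}"
proof -
  have "i * v c \<le> m \<and> i * e c \<le> k" if "M \<in> wmsets C v e m k" "i \<le> count M c" for M
  proof -
    have "i * v c \<le> count M c * v c" "i * e c \<le> count M c * e c"
      using that(2) by (auto intro: mult_right_mono)
    moreover have "count M c * v c \<le> m" "count M c * e c \<le> k"
      using that(1) count_mult_le_sum_mset[of M c v] count_mult_le_sum_mset[of M c e]
      by (auto simp: wmsets_def)
    ultimately show ?thesis by linarith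
  qed
  then show ?thesis using assms by blast
qed

text \<open>Double counting: the left-hand side adds up \<open>\<Sum>c\<in>#M. e c\<close> over all multisets \<open>M\<close>, the
  right-hand side splits the multiplicity of \<open>c\<close> in \<open>M\<close> into the \<open>i\<close> with \<open>i \<le> count M c\<close>.\<close>

lemma card_wmsets_rec:
  assumes fin: "finite C" and pos: "\<And>c. c \<in> C \<Longrightarrow> 1 \<le> e c"
  shows "k * card (wmsets C v e m k) =
    (\<Sum>c\<in>C. \<Sum>i\<in>{1..k}. if i * v c \<le> m \<and> i * e c \<le> k
       then e c * card (wmsets C v e (m - i * v c) (k - i * e c)) else 0)"
proof -
  let ?W = "wmsets C v e m k"
  have finW: "finite ?W" using finite_wmsets assms by blast
  have cnt: "(\<Sum>M\<in>?W. count M c * e c) = (\<Sum>i\<in>{1..k}. if i * v c \<le> m \<and> i * e c \<le> k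
       then e c * card (wmsets C v e (m - i * v c) (k - i * e c)) else 0)" if c: "c \<in> C" for c
  proof -
    have "count M c = (\<Sum>i\<in>{1..k}. if i \<le> count M c then 1 else 0)" if M: "M \<in> ?W" for M
    proof -
      have "count M c * 1 \<le> count M c * e c" using pos[OF c] by (intro mult_left_mono) auto
      also have "\<dots> \<le> k" using M count_mult_le_sum_mset[of M c e] by (simp add: wmsets_def)
      finally have "{1..k} \<inter> {i. i \<le> count M c} = {1..count M c}" by auto
      then show ?thesis by (simp add: sum.If_cases)
    qed
    then have "(\<Sum>M\<in>?W. count M c * e c) =
        (\<Sum>M\<in>?W. (\<Sum>i\<in>{1..k}. if i \<le> count M c then 1 else 0) * e c)"
      by (intro sum.cong) auto
    also have "\<dots> = (\<Sum>i\<in>{1..k}. e c * (\<Sum>M\<in>?W. if i \<le> count M c then 1 else 0))"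
      unfolding sum_distrib_right sum_distrib_left by (subst sum.swap) (simp add: mult.commute)
    also have "\<dots> = (\<Sum>i\<in>{1..k}. e c * card {M \<in> ?W. i \<le> count M c})"
      using finW by (simp add: sum.If_cases Int_def)
    also have "\<dots> = (\<Sum>i\<in>{1..k}. if i * v c \<le> m \<and> i * e c \<le> k
       then e c * card (wmsets C v e (m - i * v c) (k - i * e c)) else 0)"
    proof (rule sum.cong[OF refl])
      fix i
      show "e c * card {M \<in> ?W. i \<le> count M c} = (if i * v c \<le> m \<and> i * e c \<le> k
       then e c * card (wmsets C v e (m - i * v c) (k - i * e c)) else 0)"
      proof (cases "i * v c \<le> m \<and> i * e c \<le> k")
        case True
        then show ?thesis using card_wmsets_count_ge[of c C i v m e k] c by simp
      next
        case False
        then have "{M \<in> ?W. i \<le> count M c} = {}"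
          by (intro card_wmsets_count_ge_empty)
        then show ?thesis by (simp only: False if_False card.empty mult_0_right)
      qed
    qed
    finally show ?thesis .
  qed
  have "k * card ?W = (\<Sum>M\<in>?W. k)" by simp
  also have "\<dots> = (\<Sum>M\<in>?W. \<Sum>c\<in>C. count M c * e c)"
    using sum_mset_conv_sum[OF fin, of _ e] by (intro sum.cong) (auto simp: wmsets_def)
  also have "\<dots> = (\<Sum>c\<in>C. \<Sum>M\<in>?W. count M c * e c)" by (rule sum.swap)
  finally show ?thesis using cnt by simp
qed

text \<open>If \<open>c a b\<close> counts objects of weight \<open>(a, b)\<close>, this is the coefficient of \<open>x ^ w * y ^ j\<close> in
  the logarithmic derivative \<open>y d/dy\<close> of \<open>\<Prod>a b. (1 - x ^ a * y ^ b) powr (- c a b)\<close>.\<close>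

definition wdiv :: "(nat \<Rightarrow> nat \<Rightarrow> nat) \<Rightarrow> nat \<Rightarrow> nat \<Rightarrow> nat" where
  "wdiv c w j = (\<Sum>i\<in>{1..j}. if i dvd w \<and> i dvd j then (j div i) * c (w div i) (j div i) else 0)"

text \<open>Collecting the terms of \<open>card_wmsets_rec\<close> by the total weight
  \<open>(w, j)\<close> of \<open>i\<close> copies of \<open>c\<close> moves all dependence on
  \<open>C\<close> into \<open>wdiv\<close>. In terms of generating functions this is
  \<open>y dF/dy = F * (y d/dy log F)\<close>, summed over vertex weights up to
  \<open>m\<close>.\<close>

lemma card_wmsets_wdiv:
  assumes fin: "finite C" and pos: "\<And>c. c \<in> C \<Longrightarrow> 1 \<le> e c"
  shows "k * card (wmsets C v e m k) =
    (\<Sum>w\<in>{0..m}. \<Sum>j\<in>{1..k}. wdiv (\<lambda>a b. card {c\<in>C. v c = a \<and> e c = b}) w j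
       * card (wmsets C v e (m - w) (k - j)))"
proof -
  let ?g = "\<lambda>w j. card (wmsets C v e (m - w) (k - j))"
  \<comment> \<open>Each term is spread over all \<open>(w, j)\<close> by an indicator, so that the
    sums over \<open>c\<close> and \<open>i\<close> can be moved inside.\<close>
  have single: "(if i * v c \<le> m \<and> i * e c \<le> k then e c * ?g (i * v c) (i * e c) else 0) =
    (\<Sum>w\<in>{0..m}. \<Sum>j\<in>{1..k}. (if i * v c = w \<and> i * e c = j then e c else 0) * ?g w j)"
    if "c \<in> C" "i \<in> {1..k}" for c i
  proof -
    have "(\<Sum>w\<in>{0..m}. \<Sum>j\<in>{1..k}. (if i * v c = w \<and> i * e c = j then e c else 0) * ?g w j) =
      (\<Sum>w\<in>{0..m}. if w = i * v c
        then (\<Sum>j\<in>{1..k}. if j = i * e c then e c * ?g (i * v c) j else 0) else 0)"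
    proof (rule sum.cong[OF refl])
      fix w
      show "(\<Sum>j\<in>{1..k}. (if i * v c = w \<and> i * e c = j then e c else 0) * ?g w j) =
        (if w = i * v c
         then (\<Sum>j\<in>{1..k}. if j = i * e c then e c * ?g (i * v c) j else 0) else 0)"
        by (cases "w = i * v c") (auto intro!: sum.cong sum.neutral simp del: sum.delta sum.delta')
    qed
    also have "\<dots> = (if i * v c \<le> m \<and> i * e c \<le> k then e c * ?g (i * v c) (i * e c) else 0)"
      using that pos[of c] by (auto simp: sum.delta)
    finally show ?thesis by simp
  qed
  have inner: "(\<Sum>c\<in>C. \<Sum>i\<in>{1..k}. if i * v c = w \<and> i * e c = j then e c else 0) =
    wdiv (\<lambda>a b. card {c\<in>C. v c = a \<and> e c = b}) w j" if j: "j \<in> {1..k}" for w j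
  proof -
    have "(\<Sum>c\<in>C. if i * v c = w \<and> i * e c = j then e c else 0) =
      (if i dvd w \<and> i dvd j \<and> i \<le> j
       then (j div i) * card {c\<in>C. v c = w div i \<and> e c = j div i} else 0)" if i: "i \<in> {1..k}" for i
    proof (cases "i dvd w \<and> i dvd j")
      case True
      then have ij: "i \<le> j" using j by (simp add: dvd_imp_le)
      have "(\<Sum>c\<in>C. if i * v c = w \<and> i * e c = j then e c else 0) =
        (\<Sum>c\<in>C. if v c = w div i \<and> e c = j div i then j div i else 0)"
        using True i by (intro sum.cong) auto
      also have "\<dots> = (j div i) * card {c\<in>C. v c = w div i \<and> e c = j div i}"
        using fin by (simp add: sum.If_cases Int_def)
      finally show ?thesis using True ij by simp
    next
      case False
      then show ?thesis by (auto intro!: sum.neutral)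
    qed
    then have "(\<Sum>i\<in>{1..k}. \<Sum>c\<in>C. if i * v c = w \<and> i * e c = j then e c else 0) =
      (\<Sum>i\<in>{1..k}. if i dvd w \<and> i dvd j \<and> i \<le> j
       then (j div i) * card {c\<in>C. v c = w div i \<and> e c = j div i} else 0)"
      by (intro sum.cong) auto
    also have "\<dots> = (\<Sum>i\<in>{1..j}. if i dvd w \<and> i dvd j \<and> i \<le> j
       then (j div i) * card {c\<in>C. v c = w div i \<and> e c = j div i} else 0)"
      using j by (intro sum.mono_neutral_right) auto
    also have "\<dots> = wdiv (\<lambda>a b. card {c\<in>C. v c = a \<and> e c = b}) w j"
      unfolding wdiv_def by (intro sum.cong) auto
    finally show ?thesis by (subst sum.swap)
  qed
  let ?h = "\<lambda>c i w j. (if i * v c = w \<and> i * e c = j then e c else 0) * ?g w j"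
  have "k * card (wmsets C v e m k) = (\<Sum>c\<in>C. \<Sum>i\<in>{1..k}.
      if i * v c \<le> m \<and> i * e c \<le> k then e c * ?g (i * v c) (i * e c) else 0)"
    by (rule card_wmsets_rec[OF assms])
  also have "\<dots> = (\<Sum>c\<in>C. \<Sum>i\<in>{1..k}. \<Sum>w\<in>{0..m}. \<Sum>j\<in>{1..k}. ?h c i w j)"
    by (rule sum.cong[OF refl], rule sum.cong[OF refl], rule single)
  also have "\<dots> = (\<Sum>c\<in>C. \<Sum>w\<in>{0..m}. \<Sum>i\<in>{1..k}. \<Sum>j\<in>{1..k}. ?h c i w j)"
    by (rule sum.cong[OF refl], rule sum.swap)
  also have "\<dots> = (\<Sum>w\<in>{0..m}. \<Sum>c\<in>C. \<Sum>i\<in>{1..k}. \<Sum>j\<in>{1..k}. ?h c i w j)"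
    by (rule sum.swap)
  also have "\<dots> = (\<Sum>w\<in>{0..m}. \<Sum>c\<in>C. \<Sum>j\<in>{1..k}. \<Sum>i\<in>{1..k}. ?h c i w j)"
    by (rule sum.cong[OF refl], rule sum.cong[OF refl], rule sum.swap)
  also have "\<dots> = (\<Sum>w\<in>{0..m}. \<Sum>j\<in>{1..k}. \<Sum>c\<in>C. \<Sum>i\<in>{1..k}. ?h c i w j)"
    by (rule sum.cong[OF refl], rule sum.swap)
  also have "\<dots> = (\<Sum>w\<in>{0..m}. \<Sum>j\<in>{1..k}. (\<Sum>c\<in>C. \<Sum>i\<in>{1..k}.
      if i * v c = w \<and> i * e c = j then e c else 0) * ?g w j)"
    by (simp only: sum_distrib_right)
  also have "\<dots> = (\<Sum>w\<in>{0..m}. \<Sum>j\<in>{1..k}. 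
      wdiv (\<lambda>a b. card {c\<in>C. v c = a \<and> e c = b}) w j * ?g w j)"
    using inner by (intro sum.cong refl) auto
  finally show ?thesis .
qed

text \<open>Used for two kinds of objects: multisets of orbits of pairs, which encode the
  multigraphs fixed by a permutation, and multisets of connected classes, which encode products of
  orbit sums.\<close>

definition emsets :: "'c set \<Rightarrow> ('c \<Rightarrow> nat) \<Rightarrow> nat \<Rightarrow> 'c multiset set" where
  "emsets C e k = {M. set_mset M \<subseteq> C \<and> (\<Sum>c\<in>#M. e c) = k}"

lemma emsets_eq_wmsets: "emsets C e k = wmsets C (\<lambda>_. 0) e 0 k"
  by (simp add: emsets_def wmsets_def)

lemma card_emsets_empty: "card (emsets {} e k) = (if k = 0 then 1 else 0)"
proof -
  have "emsets {} e k = (if k = 0 then {{#}} else {})"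
    by (auto simp: emsets_def)
  then show ?thesis by simp
qed

text \<open>A multiset either avoids \<open>c\<close> or arises from another one by adding a copy of
  \<open>c\<close>. This is multiplication of the generating function by
  \<open>1 / (1 - x ^ e c)\<close>.\<close>

lemma card_emsets_insert:
  assumes "finite C" "c \<notin> C" "\<And>c'. c' \<in> insert c C \<Longrightarrow> 1 \<le> e c'"
  shows "card (emsets (insert c C) e k) =
    card (emsets C e k) + (if e c \<le> k then card (emsets (insert c C) e (k - e c)) else 0)"
proof -
  let ?E = "emsets (insert c C) e k"
  have fin: "finite ?E"
    unfolding emsets_eq_wmsets using assms by (intro finite_wmsets) auto
  have "?E = emsets C e k \<union> {M \<in> ?E. 1 \<le> count M c}"
    using assms(2) by (auto simp: emsets_def Suc_le_eq)
  moreover have "emsets C e k \<inter> {M \<in> ?E. 1 \<le> count M c} = {}"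
    using assms(2) by (auto simp: emsets_def Suc_le_eq)
  ultimately have "card ?E = card (emsets C e k) + card {M \<in> ?E. 1 \<le> count M c}"
    using fin by (metis (no_types, lifting) card_Un_disjoint finite_Un)
  moreover have "card {M \<in> ?E. 1 \<le> count M c} =
      (if e c \<le> k then card (emsets (insert c C) e (k - e c)) else 0)"
  proof (cases "e c \<le> k")
    case True
    then show ?thesis using card_wmsets_count_ge[of c "insert c C" 1 "\<lambda>_. 0" 0 e k]
      by (simp add: emsets_eq_wmsets)
  next
    case False
    then have "{M \<in> ?E. 1 \<le> count M c} = {}"
      using card_wmsets_count_ge_empty[of 1 "\<lambda>_. 0" c 0 e k "insert c C"]
      unfolding emsets_eq_wmsets by simp
    then show ?thesis using False by (simp only: card.empty if_False)
  qed
  ultimately show ?thesis by simp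
qed

section \<open>Cycle types\<close>

text \<open>\<open>mset_set\<close> takes each orbit once, while \<open>image_mset\<close> retains
  repeated lengths; fixed points give parts equal to 1.\<close>

definition cyc_type :: "'a set \<Rightarrow> ('a \<Rightarrow> 'a) \<Rightarrow> nat multiset" where
  "cyc_type A f = image_mset card (mset_set (orbit f ` A))"

lemma orbit_eq_funpow_range:
  assumes "permutation f"
  shows "orbit f x = range (\<lambda>i. (f ^^ i) x)"
  using orbit_altdef_permutation[OF assms, of x] by auto

lemma finite_orbit_permutation:
  assumes "permutation f"
  shows "finite (orbit f x)"
  unfolding orbit_eq_funpow_range[OF assms] using support_set[OF assms, of x]
  by (metis List.finite_set)

lemma card_orbit:
  assumes "permutation f"
  shows "card (orbit f x) = least_power f x"
proof -
  have "orbit f x = set (support f x)"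
    using support_set[OF assms] orbit_eq_funpow_range[OF assms] by simp
  then show ?thesis
    using distinct_card[OF cycle_of_permutation[OF assms, of x]] by simp
qed

lemma card_orbit_dvd_iff:
  assumes "permutation f"
  shows "card (orbit f x) dvd n \<longleftrightarrow> (f ^^ n) x = x"
  by (simp add: card_orbit[OF assms] least_power_dvd[OF assms])

lemma orbit_eq_of_mem:
  assumes "permutation f" "y \<in> orbit f x"
  shows "orbit f y = orbit f x"
  using cyclic_on_orbit'[OF assms(1)] assms(2) by (rule orbit_cyclic_eq3)

lemma mem_orbit_self: "permutation f \<Longrightarrow> x \<in> orbit f x"
  by (rule permutation_self_in_orbit)

lemma orbit_subset_permutes:
  assumes "f permutes A" "x \<in> A"
  shows "orbit f x \<subseteq> A"
  by (rule permutes_orbit_subset[OF assms])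

lemma permutes_permutation: "f permutes A \<Longrightarrow> finite A \<Longrightarrow> permutation f"
  by (auto simp: permutation_permutes)

lemma disjnt_orbits:
  assumes "permutation f" "X \<in> orbit f ` A" "Y \<in> orbit f ` A" "X \<noteq> Y"
  shows "X \<inter> Y = {}"
  using assms orbit_eq_of_mem[OF assms(1)] by (metis IntE equals0I imageE)

text \<open>The condition depends only on the orbit, so an orbit of length \<open>a\<close>
  contributes all of its \<open>a\<close> points or none. The instances used are the fixed points of
  a power, the whole set, and the points on cycles of a given length.\<close>

lemma card_set_by_orbits:
  assumes "f permutes A" "finite A"
  shows "card {x \<in> A. Q (card (orbit f x))} = (\<Sum>a\<in>#cyc_type A f. if Q a then a else 0)"
proof -
  note p = permutes_permutation[OF assms]
  let ?O = "{X \<in> orbit f ` A. Q (card X)}"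
  have "{x \<in> A. Q (card (orbit f x))} = \<Union> ?O"
  proof (intro equalityI subsetI)
    fix x assume "x \<in> {x \<in> A. Q (card (orbit f x))}"
    then show "x \<in> \<Union> ?O" using mem_orbit_self[OF p, of x] by auto
  next
    fix x assume "x \<in> \<Union> ?O"
    then obtain y where y: "y \<in> A" "x \<in> orbit f y" "Q (card (orbit f y))" by auto
    then show "x \<in> {x \<in> A. Q (card (orbit f x))}"
      using orbit_eq_of_mem[OF p y(2)] orbit_subset_permutes[OF assms(1) y(1)] by auto
  qed
  moreover have "pairwise disjnt ?O"
    unfolding pairwise_def disjnt_def using disjnt_orbits[OF p, of _ A] by blast
  ultimately have "card {x \<in> A. Q (card (orbit f x))} = (\<Sum>X\<in>?O. card X)"
    using finite_orbit_permutation[OF p] by (simp only:) (rule card_Union_disjoint, auto)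
  also have "\<dots> = (\<Sum>X\<in>orbit f ` A. if Q (card X) then card X else 0)"
    using assms(2) by (simp add: sum.If_cases Int_def)
  also have "\<dots> = (\<Sum>a\<in>#cyc_type A f. if Q a then a else 0)"
    by (simp add: cyc_type_def sum_unfold_sum_mset multiset.map_comp comp_def)
  finally show ?thesis .
qed

lemma card_fixed_funpow:
  assumes "f permutes A" "finite A"
  shows "card {x \<in> A. (f ^^ j) x = x} = (\<Sum>a\<in>#cyc_type A f. if a dvd j then a else 0)"
  using card_set_by_orbits[OF assms, of "\<lambda>a. a dvd j"]
  by (simp add: card_orbit_dvd_iff[OF permutes_permutation[OF assms]])

lemma sum_cyc_type:
  assumes "f permutes A" "finite A"
  shows "sum_mset (cyc_type A f) = card A"
  using card_set_by_orbits[OF assms, of "\<lambda>_. True"] by simp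

lemma cyc_type_pos:
  assumes "f permutes A" "finite A" "a \<in># cyc_type A f"
  shows "0 < a"
  using assms finite_orbit_permutation[OF permutes_permutation[OF assms(1,2)]]
    mem_orbit_self[OF permutes_permutation[OF assms(1,2)]]
  by (auto simp: cyc_type_def card_gt_0_iff) (metis empty_iff)

text \<open>Induction on \<open>l\<close>: in the divisor sum at \<open>l\<close>, all
  multiplicities of proper divisors are already known, which leaves that of \<open>l\<close>.
  Applied to cycle types, it says that the numbers of fixed points of all powers determine the cycle
  lengths.\<close>

lemma mset_eq_by_divisor_sums:
  fixes A B :: "nat multiset"
  assumes "0 \<notin># A" "0 \<notin># B"
    and eq: "\<And>j. 0 < j \<Longrightarrow>
      (\<Sum>a\<in>#A. if a dvd j then a else 0) = (\<Sum>a\<in>#B. if a dvd j then a else 0)"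
  shows "A = B"
proof -
  have expand: "(\<Sum>a\<in>#M. if a dvd j then a else 0) = (\<Sum>d\<in>{d. d dvd j}. count M d * d)"
    if "0 < j" for M :: "nat multiset" and j
  proof (induction M)
    case (add x M)
    have "(\<Sum>d\<in>{d. d dvd j}. count (add_mset x M) d * d) =
      (\<Sum>d\<in>{d. d dvd j}. (if d = x then d else 0) + count M d * d)"
      by (intro sum.cong) auto
    then show ?case using add that by (simp add: sum.distrib)
  qed simp
  have "count A l = count B l" if "0 < l" for l
    using that
  proof (induction l rule: less_induct)
    case (less l)
    have split: "{d. d dvd l} = insert l {d. d dvd l \<and> d < l}"
      using less.prems by (auto dest: dvd_imp_le)
    have fin: "finite {d. d dvd l \<and> d < l}" by simp
    have "(\<Sum>d\<in>{d. d dvd l \<and> d < l}. count A d * d) = (\<Sum>d\<in>{d. d dvd l \<and> d < l}. count B d * d)"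
      using less by (intro sum.cong) (auto intro!: less.IH dest: dvd_pos_nat)
    moreover have "(\<Sum>d\<in>{d. d dvd l}. count A d * d) = (\<Sum>d\<in>{d. d dvd l}. count B d * d)"
      using eq[OF less.prems] by (simp add: expand[OF less.prems])
    ultimately have "count A l * l = count B l * l"
      using fin by (simp add: split)
    then show ?case using less.prems by simp
  qed
  then show ?thesis
    using assms(1,2) by (intro multiset_eqI) (metis not_in_iff gr0I)
qed

text \<open>The coefficient of \<open>x ^ k\<close> in \<open>\<Prod>l\<leftarrow>ls. 1 / (1 - x ^ l)\<close>, with zeros in \<open>ls\<close> ignored.\<close>

fun ser_coeff :: "nat list \<Rightarrow> nat \<Rightarrow> nat" where
  "ser_coeff [] k = (if k = 0 then 1 else 0)"
| "ser_coeff (l # ls) k = ser_coeff ls k + (if 0 < l \<and> l \<le> k then ser_coeff (l # ls) (k - l) else 0)"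

lemma card_emsets_ser_coeff:
  assumes "finite C" "image_mset e (mset_set C) = mset L" "\<And>c. c \<in> C \<Longrightarrow> 1 \<le> e c"
  shows "card (emsets C e k) = ser_coeff L k"
  using assms
proof (induction L arbitrary: C k)
  case Nil
  then have "C = {}" by (simp add: mset_set_empty_iff)
  then show ?case by (simp add: card_emsets_empty)
next
  case (Cons l L)
  have "l \<in># image_mset e (mset_set C)" using Cons.prems by simp
  then obtain c where c: "c \<in> C" "e c = l" using Cons.prems(1) by auto
  define C' where "C' = C - {c}"
  have C: "C = insert c C'" "c \<notin> C'" "finite C'" using c Cons.prems by (auto simp: C'_def)
  have "image_mset e (mset_set C') = mset L"
    using Cons.prems(2) C c by simp
  then have IH: "card (emsets C' e k) = ser_coeff L k" for k
    using Cons.IH[of C'] C Cons.prems(3) by auto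
  show ?case
  proof (induction k rule: less_induct)
    case (less k)
    have "card (emsets C e k) =
        card (emsets C' e k) + (if l \<le> k then card (emsets C e (k - l)) else 0)"
      using card_emsets_insert[of C' c e k] C c Cons.prems(3) by simp
    moreover have "0 < l" using Cons.prems(3)[OF c(1)] c by simp
    ultimately show ?case using IH less.IH[of "k - l"] by auto
  qed
qed

section \<open>Inserting a new point into a cycle\<close>

lemma orbit_transpose_comp_other:
  assumes "f permutes A" "finite A" "x \<notin> A" "z \<in> A" "z \<notin> orbit f y"
  shows "orbit (transpose x y \<circ> f) z = orbit f z"
proof -
  note p = permutes_permutation[OF assms(1,2)]
  have sub: "orbit f z \<subseteq> A" by (rule orbit_subset_permutes[OF assms(1,4)])
  have "y \<notin> orbit f z"
    using assms(5) orbit_eq_of_mem[OF p, of y z] mem_orbit_self[OF p, of z] by auto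
  then have eq: "f w = (transpose x y \<circ> f) w" if "w \<in> orbit f z" for w
    using orbit.step[OF that] sub assms(3) by (auto simp: transpose_def)
  have "f \<in> orbit f z \<rightarrow> orbit f z" by (rule funcsetI, rule orbit.step)
  then have "orbit f z = orbit (transpose x y \<circ> f) z"
    by (rule orbit_cong0[OF mem_orbit_self[OF p, of z] _ eq])
  then show ?thesis by (rule sym)
qed

text \<open>As \<open>x\<close> is a fixed point of \<open>f\<close>, composing with the
  transposition redirects the predecessor of \<open>y\<close> to \<open>x\<close> and sends
  \<open>x\<close> to \<open>y\<close>: the new point is inserted just before
  \<open>y\<close>.\<close>

lemma orbit_transpose_comp_self:
  assumes "f permutes A" "finite A" "x \<notin> A" "y \<in> A" "z \<in> insert x (orbit f y)"
  shows "orbit (transpose x y \<circ> f) z = insert x (orbit f y)"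
proof -
  let ?g = "transpose x y \<circ> f"
  note p = permutes_permutation[OF assms(1,2)]
  have gp: "?g permutes insert x A"
  proof (rule permutes_compose)
    show "f permutes insert x A" by (rule permutes_subset[OF assms(1)]) auto
    show "transpose x y permutes insert x A" using assms(4) by (intro permutes_swap_id) auto
  qed
  have pg: "permutation ?g" using permutes_permutation[OF gp] assms(2) by simp
  have fx: "f x = x" using assms(1,3) by (simp add: permutes_not_in)
  have sub: "orbit f y \<subseteq> A" by (rule orbit_subset_permutes[OF assms(1,4)])
  have "(f ^^ i) y \<in> orbit ?g y" for i
  proof (induction i)
    case 0
    show ?case using mem_orbit_self[OF pg, of y] by (simp only: funpow_0)
  next
    case (Suc i)
    have "(f ^^ Suc i) y \<in> A"
      using sub orbit_eq_funpow_range[OF p, of y] by blast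
    then have ne: "f ((f ^^ i) y) \<noteq> x" using assms(3) by auto
    show ?case
    proof (cases "f ((f ^^ i) y) = y")
      case True
      then have "(f ^^ Suc i) y = y" by simp
      then show ?thesis using mem_orbit_self[OF pg, of y] by (simp only:)
    next
      case False
      then have "(f ^^ Suc i) y = ?g ((f ^^ i) y)" using ne by simp
      then show ?thesis using orbit.step[OF Suc] by metis
    qed
  qed
  then have sub1: "orbit f y \<subseteq> orbit ?g y"
    by (auto simp: orbit_eq_funpow_range[OF p])
  \<comment> \<open>The predecessor of \<open>y\<close> on its cycle, which may be \<open>y\<close>
    itself.\<close>
  obtain w where w: "w \<in> orbit f y" "f w = y"
  proof (cases rule: orbit.cases[OF mem_orbit_self[OF p, of y]])
    case 1
    then have "f y = y" by (rule sym)
    then show ?thesis by (rule that[OF mem_orbit_self[OF p, of y]])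
  next
    case (2 w)
    from 2(1) have "f w = y" by (rule sym)
    then show ?thesis by (rule that[OF 2(2)])
  qed
  then have "?g w = x" by simp
  then have "x \<in> orbit ?g y"
    using w(1) sub1 orbit.step[of w ?g y] by auto
  with sub1 have sup: "insert x (orbit f y) \<subseteq> orbit ?g y" by simp
  have closed: "?g w \<in> insert x (orbit f y)" if "w \<in> insert x (orbit f y)" for w
  proof (cases "w = x")
    case True
    then show ?thesis using fx mem_orbit_self[OF p, of y] by simp
  next
    case False
    then have "f w \<in> orbit f y" using that orbit.step[of w f y] by simp
    then show ?thesis using mem_orbit_self[OF p, of y] by (auto simp: transpose_def)
  qed
  have "w \<in> insert x (orbit f y)" if "w \<in> orbit ?g y" for w
    using that
  proof (induction rule: orbit.induct)
    case base then show ?case using closed[of y] mem_orbit_self[OF p, of y] by simp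
  next
    case (step w) then show ?case by (intro closed)
  qed
  with sup have "orbit ?g y = insert x (orbit f y)" by auto
  then show ?thesis using orbit_eq_of_mem[OF pg, of z y] assms(5) by simp
qed

lemma cyc_type_transpose_comp:
  assumes "f permutes A" "finite A" "x \<notin> A" "y \<in> A"
  shows "cyc_type (insert x A) (transpose x y \<circ> f) =
    cyc_type A f - {#card (orbit f y)#} + {#Suc (card (orbit f y))#}"
proof -
  let ?g = "transpose x y \<circ> f" and ?O = "orbit f y"
  note p = permutes_permutation[OF assms(1,2)]
  have sub: "?O \<subseteq> A" by (rule orbit_subset_permutes[OF assms(1,4)])
  then have x: "x \<notin> ?O" "x \<notin> \<Union> (orbit f ` A)"
    using assms(3) orbit_subset_permutes[OF assms(1)] by auto
  have "orbit ?g ` insert x A = orbit ?g ` insert x ?O \<union> orbit ?g ` (A - ?O)"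
    using sub by blast
  also have "orbit ?g ` insert x ?O = {insert x ?O}"
    using orbit_transpose_comp_self[OF assms] by auto
  also have "orbit ?g ` (A - ?O) = orbit f ` (A - ?O)"
    using orbit_transpose_comp_other[OF assms(1-3), of _ y] by (intro image_cong) auto
  also have "orbit f ` (A - ?O) = orbit f ` A - {?O}"
  proof (intro equalityI subsetI)
    fix X assume "X \<in> orbit f ` (A - ?O)"
    then obtain z where "z \<in> A" "z \<notin> ?O" "X = orbit f z" by blast
    then show "X \<in> orbit f ` A - {?O}" using mem_orbit_self[OF p, of z] by blast
  next
    fix X assume "X \<in> orbit f ` A - {?O}"
    then obtain z where z: "z \<in> A" "orbit f z \<noteq> ?O" "X = orbit f z" by blast
    then have "z \<notin> ?O" using orbit_eq_of_mem[OF p, of z y] by blast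
    then show "X \<in> orbit f ` (A - ?O)" using z by blast
  qed
  finally have O: "orbit ?g ` insert x A = insert (insert x ?O) (orbit f ` A - {?O})"
    by (simp only: Un_insert_left Un_empty_left)
  have "insert x ?O \<notin> orbit f ` A - {?O}" using x by blast
  moreover have "finite (orbit f ` A)" "?O \<in> orbit f ` A" using assms by auto
  ultimately show ?thesis
    using x(1) finite_orbit_permutation[OF p, of y]
    unfolding cyc_type_def O by (simp add: mset_set_Diff image_mset_Diff)
qed

lemma cyc_type_insert_fixed:
  assumes "f permutes A" "finite A" "x \<notin> A"
  shows "cyc_type (insert x A) f = add_mset 1 (cyc_type A f)"
proof -
  have "f x = x" using assms by (simp add: permutes_not_in)
  then have "orbit f x = {x}" by (simp add: orbit_eq_singleton_iff)
  moreover have "{x} \<notin> orbit f ` A"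
    using orbit_subset_permutes[OF assms(1)] assms(3) by fastforce
  ultimately show ?thesis using assms(2) by (simp add: cyc_type_def)
qed

text \<open>The order of the centralizer of a permutation of cycle type \<open>T\<close> in the
  symmetric group.\<close>

definition centralizer_order :: "nat multiset \<Rightarrow> nat" where
  "centralizer_order T = (\<Prod>a\<in>set_mset T. a ^ count T a * fact (count T a))"

lemma centralizer_order_add:
  "centralizer_order (add_mset a T) = centralizer_order T * (a * Suc (count T a))"
proof -
  let ?h = "\<lambda>T a. a ^ count T a * fact (count T a) :: nat"
  have "centralizer_order T = (\<Prod>b\<in>insert a (set_mset T). ?h T b)"
    unfolding centralizer_order_def
    by (intro prod.mono_neutral_left) (auto simp: not_in_iff)
  also have "\<dots> = ?h T a * (\<Prod>b\<in>set_mset T - {a}. ?h T b)"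
    by (simp add: prod.insert_remove)
  finally have T: "centralizer_order T = ?h T a * (\<Prod>b\<in>set_mset T - {a}. ?h T b)" .
  have "centralizer_order (add_mset a T) =
      ?h (add_mset a T) a * (\<Prod>b\<in>set_mset T - {a}. ?h (add_mset a T) b)"
    by (simp add: centralizer_order_def prod.insert_remove)
  also have "(\<Prod>b\<in>set_mset T - {a}. ?h (add_mset a T) b) = (\<Prod>b\<in>set_mset T - {a}. ?h T b)"
    by (intro prod.cong) auto
  finally show ?thesis using T by (simp add: algebra_simps)
qed

lemma centralizer_order_empty: "centralizer_order {#} = 1"
  by (simp add: centralizer_order_def)

lemma sum_mset_count: "sum_mset T = (\<Sum>b\<in>set_mset T. count T b * (b::nat))"
  using sum_mset_conv_sum[of "set_mset T" T id] by simp

text \<open>Inserting a new point into a permutation either adds a fixed point or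
  lengthens one cycle by one; a cycle of length \<open>a\<close> offers \<open>a\<close> places.\<close>

theorem card_permutations_cyc_type:
  assumes "finite A" "sum_mset T = card A" "0 \<notin># T"
  shows "card {f. f permutes A \<and> cyc_type A f = T} * centralizer_order T = fact (card A)"
  using assms
proof (induction A arbitrary: T rule: finite_induct)
  case empty
  then have T: "T = {#}" by (auto simp: sum_mset_0_iff) (metis multiset_nonemptyE)
  have "{f. f permutes ({} :: 'a set) \<and> cyc_type {} f = T} = {id}"
    by (auto simp: cyc_type_def T)
  then have "card {f. f permutes ({} :: 'a set) \<and> cyc_type {} f = T} = 1"
    by (simp only: card.insert) simp
  then show ?case by (simp only: T centralizer_order_empty) simp
next
  case (insert x A)
  let ?N = "\<lambda>T. card {f. f permutes A \<and> cyc_type A f = T}"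
  let ?P = "{f. f permutes A}"
  have finP: "finite ?P" using insert by (simp add: finite_permutations)
  let ?F = "\<lambda>(b, p). transpose x b \<circ> p"
  let ?I = "\<lambda>b p. if cyc_type (insert x A) (transpose x b \<circ> p) = T then 1 else (0::nat)"
  have inj: "inj_on ?F (insert x A \<times> ?P)"
  proof (rule inj_onI, clarify)
    fix b p c q assume h: "p permutes A" "q permutes A" "transpose x b \<circ> p = transpose x c \<circ> q"
    have "p x = x" "q x = x" using h insert.hyps by (auto simp: permutes_not_in)
    then have "b = c" using fun_cong[OF h(3), of x] by simp
    moreover have "p = q"
    proof
      fix w
      have "transpose x b (p w) = transpose x b (q w)"
        using fun_cong[OF h(3), of w] \<open>b = c\<close> by simp
      then show "p w = q w" by (metis transpose_involutory)
    qed
    ultimately show "b = c \<and> p = q" by simp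
  qed
  have "{f. f permutes insert x A} = ?F ` (insert x A \<times> ?P)"
    unfolding permutes_insert by auto
  then have "card {f. f permutes insert x A \<and> cyc_type (insert x A) f = T} =
      card {f \<in> ?F ` (insert x A \<times> ?P). cyc_type (insert x A) f = T}"
    by (intro arg_cong[where f = card]) blast
  also have "\<dots> = (\<Sum>f\<in>?F ` (insert x A \<times> ?P). if cyc_type (insert x A) f = T then 1 else 0)"
    using insert.hyps finP by (simp add: sum.If_cases Int_def)
  also have "\<dots> = (\<Sum>(b, p)\<in>insert x A \<times> ?P. ?I b p)"
    by (subst sum.reindex[OF inj]) (simp add: case_prod_unfold comp_def)
  also have "\<dots> = (\<Sum>p\<in>?P. \<Sum>b\<in>insert x A. ?I b p)"
    unfolding sum.cartesian_product[symmetric] by (rule sum.swap)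
  also have "\<dots> = (\<Sum>p\<in>?P. ?I x p) + (\<Sum>p\<in>?P. \<Sum>y\<in>A. ?I y p)"
    using insert.hyps by (simp add: sum.distrib)
  finally have total: "card {f. f permutes insert x A \<and> cyc_type (insert x A) f = T} =
    (\<Sum>p\<in>?P. ?I x p) + (\<Sum>p\<in>?P. \<Sum>y\<in>A. ?I y p)" .

  \<comment> \<open>The choice \<open>b = x\<close> leaves the new point fixed, so the old type is
    \<open>T\<close> with one part 1 removed.\<close>
  have part1: "(\<Sum>p\<in>?P. ?I x p) * centralizer_order T = fact (card A) * (count T 1 * 1)"
  proof (cases "1 \<in># T")
    case True
    then obtain R where R: "T = add_mset 1 R" by (meson mset_add)
    have "(\<Sum>p\<in>?P. ?I x p) = (\<Sum>p\<in>?P. if cyc_type A p = R then 1 else 0)"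
      using cyc_type_insert_fixed[OF _ insert.hyps(1,2)] by (intro sum.cong) (auto simp: R)
    also have "\<dots> = ?N R" using finP by (simp add: sum.If_cases Int_def)
    finally have "(\<Sum>p\<in>?P. ?I x p) * centralizer_order T =
        ?N R * centralizer_order R * Suc (count R 1)"
      by (simp add: R centralizer_order_add algebra_simps)
    also have "?N R * centralizer_order R = fact (card A)"
      using insert.IH[of R] insert.prems insert.hyps by (auto simp: R)
    finally show ?thesis by (simp add: R)
  next
    case False
    then have "(\<Sum>p\<in>?P. ?I x p) = 0"
      using cyc_type_insert_fixed[OF _ insert.hyps(1,2)] by (intro sum.neutral) auto
    then show ?thesis using False by (simp add: not_in_iff)
  qed

  \<comment> \<open>Here the new point enters an existing cycle, and the old type is
    \<open>T\<close> with some part \<open>b\<close> replaced by \<open>b - 1\<close>. The part 1 is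
    left out, as it would have to come from an empty cycle.\<close>
  have part2: "(\<Sum>p\<in>?P. \<Sum>y\<in>A. ?I y p) * centralizer_order T =
    fact (card A) * (\<Sum>b\<in>set_mset T - {1}. count T b * b)"
  proof -
    have per_perm: "(\<Sum>y\<in>A. ?I y p) = (\<Sum>b\<in>set_mset T - {1}.
        if cyc_type A p = add_mset (b - 1) (T - {#b#})
        then (b - 1) * count (cyc_type A p) (b - 1) else 0)" if p: "p permutes A" for p
    proof -
      let ?l = "\<lambda>y. card (orbit p y)"
      have lmem: "?l y \<in># cyc_type A p" if "y \<in> A" for y
        using that insert.hyps by (auto simp: cyc_type_def)
      have lpos: "0 < ?l y" if "y \<in> A" for y
        using cyc_type_pos[OF p insert.hyps(1) lmem[OF that]] .
      have "?I y p = (\<Sum>b\<in>set_mset T - {1}.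
          if ?l y = b - 1 \<and> cyc_type A p = add_mset (b - 1) (T - {#b#}) then 1 else 0)"
        if y: "y \<in> A" for y
      proof (cases "cyc_type (insert x A) (transpose x y \<circ> p) = T")
        case True
        then have T: "T = add_mset (Suc (?l y)) (cyc_type A p - {#?l y#})"
          using cyc_type_transpose_comp[OF p insert.hyps(1,2) y] by simp
        have eq: "cyc_type A p = add_mset (?l y) (T - {#Suc (?l y)#})"
          using lmem[OF y] by (simp add: T)
        have "(\<Sum>b\<in>set_mset T - {1}.
            if ?l y = b - 1 \<and> cyc_type A p = add_mset (b - 1) (T - {#b#}) then 1 else 0) =
          (\<Sum>b\<in>set_mset T - {1}. if b = Suc (?l y) then 1 else (0::nat))"
        proof (rule sum.cong[OF refl])
          fix b assume "b \<in> set_mset T - {1}"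
          then have "?l y = b - 1 \<longleftrightarrow> b = Suc (?l y)"
            using insert.prems(2) lpos[OF y] by (cases b) auto
          then show "(if ?l y = b - 1 \<and> cyc_type A p = add_mset (b - 1) (T - {#b#}) then 1 else 0)
            = (if b = Suc (?l y) then 1 else (0::nat))"
            using eq by auto
        qed
        also have "\<dots> = 1" using lpos[OF y] by (simp add: T)
        finally show ?thesis using True by simp
      next
        case False
        have "\<not> (?l y = b - 1 \<and> cyc_type A p = add_mset (b - 1) (T - {#b#}))"
          if b: "b \<in> set_mset T - {1}" for b
        proof
          assume h: "?l y = b - 1 \<and> cyc_type A p = add_mset (b - 1) (T - {#b#})"
          then have "Suc (?l y) = b" using lpos[OF y] by simp
          then have "cyc_type (insert x A) (transpose x y \<circ> p) = T"
            using cyc_type_transpose_comp[OF p insert.hyps(1,2) y] h b by simp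
          with False show False by simp
        qed
        then show ?thesis using False by simp
      qed
      then have "(\<Sum>y\<in>A. ?I y p) = (\<Sum>y\<in>A. \<Sum>b\<in>set_mset T - {1}.
          if ?l y = b - 1 \<and> cyc_type A p = add_mset (b - 1) (T - {#b#}) then 1 else 0)"
        by (intro sum.cong[OF refl]) blast
      also have "\<dots> = (\<Sum>b\<in>set_mset T - {1}. \<Sum>y\<in>A.
          if ?l y = b - 1 \<and> cyc_type A p = add_mset (b - 1) (T - {#b#}) then 1 else 0)"
        by (rule sum.swap)
      also have "\<dots> = (\<Sum>b\<in>set_mset T - {1}.
        if cyc_type A p = add_mset (b - 1) (T - {#b#}) then card {y\<in>A. ?l y = b - 1} else 0)"
        using insert.hyps by (intro sum.cong) (auto simp: sum.If_cases Int_def)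
      also have "\<dots> = (\<Sum>b\<in>set_mset T - {1}.
        if cyc_type A p = add_mset (b - 1) (T - {#b#})
        then (b - 1) * count (cyc_type A p) (b - 1) else 0)"
      proof -
        have "card {y\<in>A. ?l y = a} = a * count (cyc_type A p) a" for a
        proof -
          have "(\<Sum>c\<in>#cyc_type A p. if c = a then c else 0) =
              (\<Sum>c\<in>#cyc_type A p. if c = a then a else 0)"
            by (intro arg_cong[where f = sum_mset] image_mset_cong) auto
          then show ?thesis
            using card_set_by_orbits[OF p insert.hyps(1), of "\<lambda>c. c = a"]
            by (simp add: sum_mset_delta)
        qed
        then show ?thesis by (simp only:)
      qed
      finally show ?thesis .
    qed
    have "(\<Sum>p\<in>?P. \<Sum>y\<in>A. ?I y p) = (\<Sum>p\<in>?P. \<Sum>b\<in>set_mset T - {1}.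
        if cyc_type A p = add_mset (b - 1) (T - {#b#})
        then (b - 1) * count (add_mset (b - 1) (T - {#b#})) (b - 1) else 0)"
    proof (intro sum.cong[OF refl])
      fix p assume p: "p \<in> ?P"
      have "(\<Sum>y\<in>A. ?I y p) = (\<Sum>b\<in>set_mset T - {1}.
        if cyc_type A p = add_mset (b - 1) (T - {#b#})
        then (b - 1) * count (cyc_type A p) (b - 1) else 0)" using p per_perm by simp
      also have "\<dots> = (\<Sum>b\<in>set_mset T - {1}.
        if cyc_type A p = add_mset (b - 1) (T - {#b#})
        then (b - 1) * count (add_mset (b - 1) (T - {#b#})) (b - 1) else 0)"
        by (intro sum.cong[OF refl]) auto
      finally show "(\<Sum>y\<in>A. ?I y p) = \<dots>" .
    qed
    also have "\<dots> = (\<Sum>b\<in>set_mset T - {1}. ?N (add_mset (b - 1) (T - {#b#})) *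
        ((b - 1) * count (add_mset (b - 1) (T - {#b#})) (b - 1)))"
      by (subst sum.swap) (simp add: finP sum.If_cases Int_def)
    finally have "(\<Sum>p\<in>?P. \<Sum>y\<in>A. ?I y p) * centralizer_order T =
      (\<Sum>b\<in>set_mset T - {1}. ?N (add_mset (b - 1) (T - {#b#})) *
        ((b - 1) * count (add_mset (b - 1) (T - {#b#})) (b - 1)) * centralizer_order T)"
      by (simp add: sum_distrib_right)
    also have "\<dots> = (\<Sum>b\<in>set_mset T - {1}. fact (card A) * (count T b * b))"
    proof (rule sum.cong[OF refl])
      fix b assume b: "b \<in> set_mset T - {1}"
      then obtain R where R: "T = add_mset b R" by (meson DiffD1 mset_add)
      obtain a where a: "b = Suc a" "0 < a" using b insert.prems(2) 
        by (cases b) auto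
      have "?N (add_mset a R) * centralizer_order (add_mset a R) = fact (card A)"
        using insert.IH[of "add_mset a R"] insert.prems insert.hyps a by (auto simp: R)
      then have "?N (add_mset a R) * centralizer_order R * (a * Suc (count R a)) = fact (card A)"
        by (simp add: centralizer_order_add)
      moreover have "N * c * d = F \<Longrightarrow> N * d * (c * (g * h)) = F * (h * g)"
        for N c d F g h :: nat
        by (auto simp: ac_simps)
      ultimately have "?N (add_mset a R) * (a * Suc (count R a)) *
          (centralizer_order R * (b * Suc (count R b))) = fact (card A) * (Suc (count R b) * b)"
        by blast
      then show "?N (add_mset (b - 1) (T - {#b#})) *
        ((b - 1) * count (add_mset (b - 1) (T - {#b#})) (b - 1)) * centralizer_order T =
        fact (card A) * (count T b * b)"
        by (simp add: R a centralizer_order_add)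
    qed
    finally show ?thesis by (simp add: sum_distrib_left)
  qed

  \<comment> \<open>The two contributions add up to the sum of all parts, which is the additional
    factor of the next factorial.\<close>
  have "count T 1 * 1 + (\<Sum>b\<in>set_mset T - {1}. count T b * b) = sum_mset T"
  proof (cases "1 \<in># T")
    case True
    then show ?thesis
      unfolding sum_mset_count by (subst sum.remove[of "set_mset T" 1]) auto
  next
    case False
    then show ?thesis unfolding sum_mset_count by (simp add: not_in_iff)
  qed
  then have "fact (card A) * (count T 1 * 1) +
      fact (card A) * (\<Sum>b\<in>set_mset T - {1}. count T b * b) = fact (card A) * sum_mset T"
    by (metis distrib_left)
  then have "card {f. f permutes insert x A \<and> cyc_type (insert x A) f = T} *
      centralizer_order T = fact (card A) * sum_mset T"
    unfolding total add_mult_distrib part1 part2 .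
  then show ?case using insert.hyps insert.prems(1) by simp
qed

section \<open>Isomorphism classes of multigraphs\<close>

definition mg_size :: "multigraph \<Rightarrow> nat" where
  "mg_size g = (\<Sum>e\<in>keys g. lookup g e)"

lemma mg_size_eq_sum:
  assumes "finite P" "keys g \<subseteq> P"
  shows "mg_size g = (\<Sum>e\<in>P. lookup g e)"
  unfolding mg_size_def using assms by (intro sum.mono_neutral_left) (auto simp: in_keys_iff)

lemma pairs_alt: "pairs n = {e. e \<subseteq> {1..n} \<and> card e = 2}"
proof (intro equalityI subsetI)
  fix e assume "e \<in> {e. e \<subseteq> {1..n} \<and> card e = 2}"
  then obtain i j where e: "e = {i, j}" "i \<noteq> j" "i \<in> {1..n}" "j \<in> {1..n}"
    by (auto simp: card_2_iff)
  show "e \<in> pairs n"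
  proof (cases "i < j")
    case True
    then show ?thesis using e unfolding pairs_def by auto
  next
    case False
    then have "e = {j, i}" "j < i" using e by auto
    then show ?thesis using e unfolding pairs_def by auto
  qed
qed (auto simp: pairs_def)

lemma finite_pairs: "finite (pairs n)"
  by (rule finite_subset[of _ "Pow {1..n}"]) (auto simp: pairs_alt)

lemma image_pairs:
  assumes "s permutes {1..n}" "e \<in> pairs n"
  shows "s ` e \<in> pairs n"
proof -
  have "card (s ` e) = card e"
    using permutes_inj[OF assms(1)] by (intro card_image) (auto intro: inj_on_subset)
  moreover have "s ` e \<subseteq> {1..n}"
    using assms permutes_image[OF assms(1)] by (auto simp: pairs_alt)
  ultimately show ?thesis using assms(2) by (simp add: pairs_alt)
qed

text \<open>Being the identity outside \<open>pairs n\<close> makes it a permutation in the sense of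
  \<open>permutes\<close>, so that the results on cycle types apply.\<close>

definition pair_action :: "nat \<Rightarrow> (nat \<Rightarrow> nat) \<Rightarrow> nat set \<Rightarrow> nat set" where
  "pair_action n s e = (if e \<in> pairs n then s ` e else e)"

lemma pair_action_permutes:
  assumes "s permutes {1..n}"
  shows "pair_action n s permutes pairs n"
proof (rule bij_imp_permutes)
  have inj: "inj_on (pair_action n s) (pairs n)"
    using permutes_inj[OF assms] by (auto simp: inj_on_def pair_action_def inj_image_eq_iff)
  moreover have sub: "pair_action n s ` pairs n \<subseteq> pairs n"
    using image_pairs[OF assms] by (auto simp: pair_action_def)
  ultimately show "bij_betw (pair_action n s) (pairs n) (pairs n)"
    using endo_inj_surj[OF finite_pairs] by (auto simp: bij_betw_def)
qed (simp add: pair_action_def)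

lemma pair_action_funpow:
  assumes "s permutes {1..n}" "e \<in> pairs n"
  shows "(pair_action n s ^^ j) e = (s ^^ j) ` e \<and> (s ^^ j) ` e \<in> pairs n"
proof (induction j)
  case (Suc j)
  then show ?case
    using image_pairs[OF assms(1), of "(s ^^ j) ` e"] by (auto simp: pair_action_def image_comp)
qed (simp add: assms)

text \<open>A fixed pair either consists of two of the \<open>p\<close> fixed points or is a 2-cycle
  of \<open>r\<close>, and the 2-cycles partition the remaining \<open>q - p\<close> points.\<close>

lemma card_fixed_pairs:
  assumes "r permutes {1..n}"
  defines "p \<equiv> card {x \<in> {1..n}. r x = x}" and "q \<equiv> card {x \<in> {1..n}. r (r x) = x}"
  shows "2 * card {e \<in> pairs n. r ` e = e} + 2 * p = p\<^sup>2 + q"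
proof -
  let ?F = "{x \<in> {1..n}. r x = x}" and ?G = "{x \<in> {1..n}. r (r x) = x}"
  let ?S = "(\<lambda>x. {x, r x}) ` (?G - ?F)"
  have rin: "r x \<in> {1..n}" if "x \<in> {1..n}" for x
    using that permutes_in_image[OF assms(1)] by blast
  have split: "{e \<in> pairs n. r ` e = e} = {e. e \<subseteq> ?F \<and> card e = 2} \<union> ?S"
  proof (intro equalityI subsetI)
    fix e assume "e \<in> {e \<in> pairs n. r ` e = e}"
    then obtain x y where e: "e = {x, y}" "x \<noteq> y" "x \<in> {1..n}" "y \<in> {1..n}" "{r x, r y} = {x, y}"
      by (auto simp: pairs_alt card_2_iff)
    then consider "r x = x" "r y = y" | "r x = y" "r y = x" by (auto simp: doubleton_eq_iff)
    then show "e \<in> {e. e \<subseteq> ?F \<and> card e = 2} \<union> ?S"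
    proof cases
      case 2
      then have "x \<in> ?G - ?F" "e = {x, r x}" using e by auto
      then show ?thesis by blast
    qed (use e in auto)
  next
    fix e assume "e \<in> {e. e \<subseteq> ?F \<and> card e = 2} \<union> ?S"
    then show "e \<in> {e \<in> pairs n. r ` e = e}"
    proof
      assume "e \<in> {e. e \<subseteq> ?F \<and> card e = 2}"
      moreover from this have "r ` e = e" by force
      ultimately show ?thesis by (auto simp: pairs_alt)
    next
      assume "e \<in> ?S"
      then obtain x where "x \<in> ?G - ?F" "e = {x, r x}" by blast
      then show ?thesis using rin[of x] by (auto simp: pairs_alt)
    qed
  qed
  have disj: "{e. e \<subseteq> ?F \<and> card e = 2} \<inter> ?S = {}" by auto
  have c1: "card {e. e \<subseteq> ?F \<and> card e = 2} = p choose 2"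
    unfolding p_def by (rule n_subsets) simp
  have "pairwise disjnt ?S"
    by (auto simp: pairwise_def disjnt_def)
  then have "card (\<Union> ?S) = (\<Sum>e\<in>?S. card e)"
    by (intro card_Union_disjoint) auto
  also have "\<dots> = (\<Sum>e\<in>?S. 2)" 
  proof (rule sum.cong[OF refl])
    fix e assume "e \<in> ?S"
    then obtain x where "r x \<noteq> x" "e = {x, r x}" by auto
    then show "card e = 2" by (metis card_2_iff)
  qed
  also have "\<dots> = 2 * card ?S" by simp
  also have "\<Union> ?S = ?G - ?F"
  proof -
    have "r x \<in> ?G - ?F" if "x \<in> ?G - ?F" for x
      using that rin[of x] by auto
    then show ?thesis by blast
  qed
  also have "card (?G - ?F) = q - p"
    unfolding p_def q_def by (intro card_Diff_subset) auto
  finally have c2: "2 * card ?S = q - p" by simp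
  have pq: "p \<le> q" unfolding p_def q_def by (intro card_mono) auto
  have "card ({e. e \<subseteq> ?F \<and> card e = 2} \<union> ?S) = card {e. e \<subseteq> ?F \<and> card e = 2} + card ?S"
    by (rule card_Un_disjoint[OF _ _ disj]) (auto intro: finite_subset[of _ "Pow ?F"])
  then have "card {e \<in> pairs n. r ` e = e} = (p choose 2) + card ?S"
    unfolding split c1 .
  moreover have "2 * (p choose 2) = p * (p - 1)" by (cases p) (auto simp: choose_two)
  ultimately have "2 * card {e \<in> pairs n. r ` e = e} = p * (p - 1) + (q - p)"
    using c2 by linarith
  moreover have "p * (p - 1) + p = p\<^sup>2" by (cases p) (auto simp: power2_eq_square)
  ultimately show ?thesis using pq by linarith
qed

text \<open>A multigraph fixed by \<open>s\<close> is constant on the orbits of \<open>s\<close> on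
  pairs. Taking the common value on an orbit as its multiplicity gives a multiset of orbits, and an
  orbit of length \<open>l\<close> taken once accounts for \<open>l\<close> edges.\<close>

lemma card_fixed_multigraphs:
  assumes s: "s permutes {1..n}"
  shows "card {g \<in> multigraphs n. mg_size g = k \<and>
      (\<forall>e\<in>pairs n. lookup g (s ` e) = lookup g e)} =
    card (emsets (orbit (pair_action n s) ` pairs n) card k)"
proof -
  let ?t = "pair_action n s" let ?O = "orbit ?t ` pairs n"
  let ?X = "{g \<in> multigraphs n. mg_size g = k \<and>
      (\<forall>e\<in>pairs n. lookup g (s ` e) = lookup g e)}"
  note tp = pair_action_permutes[OF s]
  note p = permutes_permutation[OF tp finite_pairs]
  have tin: "?t e \<in> pairs n" if "e \<in> pairs n" for e
    using that image_pairs[OF s] by (simp add: pair_action_def)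
  have osub: "w \<subseteq> pairs n" if "w \<in> ?O" for w
    using that orbit_subset_permutes[OF tp] by auto
  have oeq: "orbit ?t e = w" if "w \<in> ?O" "e \<in> w" for e w
    using that orbit_eq_of_mem[OF p] by auto
  let ?f = "\<lambda>M. Abs_poly_mapping (\<lambda>e. if e \<in> pairs n then count M (orbit ?t e) else 0)"
  have look: "lookup (?f M) e = (if e \<in> pairs n then count M (orbit ?t e) else 0)" for M e
    by (rule lookup_Abs_poly_mapping[THEN fun_cong]) (auto intro: finite_subset[OF _ finite_pairs])
  have size: "(\<Sum>e\<in>pairs n. count M (orbit ?t e)) = (\<Sum>w\<in>#M. card w)"
    if M: "set_mset M \<subseteq> ?O" for M
  proof -
    have "(\<Sum>w\<in>#M. card w) = (\<Sum>w\<in>?O. \<Sum>e\<in>w. count M (orbit ?t e))"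
    proof -
      have "(\<Sum>w\<in>#M. card w) = (\<Sum>w\<in>?O. count M w * card w)"
        using finite_pairs M by (intro sum_mset_conv_sum) auto
      also have "\<dots> = (\<Sum>w\<in>?O. \<Sum>e\<in>w. count M (orbit ?t e))"
      proof (rule sum.cong[OF refl])
        fix w assume w: "w \<in> ?O"
        have "(\<Sum>e\<in>w. count M (orbit ?t e)) = (\<Sum>e\<in>w. count M w)"
        proof (rule sum.cong[OF refl])
          fix e assume "e \<in> w"
          show "count M (orbit ?t e) = count M w" by (simp only: oeq[OF w \<open>e \<in> w\<close>])
        qed
        then show "count M w * card w = (\<Sum>e\<in>w. count M (orbit ?t e))" by simp
      qed
      finally show ?thesis .
    qed
    also have "\<dots> = (\<Sum>e\<in>\<Union> ?O. count M (orbit ?t e))"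
      using finite_pairs finite_orbit_permutation[OF p] disjnt_orbits[OF p]
      by (intro sum.Union_disjoint[symmetric, unfolded comp_def]) blast+
    also have "\<Union> ?O = pairs n"
      using osub mem_orbit_self[OF p] by blast
    finally show ?thesis ..
  qed
  have keys: "keys (?f M) \<subseteq> pairs n" for M
    by (auto simp: in_keys_iff look split: if_splits)
  have "bij_betw ?f (emsets ?O card k) ?X"
  proof (rule bij_betw_imageI)
    show "inj_on ?f (emsets ?O card k)"
    proof (intro inj_onI multiset_eqI)
      fix M N w assume h: "M \<in> emsets ?O card k" "N \<in> emsets ?O card k" "?f M = ?f N"
      show "count M w = count N w"
      proof (cases "w \<in> ?O")
        case True
        then obtain e where "e \<in> pairs n" "w = orbit ?t e" by blast
        then show ?thesis
          using arg_cong[OF h(3), of "\<lambda>g. lookup g e"] by (simp add: look)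
      next
        case False
        then have "w \<notin># M" "w \<notin># N" using h by (auto simp: emsets_def)
        then show ?thesis by (simp add: not_in_iff)
      qed
    qed
    show "?f ` emsets ?O card k = ?X"
    proof (intro equalityI subsetI)
      fix g assume "g \<in> ?f ` emsets ?O card k"
      then obtain M where M: "M \<in> emsets ?O card k" "g = ?f M" by blast
      have "mg_size g = k"
        using size[of M] M keys[of M]
        by (simp add: mg_size_eq_sum[OF finite_pairs] look emsets_def)
      moreover have "lookup g (s ` e) = lookup g e"
        if e: "e \<in> pairs n" for e
      proof -
        have "?t e \<in> orbit ?t e" by (rule orbit.base)
        then have "orbit ?t (?t e) = orbit ?t e" by (rule orbit_eq_of_mem[OF p])
        then show ?thesis using e image_pairs[OF s e] M(2) by (simp add: look pair_action_def)
      qed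
      ultimately show "g \<in> ?X" using M(2) keys by (auto simp: multigraphs_def)
    next
      fix g assume g: "g \<in> ?X"
      \<comment> \<open>Any pair of the orbit may serve as representative, by the fact
        \<open>inv\<close> below.\<close>
      define h where "h w = lookup g (SOME e. e \<in> w)" for w
      define M where "M = (\<Sum>w\<in>?O. replicate_mset (h w) w)"
      have inv: "lookup g e' = lookup g e"
        if "e' \<in> orbit ?t e" "e \<in> pairs n" for e e'
        using that(1)
      proof (induction rule: orbit.induct)
        case base
        then show ?case using g that(2) by (simp add: pair_action_def)
      next
        case (step e')
        then have "e' \<in> pairs n" using orbit_subset_permutes[OF tp that(2)] by blast
        then show ?case using g step by (simp add: pair_action_def)
      qed
      have h: "h (orbit ?t e) = lookup g e" if "e \<in> pairs n" for e
        unfolding h_def using mem_orbit_self[OF p, of e] inv[OF _ that]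
        by (metis someI)
      have cnt: "count M w = (if w \<in> ?O then h w else 0)" for w
        using finite_pairs by (simp add: M_def count_sum if_distrib cong: if_cong)
      then have Msub: "set_mset M \<subseteq> ?O" by (auto simp flip: count_greater_zero_iff split: if_splits)
      have gM: "g = ?f M"
      proof (rule poly_mapping_eqI)
        fix e
        show "lookup g e = lookup (?f M) e"
          using g h[of e] by (auto simp: look cnt multigraphs_def in_keys_iff)
      qed
      have "(\<Sum>w\<in>#M. card w) = k"
        using size[OF Msub] g keys[of M]
        by (simp add: gM mg_size_eq_sum[OF finite_pairs] look)
      then show "g \<in> ?f ` emsets ?O card k"
        using gM Msub by (auto simp: emsets_def)
    qed
  qed
  then show ?thesis by (rule bij_betw_same_card[symmetric])
qed

text \<open>A pair \<open>(a, m)\<close> stands for \<open>m\<close> cycles of length \<open>a\<close>, both for the cycles of a permutation of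
  the points and for those it induces on the unordered pairs of points.\<close>

fun pair_groups :: "(nat \<times> nat) list \<Rightarrow> (nat \<times> nat) list" where
  "pair_groups [] = []"
| "pair_groups ((a, m) # gs) =
    (a, m * ((a - 1) div 2) + a * (m * (m - 1) div 2)) # (a div 2, if even a then m else 0) #
    map (\<lambda>(b, n). (lcm a b, m * n * gcd a b)) gs @ pair_groups gs"

definition expand_groups :: "(nat \<times> nat) list \<Rightarrow> nat list" where
  "expand_groups gs = concat (map (\<lambda>(l, c). replicate c l) gs)"

text \<open>The number of points fixed by the \<open>j\<close>-th power of a permutation with cycle
  groups \<open>gs\<close>.\<close>

definition divisor_sum :: "(nat \<times> nat) list \<Rightarrow> nat \<Rightarrow> nat" where
  "divisor_sum gs j = (\<Sum>(l, c)\<leftarrow>gs. if l dvd j then c * l else 0)"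

lemma divisor_sum_simps [simp]:
  "divisor_sum [] j = 0"
  "divisor_sum ((l, c) # gs) j = (if l dvd j then c * l else 0) + divisor_sum gs j"
  "divisor_sum (gs @ hs) j = divisor_sum gs j + divisor_sum hs j"
  by (simp_all add: divisor_sum_def)

lemma divisor_sum_expand:
  "(\<Sum>a\<in>#mset (expand_groups gs). if a dvd j then a else 0) = divisor_sum gs j"
  by (induction gs) (auto simp: expand_groups_def)

text \<open>The \<open>a * b\<close> pairs joining a cycle of length \<open>a\<close> to one of
  length \<open>b\<close> form \<open>gcd a b\<close> orbits of length \<open>lcm a b\<close>, and
  \<open>lcm a b\<close> divides \<open>j\<close> exactly when both lengths do.\<close>

lemma divisor_sum_cross:
  "divisor_sum (map (\<lambda>(b, n). (lcm a b, m * n * gcd a b)) gs) j =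
    (if a dvd j then a * m * divisor_sum gs j else 0)"
proof (induction gs)
  case (Cons g gs)
  obtain b n where g: "g = (b, n)" by force
  have "m * n * gcd a b * lcm a b = a * m * (n * b)"
    using prod_gcd_lcm_nat[of a b] by (simp add: ac_simps)
  then show ?case using Cons by (auto simp: g algebra_simps)
qed simp

text \<open>If the \<open>j\<close>-th power of a permutation has \<open>f\<close> fixed points and its square \<open>f'\<close>, it fixes
  \<open>f (f - 1) / 2 + (f' - f) / 2\<close> pairs; here the subtractions are moved to the other side.\<close>

lemma divisor_sum_pair_groups:
  assumes "\<And>a m. (a, m) \<in> set gs \<Longrightarrow> 0 < a"
  shows "2 * divisor_sum (pair_groups gs) j + 2 * divisor_sum gs j =
    (divisor_sum gs j)\<^sup>2 + divisor_sum gs (2 * j)"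
  using assms
proof (induction gs)
  case (Cons g gs)
  obtain a m where g: "g = (a, m)" by force
  have apos: "0 < a" using Cons.prems[of a m] g by simp
  have IH: "2 * divisor_sum (pair_groups gs) j + 2 * divisor_sum gs j =
    (divisor_sum gs j)\<^sup>2 + divisor_sum gs (2 * j)"
    by (rule Cons.IH) (rule Cons.prems, auto)
  let ?w = "m * ((a - 1) div 2) + a * (m * (m - 1) div 2)"
  let ?h = "if even a then m else 0"
  have expand: "divisor_sum (pair_groups (g # gs)) j =
      (if a dvd j then ?w * a else 0) + (if a div 2 dvd j then ?h * (a div 2) else 0) +
      (if a dvd j then a * m * divisor_sum gs j else 0) + divisor_sum (pair_groups gs) j"
    by (simp only: g pair_groups.simps divisor_sum_simps divisor_sum_cross add.assoc)
  have expand': "divisor_sum (g # gs) i = (if a dvd i then m * a else 0) + divisor_sum gs i" for i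
    by (simp add: g)
  have mm: "2 * (m * (m - 1) div 2) = m * (m - 1)"
    by (cases m) auto
  have sq: "(m * a)\<^sup>2 = a * a * (m * (m - 1)) + a * a * m"
    by (cases m) (auto simp: power2_eq_square algebra_simps)
  show ?case
  proof (cases "a dvd j")
    case True
    have core: "2 * (?w * a) + 2 * ((if even a then m else 0) * (a div 2)) + 2 * (m * a) =
        (m * a)\<^sup>2 + m * a"
    proof (cases "even a")
      case True
      then obtain b where b: "a = 2 * Suc b" using apos by (metis dvd_def mult_0_right not0_implies_Suc not_gr0)
      then have "(a - 1) div 2 = b" by simp
      then have w: "2 * (?w * a) = 2 * m * b * a + a * a * (m * (m - 1))"
        using mm by (simp add: algebra_simps)
      have "a * a * m = 2 * m * b * a + 2 * (m * a)" using b by (simp add: algebra_simps)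
      moreover have "2 * ((if even a then m else 0) * (a div 2)) = m * a" using b by simp
      ultimately show ?thesis using w sq by simp
    next
      case False
      then obtain b where b: "a = Suc (2 * b)" by (metis oddE Suc_eq_plus1)
      then have "(a - 1) div 2 = b" by simp
      then have w: "2 * (?w * a) = 2 * m * b * a + a * a * (m * (m - 1))"
        using mm by (simp add: algebra_simps)
      have "a * a * m = 2 * m * b * a + m * a" using b by (simp add: algebra_simps)
      then show ?thesis using w sq False by simp
    qed
    have "a div 2 dvd j" if "even a"
      using True that by (metis dvd_div_mult_self dvd_mult_left dvd_trans)
    then have half: "(if a div 2 dvd j then ?h * (a div 2) else 0) = ?h * (a div 2)" by simp
    have sum_sq: "(m * a + divisor_sum gs j)\<^sup>2 =
        (m * a)\<^sup>2 + (divisor_sum gs j)\<^sup>2 + 2 * (a * m * divisor_sum gs j)"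
      by (simp add: power2_sum)
    have double: "a dvd 2 * j" using True by simp
    have arith: "2 * (W + X + C + P) + 2 * (M + D) = Q + S + 2 * C + (M + S')"
      if "2 * W + 2 * X + 2 * M = Q + M" "2 * P + 2 * D = S + S'" for W X C P M D Q S S' :: nat
      using that by (simp add: distrib_left)
    show ?thesis
      unfolding expand expand'
      by (simp only: True if_True half sum_sq double) (rule arith[OF core IH])
  next
    case False
    \<comment> \<open>If \<open>a\<close> does not divide \<open>j\<close>, the square of the power
      can still fix the cycle pointwise: then the power itself is the half-turn of an even cycle and
      fixes exactly the pairs of opposite points, which form the orbit of length
      \<open>a div 2\<close>.\<close>
    have "a dvd 2 * j \<longleftrightarrow> even a \<and> a div 2 dvd j"
    proof
      assume h: "a dvd 2 * j"
      have "even a"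
      proof (rule ccontr)
        assume "odd a"
        then have "coprime a 2" by simp
        with h False show False by (simp add: coprime_dvd_mult_right_iff)
      qed
      with h show "even a \<and> a div 2 dvd j" by (auto elim!: evenE)
    qed (auto elim!: evenE)
    then show ?thesis using False IH unfolding expand expand' by (auto elim!: evenE)
  qed
qed simp

text \<open>Only nonempty groups have positive length: cycles of length 1 produce the group
  \<open>(0, 0)\<close> of pairs of opposite points.\<close>

lemma pair_groups_pos:
  assumes "\<And>a m. (a, m) \<in> set gs \<Longrightarrow> 0 < a" "(l, c) \<in> set (pair_groups gs)" "0 < c"
  shows "0 < l"
  using assms
proof (induction gs)
  case (Cons g gs)
  obtain a m where g: "g = (a, m)" by force
  have "0 < a" using Cons.prems(1)[of a m] by (simp add: g)
  moreover have "0 < b" if "(b, k) \<in> set gs" for b k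
    using Cons.prems(1)[of b k] that by simp
  ultimately show ?case
    using Cons by (auto simp: g intro!: lcm_pos_nat split: if_splits elim!: evenE)
qed simp

lemma zero_not_in_expand:
  assumes "\<And>l c. (l, c) \<in> set gs \<Longrightarrow> 0 < c \<Longrightarrow> 0 < l"
  shows "0 \<notin> set (expand_groups gs)"
  using assms by (auto simp: expand_groups_def)

text \<open>By \<open>mset_eq_by_divisor_sums\<close> it suffices to count the pairs fixed by each
  power of \<open>s\<close>, and \<open>card_fixed_pairs\<close> obtains this number from the fixed
  points of the power and of its square.\<close>

lemma cyc_type_pair_action:
  assumes s: "s permutes {1..n}" and type: "cyc_type {1..n} s = mset (expand_groups gs)"
    and pos: "\<And>a m. (a, m) \<in> set gs \<Longrightarrow> 0 < a"
  shows "cyc_type (pairs n) (pair_action n s) = mset (expand_groups (pair_groups gs))"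
proof (rule mset_eq_by_divisor_sums)
  show "0 \<notin># cyc_type (pairs n) (pair_action n s)"
    using cyc_type_pos[OF pair_action_permutes[OF s] finite_pairs] by blast
  show "0 \<notin># mset (expand_groups (pair_groups gs))"
    using zero_not_in_expand[of "pair_groups gs"] pair_groups_pos[OF pos] by auto
  fix j :: nat
  have fix_vertices: "card {x \<in> {1..n}. (s ^^ i) x = x} = divisor_sum gs i" for i
    using card_fixed_funpow[OF s finite_atLeastAtMost, of i] unfolding type divisor_sum_expand .
  have sj: "(s ^^ j) permutes {1..n}"
  proof (induction j)
    case 0
    show ?case by (simp only: funpow.simps permutes_id)
  next
    case (Suc j)
    show ?case unfolding funpow.simps by (rule permutes_compose[OF Suc s])
  qed
  have eq: "2 * divisor_sum (pair_groups gs) j + 2 * divisor_sum gs j =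
      (divisor_sum gs j)\<^sup>2 + divisor_sum gs (2 * j)"
    by (rule divisor_sum_pair_groups) (rule pos)
  have "card {e \<in> pairs n. (pair_action n s ^^ j) e = e} = card {e \<in> pairs n. (s ^^ j) ` e = e}"
    using pair_action_funpow[OF s] by (intro arg_cong[where f = card]) auto
  moreover have "2 * card {e \<in> pairs n. (s ^^ j) ` e = e} + 2 * divisor_sum gs j =
      (divisor_sum gs j)\<^sup>2 + divisor_sum gs (2 * j)"
    using card_fixed_pairs[OF sj] fix_vertices[of j] fix_vertices[of "2 * j"]
    by (simp add: mult_2 funpow_add)
  ultimately show "(\<Sum>a\<in>#cyc_type (pairs n) (pair_action n s). if a dvd j then a else 0) =
      (\<Sum>a\<in>#mset (expand_groups (pair_groups gs)). if a dvd j then a else 0)"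
    using eq card_fixed_funpow[OF pair_action_permutes[OF s] finite_pairs, of j]
    by (simp only: divisor_sum_expand)
qed

theorem card_fixed_multigraphs_ser_coeff:
  assumes "s permutes {1..n}" "cyc_type {1..n} s = mset (expand_groups gs)"
    "\<And>a m. (a, m) \<in> set gs \<Longrightarrow> 0 < a"
  shows "card {g \<in> multigraphs n. mg_size g = k \<and>
      (\<forall>e\<in>pairs n. lookup g (s ` e) = lookup g e)} =
    ser_coeff (expand_groups (pair_groups gs)) k"
proof -
  note tp = pair_action_permutes[OF assms(1)]
  have "card (emsets (orbit (pair_action n s) ` pairs n) card k) =
      ser_coeff (expand_groups (pair_groups gs)) k"
  proof (rule card_emsets_ser_coeff)
    show "image_mset card (mset_set (orbit (pair_action n s) ` pairs n)) =
        mset (expand_groups (pair_groups gs))"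
      using cyc_type_pair_action[OF assms] by (simp only: cyc_type_def)
    fix c assume "c \<in> orbit (pair_action n s) ` pairs n"
    then have "card c \<in># cyc_type (pairs n) (pair_action n s)"
      by (simp add: cyc_type_def finite_pairs)
    then show "1 \<le> card c" using cyc_type_pos[OF tp finite_pairs] by fastforce
  qed (simp add: finite_pairs)
  then show ?thesis using card_fixed_multigraphs[OF assms(1)] by simp
qed

section \<open>Isomorphism of multigraphs on arbitrary vertices\<close>

definition wf_mg :: "multigraph \<Rightarrow> bool" where
  "wf_mg g \<longleftrightarrow> (\<forall>e\<in>keys g. card e = 2)"

definition verts :: "multigraph \<Rightarrow> nat set" where
  "verts g = \<Union> (keys g)"

text \<open>Bijections of all of \<open>nat\<close> replace the permutations of
  \<open>{1..n}\<close>. Isomorphism then does not depend on \<open>n\<close>, and components can be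
  moved to fresh vertices; \<open>isomorphic_iff_mg_iso\<close> leads back to
  \<open>isomorphic\<close>.\<close>

definition maps_mg :: "(nat \<Rightarrow> nat) \<Rightarrow> multigraph \<Rightarrow> multigraph \<Rightarrow> bool" where
  "maps_mg s g h \<longleftrightarrow> bij s \<and> (\<forall>e. lookup h (s ` e) = lookup g e)"

definition mg_iso :: "multigraph \<Rightarrow> multigraph \<Rightarrow> bool" where
  "mg_iso g h \<longleftrightarrow> (\<exists>s. maps_mg s g h)"

definition mg_class :: "multigraph \<Rightarrow> multigraph set" where
  "mg_class g = {h. mg_iso g h}"

definition relabel :: "(nat \<Rightarrow> nat) \<Rightarrow> multigraph \<Rightarrow> multigraph" where
  "relabel s g = Poly_Mapping.map_key (\<lambda>e. inv s ` e) g"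

lemma lookup_relabel:
  assumes "bij s"
  shows "lookup (relabel s g) e = lookup g (inv s ` e)"
proof -
  have "inj (\<lambda>e. inv s ` e)"
    using bij_is_inj[OF bij_imp_bij_inv[OF assms]] by (simp add: inj_on_def inj_image_eq_iff)
  then show ?thesis by (simp add: relabel_def map_key.rep_eq)
qed

lemma maps_mg_relabel:
  assumes "bij s"
  shows "maps_mg s g (relabel s g)"
  using assms by (simp add: maps_mg_def lookup_relabel image_comp bij_is_inj)

lemma maps_mg_unique:
  assumes "maps_mg s g h" "maps_mg s g h'"
  shows "h = h'"
proof (rule poly_mapping_eqI)
  fix e
  have "e = s ` (inv s ` e)"
    using assms by (simp add: maps_mg_def image_f_inv_f bij_is_surj)
  then show "lookup h e = lookup h' e"
    using assms unfolding maps_mg_def by metis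
qed

lemma maps_mg_id: "maps_mg id g g"
  by (simp add: maps_mg_def)

lemma maps_mg_inv:
  assumes "maps_mg s g h" shows "maps_mg (inv s) h g"
  unfolding maps_mg_def
proof (intro conjI allI)
  show "bij (inv s)" using assms by (simp add: maps_mg_def bij_imp_bij_inv)
  fix e
  have "s ` (inv s ` e) = e"
    using assms by (simp add: maps_mg_def image_f_inv_f bij_is_surj)
  then show "lookup g (inv s ` e) = lookup h e"
    using assms unfolding maps_mg_def by metis
qed

lemma maps_mg_comp:
  assumes "maps_mg s g h" "maps_mg t h k" shows "maps_mg (t \<circ> s) g k"
  using assms unfolding maps_mg_def image_comp[symmetric] by (simp add: bij_comp)

lemma mg_iso_refl: "mg_iso g g"
  using maps_mg_id mg_iso_def by blast

lemma mg_iso_sym: "mg_iso g h \<Longrightarrow> mg_iso h g"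
  using maps_mg_inv mg_iso_def by blast

lemma mg_iso_trans: "mg_iso g h \<Longrightarrow> mg_iso h k \<Longrightarrow> mg_iso g k"
  unfolding mg_iso_def using maps_mg_comp by metis

lemma mg_class_eq_iff: "mg_class g = mg_class h \<longleftrightarrow> mg_iso g h"
  unfolding mg_class_def using mg_iso_refl mg_iso_sym mg_iso_trans by blast

lemma mem_mg_class_self: "g \<in> mg_class g"
  by (simp add: mg_class_def mg_iso_refl)

lemma keys_maps_mg:
  assumes "maps_mg s g h"
  shows "keys h = (\<lambda>e. s ` e) ` keys g"
proof (intro equalityI subsetI)
  fix e assume e: "e \<in> keys h"
  have "s ` (inv s ` e) = e"
    using assms by (simp add: maps_mg_def image_f_inv_f bij_is_surj)
  then have "inv s ` e \<in> keys g"
    using e assms unfolding maps_mg_def in_keys_iff by metis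
  then show "e \<in> (\<lambda>e. s ` e) ` keys g"
    by (rule rev_image_eqI) (rule \<open>s ` (inv s ` e) = e\<close>[symmetric])
next
  fix e assume "e \<in> (\<lambda>e. s ` e) ` keys g"
  then show "e \<in> keys h"
    using assms by (auto simp: maps_mg_def in_keys_iff)
qed

lemma verts_maps_mg:
  assumes "maps_mg s g h" shows "verts h = s ` verts g"
  by (simp add: verts_def keys_maps_mg[OF assms] image_Union)

lemma card_verts_maps_mg:
  assumes "maps_mg s g h" shows "card (verts h) = card (verts g)"
  using assms unfolding verts_maps_mg[OF assms]
  by (intro card_image) (auto simp: maps_mg_def bij_def intro: inj_on_subset)

lemma inj_image: "bij s \<Longrightarrow> inj (\<lambda>e. s ` e)"
  by (simp add: inj_on_def bij_def inj_image_eq_iff)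

lemma mg_size_maps_mg:
  assumes "maps_mg s g h" shows "mg_size h = mg_size g"
  using assms unfolding mg_size_def keys_maps_mg[OF assms]
  by (subst sum.reindex) (auto simp: maps_mg_def intro: inj_on_subset[OF inj_image])

lemma wf_mg_maps_mg:
  assumes "maps_mg s g h" "wf_mg g" shows "wf_mg h"
  using assms(2) assms(1) unfolding wf_mg_def keys_maps_mg[OF assms(1)] maps_mg_def bij_def
  by (auto intro!: card_image[THEN trans] intro: inj_on_subset)

lemma mg_iso_invariants:
  assumes "mg_iso g h"
  shows "card (verts h) = card (verts g)" "mg_size h = mg_size g" "wf_mg g \<Longrightarrow> wf_mg h"
  using assms card_verts_maps_mg mg_size_maps_mg wf_mg_maps_mg unfolding mg_iso_def by blast+

lemma finite_verts: "wf_mg g \<Longrightarrow> finite (verts g)"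
  unfolding verts_def wf_mg_def
  by (intro finite_Union finite_keys) (metis card.infinite zero_neq_numeral)

lemma multigraphs_alt: "multigraphs n = {g. wf_mg g \<and> verts g \<subseteq> {1..n}}"
  by (auto simp: multigraphs_def pairs_alt wf_mg_def verts_def)

lemma extend_permutation:
  assumes "finite T" "S \<subseteq> T" "f ` S \<subseteq> T" "inj_on f S"
  obtains p where "p permutes T" "\<And>x. x \<in> S \<Longrightarrow> p x = f x"
proof -
  have "card (T - S) = card (T - f ` S)"
    using assms by (simp add: card_Diff_subset finite_subset[of _ T] card_image)
  then obtain b where b: "bij_betw b (T - S) (T - f ` S)"
    using assms(1) by (metis finite_Diff finite_same_card_bij)
  define p where "p x = (if x \<in> S then f x else if x \<in> T then b x else x)" for x
  have "bij_betw p S (f ` S)"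
    using assms(4) by (auto simp: bij_betw_def p_def inj_on_def)
  moreover have "bij_betw p (T - S) (T - f ` S)"
    using b by (subst bij_betw_cong[of _ _ b]) (auto simp: p_def)
  ultimately have "bij_betw p (S \<union> (T - S)) (f ` S \<union> (T - f ` S))"
    by (rule bij_betw_combine) auto
  moreover have "S \<union> (T - S) = T" "f ` S \<union> (T - f ` S) = T" using assms by auto
  ultimately have "bij_betw p T T" by simp
  then have "p permutes T" using assms(2) by (intro bij_imp_permutes) (auto simp: p_def)
  then show thesis using that[of p] by (simp add: p_def)
qed

text \<open>The images of the edges of \<open>g\<close> are all the edges of \<open>h\<close>, so a
  bijection that agrees with \<open>s\<close> on the vertices of \<open>g\<close> cannot hit a
  further edge of \<open>h\<close>, being injective on sets.\<close>

lemma maps_mg_agree: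
  assumes "maps_mg s g h" "bij t" "\<And>x. x \<in> verts g \<Longrightarrow> t x = s x"
  shows "maps_mg t g h"
  unfolding maps_mg_def
proof (intro conjI allI)
  fix e
  have agree: "t ` e' = s ` e'" if "e' \<in> keys g" for e'
    using that assms(3) by (intro image_cong) (auto simp: verts_def)
  show "lookup h (t ` e) = lookup g e"
  proof (cases "e \<in> keys g")
    case True
    then show ?thesis using assms(1) agree by (simp add: maps_mg_def)
  next
    case False
    have "t ` e \<notin> keys h"
    proof
      assume "t ` e \<in> keys h"
      then obtain e' where e': "e' \<in> keys g" "t ` e = s ` e'"
        unfolding keys_maps_mg[OF assms(1)] by blast
      then have "t ` e = t ` e'" using agree by simp
      then have "e = e'" using inj_image[OF assms(2)] by (simp add: inj_eq)
      with e' False show False by simp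
    qed
    then show ?thesis using False by (simp add: in_keys_iff)
  qed
qed (rule assms(2))

text \<open>An isomorphism may leave \<open>{1..n}\<close> outside the vertices of \<open>g\<close>;
  its restriction to these vertices is injective into \<open>{1..n}\<close> and extends to a
  permutation there.\<close>

lemma mg_iso_permutes:
  assumes "g \<in> multigraphs n" "h \<in> multigraphs n" "mg_iso g h"
  obtains s where "s permutes {1..n}" "maps_mg s g h"
proof -
  obtain t where t: "maps_mg t g h" using assms(3) mg_iso_def by blast
  have "t ` verts g \<subseteq> {1..n}" "verts g \<subseteq> {1..n}"
    using assms(1,2) verts_maps_mg[OF t] by (auto simp: multigraphs_alt)
  moreover have "inj_on t (verts g)"
    using t by (auto simp: maps_mg_def bij_def intro: inj_on_subset)
  ultimately obtain s where s: "s permutes {1..n}" "\<And>x. x \<in> verts g \<Longrightarrow> s x = t x"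
    by (elim extend_permutation[of "{1..n}" "verts g" t, rotated -1]) auto
  then show thesis using that[OF s(1)] maps_mg_agree[OF t permutes_bij[OF s(1)] s(2)] by simp
qed

lemma maps_mg_iff_pairs:
  assumes "g \<in> multigraphs n" "h \<in> multigraphs n" "s permutes {1..n}"
  shows "maps_mg s g h \<longleftrightarrow>
    (\<forall>e\<in>pairs n. lookup h (s ` e) = lookup g e)"
proof
  assume r: "\<forall>e\<in>pairs n. lookup h (s ` e) = lookup g e"
  have "lookup h (s ` e) = lookup g e" for e
  proof (cases "e \<in> pairs n")
    case False
    have "s ` e \<notin> pairs n"
    proof
      assume "s ` e \<in> pairs n"
      then have "inv s ` (s ` e) \<in> pairs n"
        using permutes_inv[OF assms(3)] image_pairs by blast
      with False show False by (simp add: image_comp permutes_inv_o[OF assms(3)])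
    qed
    then have "lookup h (s ` e) = 0" "lookup g e = 0"
      using False assms(1,2) unfolding multigraphs_def by (meson in_keys_iff mem_Collect_eq subsetD)+
    then show ?thesis by simp
  qed (use r in blast)
  then show "maps_mg s g h" using permutes_bij[OF assms(3)] by (simp add: maps_mg_def)
qed (simp add: maps_mg_def)

lemma isomorphic_iff_mg_iso:
  assumes "g \<in> multigraphs n" "h \<in> multigraphs n"
  shows "isomorphic n g h \<longleftrightarrow> mg_iso g h"
  unfolding isomorphic_def using assms
  by (metis maps_mg_iff_pairs mg_iso_def mg_iso_permutes)

lemma relabel_multigraphs:
  assumes "s permutes {1..n}" "g \<in> multigraphs n"
  shows "relabel s g \<in> multigraphs n"
  using assms maps_mg_relabel[OF permutes_bij[OF assms(1)], of g] permutes_image[OF assms(1)]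
  by (auto simp: multigraphs_alt verts_maps_mg intro: wf_mg_maps_mg)

text \<open>Serves to bring a class into \<open>{1..n}\<close> and to find a copy of a component on
  vertices that are still free.\<close>

lemma relocate:
  assumes "wf_mg g" "finite T" "card (verts g) \<le> card T"
  obtains h where "mg_iso g h" "verts h \<subseteq> T"
proof -
  obtain f where f: "inj_on f (verts g)" "f ` verts g \<subseteq> T"
    using card_le_inj[OF finite_verts[OF assms(1)] assms(2,3)] by blast
  then obtain s where s: "s permutes (verts g \<union> T)" "\<And>x. x \<in> verts g \<Longrightarrow> s x = f x"
    using finite_verts[OF assms(1)] assms(2)
    by (elim extend_permutation[of "verts g \<union> T" "verts g" f, rotated -1]) auto
  have m: "maps_mg s g (relabel s g)" by (rule maps_mg_relabel[OF permutes_bij[OF s(1)]])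
  then have "verts (relabel s g) \<subseteq> T" using f(2) s(2) by (auto simp: verts_maps_mg)
  then show thesis using that m mg_iso_def by blast
qed

lemma finite_multigraphs_size: "finite {g \<in> multigraphs n. mg_size g = k}"
proof -
  let ?X = "{g \<in> multigraphs n. mg_size g = k}"
  let ?f = "\<lambda>g e. if e \<in> pairs n then lookup g e else undefined"
  have "?f ` ?X \<subseteq> pairs n \<rightarrow>\<^sub>E {..k}"
  proof (intro image_subsetI PiE_I)
    fix g e assume g: "g \<in> ?X" and e: "e \<in> pairs n"
    then have "k = (\<Sum>e\<in>pairs n. lookup g e)"
      using mg_size_eq_sum[OF finite_pairs, of g n] by (auto simp: multigraphs_def)
    then show "?f g e \<in> {..k}" using e finite_pairs[of n] by (simp add: member_le_sum)
  qed auto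
  moreover have "inj_on ?f ?X"
  proof (intro inj_onI poly_mapping_eqI)
    fix g h e assume h: "g \<in> ?X" "h \<in> ?X" "?f g = ?f h"
    show "lookup g e = lookup h e"
    proof (cases "e \<in> pairs n")
      case True then show ?thesis using fun_cong[OF h(3), of e] by simp
    next
      case False
      then have "e \<notin> keys g" "e \<notin> keys h"
        using h by (auto simp: multigraphs_def)
      then show ?thesis by (simp add: in_keys_iff)
    qed
  qed
  ultimately show ?thesis
    by (meson finite_PiE finite_atMost finite_imageD finite_subset finite_pairs)
qed

section \<open>Burnside's lemma and the sum over partitions\<close>

definition unl :: "nat \<Rightarrow> nat \<Rightarrow> nat" where
  "unl n k = card (mg_class ` {g \<in> multigraphs n. mg_size g = k})"

text \<open>The permutations that fix \<open>g\<close> are in bijection with those that carry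
  \<open>g0\<close> to \<open>g\<close>, and every permutation carries \<open>g0\<close> to exactly
  one multigraph of its class.\<close>

lemma sum_stabilizers:
  assumes g0: "g0 \<in> multigraphs n"
  shows "(\<Sum>g | g \<in> multigraphs n \<and> mg_iso g0 g. card {s. s permutes {1..n} \<and> maps_mg s g g}) = fact n"
proof -
  let ?Y = "{g. g \<in> multigraphs n \<and> mg_iso g0 g}" and ?P = "{s. s permutes {1..n}}"
  have finP: "finite ?P" by (simp add: finite_permutations)
  have finY: "finite ?Y"
    by (rule finite_subset[OF _ finite_multigraphs_size[of n "mg_size g0"]]) (auto dest: mg_iso_invariants)
  have "card {s. s permutes {1..n} \<and> maps_mg s g g} = card {s \<in> ?P. maps_mg s g0 g}" if g: "g \<in> ?Y" for g
  proof -
    obtain t where t: "t permutes {1..n}" "maps_mg t g0 g" using mg_iso_permutes[OF g0] g by blast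
    have "bij_betw (\<lambda>s. s \<circ> t) {s. s permutes {1..n} \<and> maps_mg s g g} {s \<in> ?P. maps_mg s g0 g}"
    proof (rule bij_betw_byWitness[where f' = "\<lambda>s. s \<circ> inv t"])
      show "(\<lambda>s. s \<circ> t) ` {s. s permutes {1..n} \<and> maps_mg s g g} \<subseteq> {s \<in> ?P. maps_mg s g0 g}"
        using t by (auto intro: permutes_compose maps_mg_comp)
      show "(\<lambda>s. s \<circ> inv t) ` {s \<in> ?P. maps_mg s g0 g} \<subseteq> {s. s permutes {1..n} \<and> maps_mg s g g}"
        using t by (auto intro: permutes_compose permutes_inv maps_mg_comp maps_mg_inv)
    qed (use t in \<open>auto simp: comp_assoc permutes_inv_o\<close>)
    then show ?thesis by (rule bij_betw_same_card)
  qed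
  then have "(\<Sum>g\<in>?Y. card {s. s permutes {1..n} \<and> maps_mg s g g}) =
      (\<Sum>g\<in>?Y. card {s \<in> ?P. maps_mg s g0 g})"
    by (rule sum.cong[OF refl])
  also have "\<dots> = (\<Sum>g\<in>?Y. \<Sum>s\<in>?P. if maps_mg s g0 g then 1 else 0)"
    using finP by (simp add: sum.If_cases Int_def)
  also have "\<dots> = (\<Sum>s\<in>?P. \<Sum>g\<in>?Y. if maps_mg s g0 g then 1 else 0)" by (rule sum.swap)
  also have "\<dots> = (\<Sum>s\<in>?P. 1)"
  proof (rule sum.cong[OF refl])
    fix s assume "s \<in> ?P"
    then have s: "s permutes {1..n}" by simp
    have m: "maps_mg s g0 (relabel s g0)" by (rule maps_mg_relabel[OF permutes_bij[OF s]])
    have "{g \<in> ?Y. maps_mg s g0 g} = {relabel s g0}"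
      using m maps_mg_unique[OF _ m] relabel_multigraphs[OF s g0] mg_iso_def by blast
    then show "(\<Sum>g\<in>?Y. if maps_mg s g0 g then 1 else 0) = (1 :: nat)"
      using finY by (simp add: sum.If_cases Int_def)
  qed
  also have "\<dots> = fact n" using card_permutations[of "{1..n}" n] by simp
  finally show ?thesis .
qed

lemma burnside_unl:
  "fact n * unl n k = (\<Sum>s | s permutes {1..n}. card {g \<in> multigraphs n. mg_size g = k \<and> maps_mg s g g})"
proof -
  let ?X = "{g \<in> multigraphs n. mg_size g = k}" and ?P = "{s. s permutes {1..n}}"
  note finX = finite_multigraphs_size[of n k]
  have finP: "finite ?P" by (simp add: finite_permutations)
  have "(\<Sum>s\<in>?P. card {g \<in> multigraphs n. mg_size g = k \<and> maps_mg s g g}) =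
      (\<Sum>s\<in>?P. \<Sum>g\<in>?X. if maps_mg s g g then 1 else 0)"
    using finX by (simp add: sum.If_cases Int_def conj_assoc)
  also have "\<dots> = (\<Sum>g\<in>?X. \<Sum>s\<in>?P. if maps_mg s g g then 1 else 0)" by (rule sum.swap)
  also have "\<dots> = (\<Sum>g\<in>?X. card {s. s permutes {1..n} \<and> maps_mg s g g})"
    using finP by (simp add: sum.If_cases Int_def)
  also have "\<dots> = (\<Sum>q\<in>mg_class ` ?X. \<Sum>g | g \<in> ?X \<and> mg_class g = q. card {s. s permutes {1..n} \<and> maps_mg s g g})"
    using finX by (rule sum.image_gen)
  also have "\<dots> = (\<Sum>q\<in>mg_class ` ?X. fact n)"
  proof (rule sum.cong[OF refl])
    fix q assume "q \<in> mg_class ` ?X"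
    then obtain g0 where g0: "g0 \<in> ?X" "q = mg_class g0" by blast
    then have "{g. g \<in> ?X \<and> mg_class g = q} = {g. g \<in> multigraphs n \<and> mg_iso g0 g}"
      using mg_iso_invariants(2) mg_iso_sym by (auto simp: mg_class_eq_iff)
    then show "(\<Sum>g | g \<in> ?X \<and> mg_class g = q. card {s. s permutes {1..n} \<and> maps_mg s g g}) = fact n"
      using sum_stabilizers[of g0 n] g0 by simp
  qed
  finally show ?thesis by (simp add: unl_def mult.commute)
qed

text \<open>Every cycle forms a group of its own, even if lengths repeat, so that adding a cycle
  just puts further lengths in front; see \<open>pair_lens_Cons\<close>.\<close>

definition pair_lens :: "nat list \<Rightarrow> nat list" where
  "pair_lens as = expand_groups (pair_groups (map (\<lambda>a. (a, 1)) as))"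

definition partition_lists :: "nat \<Rightarrow> nat list set" where
  "partition_lists n = {as. sorted as \<and> 0 \<notin> set as \<and> sum_list as = n}"

lemma centralizer_order_pos: "0 \<notin># T \<Longrightarrow> 0 < centralizer_order T"
  unfolding centralizer_order_def by (intro prod_pos) (auto intro: ccontr)

lemma finite_partition_lists: "finite (partition_lists n)"
proof (rule finite_subset)
  show "partition_lists n \<subseteq> {as. set as \<subseteq> {..n} \<and> length as \<le> n}"
  proof (rule subsetI, rule CollectI, rule conjI)
    fix as assume "as \<in> partition_lists n"
    then have as: "0 \<notin> set as" "sum_list as = n" by (auto simp: partition_lists_def)
    show "set as \<subseteq> {..n}" using member_le_sum_list[of _ as] as(2) by auto
    have "length as = (\<Sum>a\<leftarrow>as. 1)" by (simp add: sum_list_triv)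
    also have "\<dots> \<le> (\<Sum>a\<leftarrow>as. a)"
      using as(1) by (intro sum_list_mono) (metis One_nat_def Suc_leI gr0I)
    finally show "length as \<le> n" using as(2) by simp
  qed
qed (rule finite_lists_length_le, simp)

text \<open>In Burnside's sum the number of fixed multigraphs depends only on the cycle type, and
  \<open>fact n div centralizer_order\<close> is the number of permutations of that type.\<close>

theorem unl_formula:
  "fact n * unl n k = (\<Sum>as\<in>partition_lists n.
     fact n div centralizer_order (mset as) * ser_coeff (pair_lens as) k)"
proof -
  let ?P = "{s. s permutes {1..n}}"
  let ?c = "\<lambda>s. card {g \<in> multigraphs n. mg_size g = k \<and> maps_mg s g g}"
  let ?t = "\<lambda>s. sorted_list_of_multiset (cyc_type {1..n} s)"
  have finP: "finite ?P" by (simp add: finite_permutations)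
  have t: "?t s \<in> partition_lists n" if "s permutes {1..n}" for s
    using cyc_type_pos[OF that] sum_cyc_type[OF that]
    by (auto simp: partition_lists_def simp flip: sum_mset_sum_list)
  have "fact n * unl n k = (\<Sum>as\<in>partition_lists n. \<Sum>s | s \<in> ?P \<and> ?t s = as. ?c s)"
    unfolding burnside_unl using finP finite_partition_lists t by (intro sum.group[symmetric]) auto
  also have "\<dots> = (\<Sum>as\<in>partition_lists n.
     fact n div centralizer_order (mset as) * ser_coeff (pair_lens as) k)"
  proof (rule sum.cong[OF refl])
    fix as assume as: "as \<in> partition_lists n"
    then have pos: "0 \<notin> set as" and sum: "sum_list as = n" and sorted: "sorted as"
      by (auto simp: partition_lists_def)
    have exp: "expand_groups (map (\<lambda>a. (a, 1)) as) = as"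
      by (induction as) (auto simp: expand_groups_def)
    have eq: "{s. s \<in> ?P \<and> ?t s = as} = {s. s permutes {1..n} \<and> cyc_type {1..n} s = mset as}"
    proof -
      have "sorted_list_of_multiset M = as \<longleftrightarrow> M = mset as" for M
        using sorted by (metis mset_sorted_list_of_multiset sorted_list_of_multiset_mset sorted_sort_id)
      then show ?thesis by auto
    qed
    have "?c s = ser_coeff (pair_lens as) k"
      if "s permutes {1..n}" "cyc_type {1..n} s = mset as" for s
    proof -
      have "{g \<in> multigraphs n. mg_size g = k \<and> maps_mg s g g} = {g \<in> multigraphs n. mg_size g = k \<and>
          (\<forall>e\<in>pairs n. lookup g (s ` e) = lookup g e)}"
        using maps_mg_iff_pairs[OF _ _ that(1)] by blast
      moreover have posm: "0 < a" if "(a, m) \<in> set (map (\<lambda>a. (a, 1)) as)" for a m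
        using that pos by (auto intro: gr0I)
      have "card {g \<in> multigraphs n. mg_size g = k \<and>
          (\<forall>e\<in>pairs n. lookup g (s ` e) = lookup g e)} =
        ser_coeff (pair_lens as) k"
        unfolding pair_lens_def
        by (rule card_fixed_multigraphs_ser_coeff[OF that(1)]) (simp only: exp that(2), erule posm)
      ultimately show ?thesis by simp
    qed
    then have "(\<Sum>s | s \<in> ?P \<and> ?t s = as. ?c s) =
        card {s. s permutes {1..n} \<and> cyc_type {1..n} s = mset as} * ser_coeff (pair_lens as) k"
      unfolding eq by simp
    also have "card {s. s permutes {1..n} \<and> cyc_type {1..n} s = mset as} =
        fact n div centralizer_order (mset as)"
    proof -
      have "card {s. s permutes {1..n} \<and> cyc_type {1..n} s = mset as} * centralizer_order (mset as) = fact n"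
        using card_permutations_cyc_type[of "{1..n}" "mset as"] pos sum
        by (simp add: sum_mset_sum_list)
      then show ?thesis using centralizer_order_pos[of "mset as"] pos
        by (metis nonzero_mult_div_cancel_right not_gr0 set_mset_mset)
    qed
    finally show "(\<Sum>s | s \<in> ?P \<and> ?t s = as. ?c s) =
      fact n div centralizer_order (mset as) * ser_coeff (pair_lens as) k" .
  qed
  finally show ?thesis .
qed

section \<open>Connected components\<close>

definition mg_restrict :: "multigraph \<Rightarrow> nat set \<Rightarrow> multigraph" where
  "mg_restrict g S = Abs_poly_mapping (\<lambda>e. if e \<subseteq> S then lookup g e else 0)"

lemma lookup_mg_restrict:
  "lookup (mg_restrict g S) e = (if e \<subseteq> S then lookup g e else 0)"
proof -
  have "{e. (if e \<subseteq> S then lookup g e else 0) \<noteq> 0} \<subseteq> keys g"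
    by (auto simp: in_keys_iff)
  then have "finite {e. (if e \<subseteq> S then lookup g e else 0) \<noteq> 0}"
    using finite_keys finite_subset by blast
  then show ?thesis unfolding mg_restrict_def by (subst lookup_Abs_poly_mapping) auto
qed

text \<open>In a well-formed multigraph the closed sets are the unions of vertex sets of components.
  Using them instead of paths makes splitting a disconnected multigraph immediate.\<close>

definition closed_in :: "multigraph \<Rightarrow> nat set \<Rightarrow> bool" where
  "closed_in g S \<longleftrightarrow> S \<subseteq> verts g \<and> (\<forall>e\<in>keys g. e \<subseteq> S \<or> e \<inter> S = {})"

text \<open>Excluding 0 gives every connected multigraph at least one edge, hence positive weight in
  the multisets of components. Isolated vertices do not matter, as \<open>verts\<close> only sees
  endpoints of edges.\<close>

definition mg_connected :: "multigraph \<Rightarrow> bool" where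
  "mg_connected g \<longleftrightarrow>
    wf_mg g \<and> g \<noteq> 0 \<and> (\<forall>S. closed_in g S \<longrightarrow> S = {} \<or> S = verts g)"

lemma edge_nonempty: "wf_mg g \<Longrightarrow> e \<in> keys g \<Longrightarrow> e \<noteq> {}"
  by (auto simp: wf_mg_def)

lemma keys_add_mg: "keys (g + h) = keys g \<union> keys (h :: multigraph)"
  by (auto simp: in_keys_iff lookup_add)

lemma verts_add: "verts (g + h) = verts g \<union> verts h"
  by (simp add: verts_def keys_add_mg)

lemma verts_zero [simp]: "verts 0 = {}"
  by (simp add: verts_def)

lemma wf_mg_add: "wf_mg (g + h) \<longleftrightarrow> wf_mg g \<and> wf_mg h"
  by (auto simp: wf_mg_def keys_add_mg)

lemma wf_mg_zero [simp]: "wf_mg 0"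
  by (simp add: wf_mg_def)

lemma mg_size_zero [simp]: "mg_size 0 = 0"
  by (simp add: mg_size_def)

lemma mg_size_add: "mg_size (g + h) = mg_size g + mg_size h"
proof -
  let ?P = "keys g \<union> keys h"
  have "mg_size (g + h) = (\<Sum>e\<in>?P. lookup (g + h) e)"
    by (intro mg_size_eq_sum) (auto simp: keys_add_mg)
  also have "\<dots> = mg_size g + mg_size h"
    by (subst (1 2) mg_size_eq_sum[of ?P]) (auto simp: lookup_add sum.distrib)
  finally show ?thesis .
qed

lemma mg_size_eq_0_iff: "mg_size g = 0 \<longleftrightarrow> g = 0"
  by (auto simp: mg_size_def in_keys_iff intro: poly_mapping_eqI)

lemma verts_nonempty: "wf_mg g \<Longrightarrow> g \<noteq> 0 \<Longrightarrow> verts g \<noteq> {}"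
  unfolding verts_def using edge_nonempty keys_eq_empty by fastforce

lemma split_closed:
  assumes "wf_mg g" "closed_in g S" "S \<noteq> {}" "S \<noteq> verts g"
  obtains a b where "g = a + b" "a \<noteq> 0" "b \<noteq> 0" "verts a \<inter> verts b = {}"
proof -
  let ?a = "mg_restrict g S" and ?b = "mg_restrict g (- S)"
  have gab: "g = ?a + ?b"
  proof (rule poly_mapping_eqI)
    fix e
    show "lookup g e = lookup (?a + ?b) e"
    proof (cases "e \<in> keys g")
      case True
      then have "e \<noteq> {}" "e \<subseteq> S \<or> e \<inter> S = {}"
        using assms edge_nonempty by (auto simp: closed_in_def)
      then show ?thesis by (auto simp: lookup_add lookup_mg_restrict)
    next
      case False
      then show ?thesis by (simp add: in_keys_iff lookup_add lookup_mg_restrict)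
    qed
  qed
  have va: "verts ?a \<subseteq> S" and vb: "verts ?b \<subseteq> - S"
    by (auto simp: verts_def in_keys_iff lookup_mg_restrict split: if_splits)
  obtain x where x: "x \<in> S" using assms(3) by blast
  obtain y where y: "y \<in> verts g" "y \<notin> S" using assms(2,4) by (auto simp: closed_in_def)
  have "x \<in> verts g" using x assms(2) by (auto simp: closed_in_def)
  then have "x \<in> verts ?a" "y \<in> verts ?b"
    using x y va vb verts_add[of ?a ?b] gab by auto
  then have "?a \<noteq> 0" "?b \<noteq> 0" by auto
  then show thesis using that[OF gab] va vb by blast
qed

text \<open>A set of components suffices, although isomorphic components occur: disjoint nonempty
  vertex sets make them distinct. Multiplicities appear only after passing to classes, in
  \<open>comps\<close>.\<close>

definition decomp :: "multigraph \<Rightarrow> multigraph set \<Rightarrow> bool" where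
  "decomp g D \<longleftrightarrow> finite D \<and> (\<forall>c\<in>D. mg_connected c) \<and>
    (\<forall>c\<in>D. \<forall>d\<in>D. c \<noteq> d \<longrightarrow> verts c \<inter> verts d = {}) \<and> g = \<Sum>D"

lemma verts_sum: "finite D \<Longrightarrow> verts (\<Sum>D) = (\<Union>c\<in>D. verts c)"
  by (induction D rule: finite_induct) (auto simp: verts_add)

lemma wf_mg_sum: "finite D \<Longrightarrow> wf_mg (\<Sum>D) \<longleftrightarrow> (\<forall>c\<in>D. wf_mg c)"
  by (induction D rule: finite_induct) (auto simp: wf_mg_add)

lemma keys_sum_mg: "finite D \<Longrightarrow> keys (\<Sum>D) = (\<Union>c\<in>(D::multigraph set). keys c)"
  by (induction D rule: finite_induct) (auto simp: keys_add_mg)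

lemma mg_size_sum: "finite D \<Longrightarrow> mg_size (\<Sum>D) = (\<Sum>c\<in>D. mg_size c)"
  by (induction D rule: finite_induct) (auto simp: mg_size_add)

lemma decomp_wf: "decomp g D \<Longrightarrow> wf_mg g"
  by (auto simp: decomp_def wf_mg_sum mg_connected_def)

lemma connected_verts_nonempty: "mg_connected c \<Longrightarrow> verts c \<noteq> {}"
  by (simp add: mg_connected_def verts_nonempty)

lemma card_verts_decomp:
  assumes "decomp g D" shows "card (verts g) = (\<Sum>c\<in>D. card (verts c))"
proof -
  have "card (\<Union>c\<in>D. verts c) = (\<Sum>c\<in>D. card (verts c))"
    using assms by (intro card_UN_disjoint) (auto simp: decomp_def mg_connected_def finite_verts)
  then show ?thesis using assms by (simp add: decomp_def verts_sum)
qed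

lemma decomp_union:
  assumes "decomp a D" "decomp b E" "verts a \<inter> verts b = {}"
  shows "decomp (a + b) (D \<union> E)" "D \<inter> E = {}"
proof -
  have sub: "verts c \<subseteq> verts a" if "c \<in> D" for c
    using that assms(1) by (auto simp: decomp_def verts_sum)
  have sub': "verts c \<subseteq> verts b" if "c \<in> E" for c
    using that assms(2) by (auto simp: decomp_def verts_sum)
  have disj: "verts c \<inter> verts d = {}" if "c \<in> D" "d \<in> E" for c d
    using sub[OF that(1)] sub'[OF that(2)] assms(3) by blast
  show DE: "D \<inter> E = {}"
  proof (rule ccontr)
    assume "D \<inter> E \<noteq> {}"
    then obtain c where c: "c \<in> D" "c \<in> E" by blast
    then have "verts c = {}" using disj by blast
    then show False using c assms(1) connected_verts_nonempty by (auto simp: decomp_def)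
  qed
  show "decomp (a + b) (D \<union> E)"
    unfolding decomp_def
  proof (intro conjI ballI impI)
    show "a + b = \<Sum> (D \<union> E)"
      using assms(1,2) DE by (simp add: decomp_def sum.union_disjoint)
    fix c d assume h: "c \<in> D \<union> E" "d \<in> D \<union> E" "c \<noteq> d"
    show "verts c \<inter> verts d = {}"
      using h disj[of c d] disj[of d c] assms(1,2) unfolding decomp_def by blast
  qed (use assms(1,2) in \<open>auto simp: decomp_def\<close>)
qed

lemma decomp_exists:
  assumes "wf_mg g" shows "\<exists>D. decomp g D"
  using assms
proof (induction "mg_size g" arbitrary: g rule: less_induct)
  case less
  consider "g = 0" | "mg_connected g" | S where "closed_in g S" "S \<noteq> {}" "S \<noteq> verts g"
    using less.prems by (auto simp: mg_connected_def)
  then show ?case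
  proof cases
    case 1
    then have "decomp g {}" by (simp add: decomp_def)
    then show ?thesis ..
  next
    case 2
    then have "decomp g {g}" by (simp add: decomp_def)
    then show ?thesis ..
  next
    case 3
    then obtain a b where ab: "g = a + b" "a \<noteq> 0" "b \<noteq> 0" "verts a \<inter> verts b = {}"
      using split_closed[OF less.prems] by metis
    then have "mg_size a < mg_size g" "mg_size b < mg_size g" "wf_mg a" "wf_mg b"
      using less.prems mg_size_eq_0_iff[of a] mg_size_eq_0_iff[of b] by (auto simp: mg_size_add wf_mg_add)
    then obtain D E where "decomp a D" "decomp b E" using less.hyps by blast
    then show ?thesis using decomp_union ab by blast
  qed
qed

lemma decomp_closed:
  assumes "decomp g D" "c \<in> D" shows "closed_in g (verts c)"
  unfolding closed_in_def
proof (intro conjI ballI)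
  show "verts c \<subseteq> verts g" using assms by (auto simp: decomp_def verts_sum)
  fix e assume "e \<in> keys g"
  then obtain d where d: "d \<in> D" "e \<in> keys d"
    using assms by (auto simp: decomp_def keys_sum_mg)
  then have "e \<subseteq> verts d" by (auto simp: verts_def)
  then show "e \<subseteq> verts c \<or> e \<inter> verts c = {}"
    using assms d(1) unfolding decomp_def by (cases "d = c") fastforce+
qed

text \<open>A component is recovered from its vertex set, so uniqueness of decompositions reduces to
  comparing vertex sets.\<close>

lemma decomp_component:
  assumes "decomp g D" "c \<in> D" shows "c = mg_restrict g (verts c)"
proof (rule poly_mapping_eqI)
  fix e
  have D: "finite D" "g = \<Sum>D" using assms by (auto simp: decomp_def)
  have g: "lookup g e = lookup c e + (\<Sum>d\<in>D - {c}. lookup d e)"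
    unfolding D(2) lookup_sum using D(1) assms(2) by (rule sum.remove)
  have other: "(\<Sum>d\<in>D - {c}. lookup d e) = 0" if "e \<subseteq> verts c"
  proof (rule sum.neutral, rule ballI)
    fix d assume d: "d \<in> D - {c}"
    show "lookup d e = 0"
    proof (rule ccontr)
      assume "lookup d e \<noteq> 0"
      then have e: "e \<in> keys d" by (simp add: in_keys_iff)
      then have "e \<subseteq> verts d" by (auto simp: verts_def)
      then have "e = {}" using d assms that unfolding decomp_def by blast
      then show False using e d assms edge_nonempty unfolding decomp_def mg_connected_def by blast
    qed
  qed
  have "lookup c e = 0" if "\<not> e \<subseteq> verts c"
    using that by (auto simp: verts_def in_keys_iff)
  then show "lookup c e = lookup (mg_restrict g (verts c)) e"
    using g other by (auto simp: lookup_mg_restrict)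
qed

lemma closed_in_component:
  assumes "decomp g D" "c \<in> D" "closed_in g S"
  shows "verts c \<inter> S = {} \<or> verts c \<subseteq> S"
proof -
  have "keys c \<subseteq> keys g"
    using assms(1,2) by (auto simp: decomp_def keys_sum_mg)
  then have "closed_in c (verts c \<inter> S)"
    using assms(3) unfolding closed_in_def verts_def by blast
  then show ?thesis using assms(1,2) unfolding decomp_def mg_connected_def by blast
qed

text \<open>Take components of the two decompositions that share a vertex. The vertex set of each is
  closed in \<open>g\<close> and meets the other, so connectedness gives both inclusions.\<close>

lemma decomp_subset:
  assumes "decomp g D" "decomp g E" shows "D \<subseteq> E"
proof
  fix c assume c: "c \<in> D"
  then obtain x where x: "x \<in> verts c"
    using assms(1) connected_verts_nonempty unfolding decomp_def by blast
  then have "x \<in> verts g" using assms(1) c by (auto simp: decomp_def verts_sum)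
  then obtain d where d: "d \<in> E" "x \<in> verts d" using assms(2) by (auto simp: decomp_def verts_sum)
  have "verts c \<subseteq> verts d" "verts d \<subseteq> verts c"
    using closed_in_component[OF assms(1) c decomp_closed[OF assms(2) d(1)]]
      closed_in_component[OF assms(2) d(1) decomp_closed[OF assms(1) c]] x d(2) by auto
  then have "c = d"
    using decomp_component[OF assms(1) c] decomp_component[OF assms(2) d(1)] by simp
  then show "c \<in> E" using d by simp
qed

lemma decomp_unique: "decomp g D \<Longrightarrow> decomp g E \<Longrightarrow> D = E"
  using decomp_subset by blast

lemma closed_in_maps_mg:
  assumes "maps_mg s g h" "closed_in h S" shows "closed_in g (s -` S)"
proof -
  have "inj s" using assms(1) by (simp add: maps_mg_def bij_def)
  show ?thesis
    unfolding closed_in_def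
  proof (intro conjI ballI)
    show "s -` S \<subseteq> verts g"
      using assms(2) \<open>inj s\<close> by (auto simp: closed_in_def verts_maps_mg[OF assms(1)] dest: injD)
    fix e assume "e \<in> keys g"
    then have "s ` e \<in> keys h" by (simp add: keys_maps_mg[OF assms(1)])
    then have "s ` e \<subseteq> S \<or> s ` e \<inter> S = {}"
      using assms(2) by (simp add: closed_in_def)
    then show "e \<subseteq> s -` S \<or> e \<inter> s -` S = {}" by auto
  qed
qed

lemma mg_connected_maps_mg:
  assumes "maps_mg s g h" "mg_connected g" shows "mg_connected h"
  unfolding mg_connected_def
proof (intro conjI allI impI)
  show "wf_mg h" using assms wf_mg_maps_mg by (simp add: mg_connected_def)
  show "h \<noteq> 0"
    using assms mg_size_maps_mg[OF assms(1)] mg_size_eq_0_iff by (auto simp: mg_connected_def)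
  fix S assume "closed_in h S"
  then have "s -` S = {} \<or> s -` S = verts g"
    using closed_in_maps_mg[OF assms(1)] assms(2) by (simp add: mg_connected_def)
  moreover have "s ` (s -` S) = S"
    using assms(1) by (intro surj_image_vimage_eq) (simp add: maps_mg_def bij_def)
  ultimately show "S = {} \<or> S = verts h" using verts_maps_mg[OF assms(1)] by (metis image_empty)
qed

lemma relabel_add: "bij s \<Longrightarrow> relabel s (g + h) = relabel s g + relabel s h"
  by (intro poly_mapping_eqI) (simp add: lookup_relabel lookup_add)

lemma relabel_zero: "bij s \<Longrightarrow> relabel s 0 = 0"
  by (intro poly_mapping_eqI) (simp add: lookup_relabel)

lemma relabel_inj: "bij s \<Longrightarrow> relabel s g = relabel s h \<Longrightarrow> g = h"
proof -
  assume s: "bij s" and eq: "relabel s g = relabel s h"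
  have "maps_mg (inv s) (relabel s g) g" by (rule maps_mg_inv[OF maps_mg_relabel[OF s]])
  moreover have "maps_mg (inv s) (relabel s g) h"
    unfolding eq by (rule maps_mg_inv[OF maps_mg_relabel[OF s]])
  ultimately show "g = h" by (rule maps_mg_unique)
qed

lemma relabel_sum:
  assumes "bij s" "finite D" shows "relabel s (\<Sum>D) = \<Sum>(relabel s ` D)"
proof -
  have "relabel s (\<Sum>D) = (\<Sum>c\<in>D. relabel s c)"
    using assms(2,1) by (induction D rule: finite_induct) (simp_all add: relabel_add relabel_zero)
  also have "\<dots> = \<Sum>(relabel s ` D)"
    using relabel_inj[OF assms(1)] by (subst sum.reindex) (auto simp: inj_on_def)
  finally show ?thesis .
qed

lemma decomp_relabel:
  assumes "maps_mg s g h" "decomp g D" shows "decomp h (relabel s ` D)"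
proof -
  have s: "bij s" using assms(1) by (simp add: maps_mg_def)
  have h: "h = relabel s g" using maps_mg_unique[OF assms(1) maps_mg_relabel[OF s]] .
  have vd: "verts (relabel s c) = s ` verts c" for c
    using verts_maps_mg[OF maps_mg_relabel[OF s]] .
  show ?thesis
    unfolding decomp_def
  proof (intro conjI ballI impI)
    show "finite (relabel s ` D)" using assms(2) by (simp add: decomp_def)
    show "h = \<Sum>(relabel s ` D)" using assms(2) relabel_sum[OF s] by (simp add: decomp_def h)
    fix c assume c: "c \<in> relabel s ` D"
    then show "mg_connected c"
      using assms(2) mg_connected_maps_mg[OF maps_mg_relabel[OF s]] by (auto simp: decomp_def)
    fix d assume d: "d \<in> relabel s ` D" "c \<noteq> d"
    from c d obtain c' d' where "c = relabel s c'" "d = relabel s d'" "c' \<in> D" "d' \<in> D" "c' \<noteq> d'"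
      by blast
    then have "verts c' \<inter> verts d' = {}" using assms(2) unfolding decomp_def by blast
    moreover have "s ` verts c' \<inter> s ` verts d' = s ` (verts c' \<inter> verts d')"
      by (rule image_Int[OF bij_is_inj[OF s], symmetric])
    ultimately show "verts c \<inter> verts d = {}"
      using \<open>c = relabel s c'\<close> \<open>d = relabel s d'\<close> by (simp only: vd image_empty)
  qed
qed

text \<open>Disjointness on both sides lets the two isomorphisms be glued to an injection on the
  vertices, which is then extended to a permutation of a finite set.\<close>

lemma mg_iso_add:
  assumes "mg_iso a a'" "mg_iso b b'" "verts a \<inter> verts b = {}" "verts a' \<inter> verts b' = {}"
    "wf_mg a" "wf_mg b"
  shows "mg_iso (a + b) (a' + b')"
proof -
  obtain s t where s: "maps_mg s a a'" and t: "maps_mg t b b'" using assms(1,2) mg_iso_def by metis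
  define f where "f x = (if x \<in> verts a then s x else t x)" for x
  have fa: "f ` verts a = verts a'" by (simp add: f_def verts_maps_mg[OF s])
  have "f ` verts b = t ` verts b" using assms(3) by (intro image_cong) (auto simp: f_def)
  then have fb: "f ` verts b = verts b'" by (simp add: verts_maps_mg[OF t])
  have "inj_on f (verts a) = inj_on s (verts a)" "inj_on f (verts b) = inj_on t (verts b)"
    using assms(3) by (auto intro!: inj_on_cong simp: f_def)
  moreover have "inj_on s (verts a)" "inj_on t (verts b)"
    using s t by (auto simp: maps_mg_def intro: inj_on_subset[OF bij_is_inj])
  ultimately have inj: "inj_on f (verts a \<union> verts b)"
    using fa fb assms(3,4) by (auto simp: inj_on_Un)
  let ?T = "verts a \<union> verts b \<union> verts a' \<union> verts b'"
  have "finite ?T" using assms finite_verts mg_iso_invariants(3) by auto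
  then obtain p where p: "p permutes ?T" "\<And>x. x \<in> verts a \<union> verts b \<Longrightarrow> p x = f x"
    using fa fb inj by (elim extend_permutation[of ?T "verts a \<union> verts b" f, rotated -1]) auto
  have "maps_mg p a a'"
    by (rule maps_mg_agree[OF s permutes_bij[OF p(1)]]) (simp add: p(2) f_def)
  moreover have "maps_mg p b b'"
    using assms(3) by (intro maps_mg_agree[OF t permutes_bij[OF p(1)]]) (auto simp: p(2) f_def)
  ultimately have "maps_mg p (a + b) (a' + b')" by (simp add: maps_mg_def lookup_add)
  then show ?thesis using mg_iso_def by blast
qed

section \<open>Multigraphs as multisets of connected classes\<close>

definition comps :: "multigraph \<Rightarrow> multigraph set multiset" where
  "comps g = image_mset mg_class (mset_set (THE D. decomp g D))"

lemma comps_eq: "decomp g D \<Longrightarrow> comps g = image_mset mg_class (mset_set D)"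
  unfolding comps_def using decomp_unique by (metis the_equality)

lemma comps_mg_iso:
  assumes "mg_iso g h" "wf_mg g" shows "comps h = comps g"
proof -
  obtain s where s: "maps_mg s g h" using assms mg_iso_def by blast
  obtain D where D: "decomp g D" using decomp_exists assms(2) by blast
  have bs: "bij s" using s by (simp add: maps_mg_def)
  have inj: "inj_on (relabel s) D" using relabel_inj[OF bs] by (auto simp: inj_on_def)
  have "mg_class (relabel s c) = mg_class c" for c
    using maps_mg_relabel[OF bs] mg_class_eq_iff mg_iso_def mg_iso_sym by blast
  then have "image_mset mg_class (mset_set (relabel s ` D)) = image_mset mg_class (mset_set D)"
    by (simp add: image_mset_mset_set[OF inj, symmetric] multiset.map_comp comp_def)
  then show ?thesis using comps_eq[OF D] comps_eq[OF decomp_relabel[OF s D]] by simp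
qed

lemma decomp_remove:
  assumes "decomp g D" "c \<in> D"
  shows "decomp (\<Sum>(D - {c})) (D - {c})" "g = c + \<Sum>(D - {c})" "verts c \<inter> verts (\<Sum>(D - {c})) = {}"
proof -
  have fin: "finite D" using assms by (simp add: decomp_def)
  show "decomp (\<Sum>(D - {c})) (D - {c})" using assms unfolding decomp_def by blast
  show "g = c + \<Sum>(D - {c})" using assms fin by (simp add: decomp_def sum.remove)
  show "verts c \<inter> verts (\<Sum>(D - {c})) = {}"
    using assms fin unfolding decomp_def by (simp add: verts_sum) blast
qed

text \<open>Induction on the number of components: a component of \<open>g\<close> is matched with
  one of \<open>h\<close> of the same class, both are removed, and the isomorphisms are glued by
  \<open>mg_iso_add\<close>.\<close>

lemma mg_iso_of_comps:
  assumes "decomp g D" "decomp h E" "image_mset mg_class (mset_set D) = image_mset mg_class (mset_set E)"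
  shows "mg_iso g h"
  using assms
proof (induction "card D" arbitrary: D E g h)
  case 0
  then have "D = {}" by (simp add: decomp_def)
  moreover from this 0 have "E = {}" by (simp add: decomp_def mset_set_empty_iff)
  ultimately have "g = 0" "h = 0" using 0 by (auto simp: decomp_def)
  then show ?case by (simp add: mg_iso_refl)
next
  case (Suc m)
  have finD: "finite D" and finE: "finite E" using Suc.prems by (auto simp: decomp_def)
  from Suc obtain c where c: "c \<in> D" by fastforce
  then have "mg_class c \<in># image_mset mg_class (mset_set E)"
    using Suc.prems(3)[symmetric] finD by simp
  then obtain d where d: "d \<in> E" "mg_class d = mg_class c" using finE by auto
  have "image_mset mg_class (mset_set (D - {c})) = image_mset mg_class (mset_set (E - {d}))"
    using Suc.prems(3) c d finD finE by (simp add: mset_set_Diff image_mset_Diff)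
  moreover have "m = card (D - {c})" using Suc.hyps(2) c finD by simp
  ultimately have "mg_iso (\<Sum>(D - {c})) (\<Sum>(E - {d}))"
    using Suc.hyps(1)[OF _ decomp_remove(1)[OF Suc.prems(1) c] decomp_remove(1)[OF Suc.prems(2) d(1)]]
    by blast
  then show ?case
    using decomp_remove[OF Suc.prems(1) c] decomp_remove[OF Suc.prems(2) d(1)] d(2)
      mg_iso_add[of c d "\<Sum>(D - {c})" "\<Sum>(E - {d})"] Suc.prems(1) c decomp_wf
    by (auto simp: mg_class_eq_iff[symmetric] decomp_def mg_connected_def)
qed

definition nv :: "multigraph set \<Rightarrow> nat" where
  "nv q = card (verts (SOME g. g \<in> q))"

definition ne :: "multigraph set \<Rightarrow> nat" where
  "ne q = mg_size (SOME g. g \<in> q)"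

lemma class_rep: "mg_iso g (SOME h. h \<in> mg_class g)"
  using someI[of "\<lambda>h. h \<in> mg_class g", OF mem_mg_class_self] by (simp add: mg_class_def)

lemma nv_class: "nv (mg_class g) = card (verts g)"
  unfolding nv_def using mg_iso_invariants(1)[OF class_rep] .

lemma ne_class: "ne (mg_class g) = mg_size g"
  unfolding ne_def using mg_iso_invariants(2)[OF class_rep] .

definition conn_classes :: "nat \<Rightarrow> nat \<Rightarrow> multigraph set set" where
  "conn_classes V K = {mg_class c | c. mg_connected c \<and> card (verts c) \<le> V \<and> mg_size c \<le> K}"

lemma comps_weights:
  assumes "wf_mg g"
  shows "(\<Sum>q\<in>#comps g. nv q) = card (verts g)" "(\<Sum>q\<in>#comps g. ne q) = mg_size g"
proof -
  obtain D where D: "decomp g D" using decomp_exists assms by blast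
  have "(\<Sum>q\<in>#comps g. nv q) = (\<Sum>c\<in>D. card (verts c))"
    by (simp add: comps_eq[OF D] multiset.map_comp comp_def nv_class sum_unfold_sum_mset)
  then show "(\<Sum>q\<in>#comps g. nv q) = card (verts g)" by (simp add: card_verts_decomp[OF D])
  have "(\<Sum>q\<in>#comps g. ne q) = (\<Sum>c\<in>D. mg_size c)"
    by (simp add: comps_eq[OF D] multiset.map_comp comp_def ne_class sum_unfold_sum_mset)
  also have "\<dots> = mg_size g" using D by (simp add: decomp_def mg_size_sum)
  finally show "(\<Sum>q\<in>#comps g. ne q) = mg_size g" .
qed

lemma mg_size_pos: "mg_connected c \<Longrightarrow> 0 < mg_size c"
  using mg_size_eq_0_iff[of c] by (auto simp: mg_connected_def)

lemma class_in_image: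
  assumes "wf_mg g" "card (verts g) \<le> n"
  shows "mg_class g \<in> mg_class ` {h \<in> multigraphs n. mg_size h = mg_size g}"
proof -
  obtain h where h: "mg_iso g h" "verts h \<subseteq> {1..n}"
    using relocate[OF assms(1), of "{1..n}"] assms(2) by auto
  then have "h \<in> multigraphs n" "mg_size h = mg_size g" "mg_class g = mg_class h"
    using mg_iso_invariants[OF h(1)] assms(1) by (auto simp: multigraphs_alt mg_class_eq_iff)
  then show ?thesis by blast
qed

lemma finite_conn_classes: "finite (conn_classes V K)"
proof (rule finite_subset)
  show "conn_classes V K \<subseteq> (\<Union>k\<le>K. mg_class ` {g \<in> multigraphs V. mg_size g = k})"
    using class_in_image by (fastforce simp: conn_classes_def mg_connected_def)
qed (simp add: finite_multigraphs_size)

lemma ne_conn_classes: "q \<in> conn_classes V K \<Longrightarrow> 1 \<le> ne q"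
  using mg_size_pos by (auto simp: conn_classes_def ne_class Suc_le_eq)

lemma realize_comps:
  assumes "set_mset M \<subseteq> {mg_class c | c. mg_connected c}"
  shows "\<exists>g. wf_mg g \<and> comps g = M"
  using assms
proof (induction M)
  case empty
  have "decomp 0 {}" by (simp add: decomp_def)
  then have "comps 0 = {#}" by (simp add: comps_eq)
  then show ?case using wf_mg_zero by blast
next
  case (add q M)
  then obtain g where g: "wf_mg g" "comps g = M" by auto
  obtain c where c: "mg_connected c" "q = mg_class c" using add.prems by auto
  then have wfc: "wf_mg c" by (simp add: mg_connected_def)
  \<comment> \<open>Since the vertices range over all of \<open>nat\<close>, there is always room
    for a copy of \<open>c\<close> disjoint from \<open>g\<close>.\<close>
  obtain T where T: "finite T" "card T = card (verts c)" "T \<inter> verts g = {}"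
    using infinite_arbitrarily_large[of "- verts g" "card (verts c)"] finite_verts[OF g(1)]
    by (metis Compl_disjoint Int_commute disjoint_iff infinite_UNIV_nat finite_compl subsetD)
  obtain d where d: "mg_iso c d" "verts d \<subseteq> T"
    using relocate[OF wfc T(1)] T(2) by auto
  have dc: "mg_connected d" using d(1) c(1) mg_connected_maps_mg mg_iso_def by blast
  obtain D where D: "decomp g D" using decomp_exists g by blast
  have "decomp d {d}" using dc by (simp add: decomp_def)
  moreover have "verts d \<inter> verts g = {}" using d T by blast
  ultimately have u: "decomp (d + g) ({d} \<union> D)" "{d} \<inter> D = {}" using decomp_union D by blast+
  have "comps (d + g) = add_mset (mg_class d) (comps g)"
  proof -
    have "finite D" using D by (simp add: decomp_def)
    then show ?thesis using u(2) unfolding comps_eq[OF u(1)] comps_eq[OF D] by simp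
  qed
  moreover have "mg_class d = q" using d(1) c(2) mg_class_eq_iff by blast
  ultimately show ?case using g(2) decomp_wf[OF u(1)] by auto
qed

text \<open>The multiset of component classes is a complete isomorphism invariant, and every
  multiset with at most \<open>n\<close> vertices is realized on \<open>{1..n}\<close>, the vertices
  left over being isolated. No component exceeds the bounds \<open>V\<close> and
  \<open>K\<close>.\<close>

theorem unl_eq_card_wmsets:
  assumes "n \<le> V" "k \<le> K"
  shows "unl n k = card (wmsets (conn_classes V K) nv ne n k)"
proof -
  let ?X = "{g \<in> multigraphs n. mg_size g = k}"
  let ?f = "\<lambda>q. comps (SOME g. g \<in> q)"
  have f: "?f (mg_class g) = comps g" if "wf_mg g" for g
    using comps_mg_iso[OF class_rep that] .
  have "bij_betw ?f (mg_class ` ?X) (wmsets (conn_classes V K) nv ne n k)"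
  proof (rule bij_betw_imageI)
    show "inj_on ?f (mg_class ` ?X)"
    proof (rule inj_onI, elim imageE)
      fix q r g h assume h: "?f q = ?f r" "q = mg_class g" "g \<in> ?X" "r = mg_class h" "h \<in> ?X"
      then have wf: "wf_mg g" "wf_mg h" by (auto simp: multigraphs_alt)
      then obtain D E where "decomp g D" "decomp h E" using decomp_exists by blast
      moreover have "comps g = comps h" using h f wf by simp
      ultimately show "q = r" using mg_iso_of_comps comps_eq h by (metis mg_class_eq_iff)
    qed
    show "?f ` mg_class ` ?X = wmsets (conn_classes V K) nv ne n k"
    proof (intro equalityI subsetI)
      fix M assume "M \<in> ?f ` mg_class ` ?X"
      then obtain g where g: "g \<in> ?X" "M = ?f (mg_class g)" by blast
      then have wf: "wf_mg g" and v: "card (verts g) \<le> n"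
        using card_mono[of "{1..n}" "verts g"] by (auto simp: multigraphs_alt)
      have M: "M = comps g" using g f wf by simp
      obtain D where D: "decomp g D" using decomp_exists wf by blast
      have "mg_class c \<in> conn_classes V K" if "c \<in> D" for c
      proof -
        have "card (verts c) \<le> card (verts g)" "mg_size c \<le> mg_size g"
          using that D unfolding card_verts_decomp[OF D]
          by (auto simp: decomp_def mg_size_sum intro: member_le_sum)
        then show ?thesis using that D v g assms unfolding conn_classes_def decomp_def by force
      qed
      moreover have "finite D" using D by (simp add: decomp_def)
      ultimately have "set_mset (comps g) \<subseteq> conn_classes V K" by (auto simp: comps_eq[OF D])
      moreover have "mg_size g = k" using g(1) by simp
      ultimately show "M \<in> wmsets (conn_classes V K) nv ne n k"
        using v unfolding M wmsets_def by (simp add: comps_weights[OF wf])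
    next
      fix M assume M: "M \<in> wmsets (conn_classes V K) nv ne n k"
      then obtain g where g: "wf_mg g" "comps g = M"
        using realize_comps[of M] by (auto simp: wmsets_def conn_classes_def)
      then have "card (verts g) \<le> n" "mg_size g = k"
        using M comps_weights[OF g(1)] by (auto simp: wmsets_def)
      then have "mg_class g \<in> mg_class ` ?X" using class_in_image[OF g(1)] by blast
      then have "?f (mg_class g) \<in> ?f ` mg_class ` ?X" by (rule imageI)
      then show "M \<in> ?f ` mg_class ` ?X" by (simp only: f[OF g(1)] g(2))
    qed
  qed
  then show ?thesis unfolding unl_def by (rule bij_betw_same_card)
qed

section \<open>Products of orbit sums\<close>

lemma finite_below: "finite {a :: multigraph. \<forall>e. lookup a e \<le> lookup h e}"
proof -
  let ?X = "{a :: multigraph. \<forall>e. lookup a e \<le> lookup h e}"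
  let ?P = "keys h"
  let ?f = "\<lambda>a e. if e \<in> ?P then lookup a e else undefined"
  have "?f ` ?X \<subseteq> (\<Pi>\<^sub>E e\<in>?P. {..lookup h e})"
    by (auto simp: PiE_iff extensional_def)
  moreover have "inj_on ?f ?X"
  proof (intro inj_onI poly_mapping_eqI)
    fix a b e assume h: "a \<in> ?X" "b \<in> ?X" "?f a = ?f b"
    show "lookup a e = lookup b e"
    proof (cases "e \<in> ?P")
      case True then show ?thesis using fun_cong[OF h(3), of e] by simp
    next
      case False
      then have "lookup h e = 0" by (simp add: in_keys_iff)
      then show ?thesis using h(1,2) by (metis le_zero_eq mem_Collect_eq)
    qed
  qed
  ultimately show ?thesis by (meson finite_PiE finite_atMost finite_imageD finite_keys finite_subset)
qed

definition splits :: "multigraph \<Rightarrow> (multigraph \<times> multigraph) set" where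
  "splits h = {(a, b). a + b = h}"

lemma finite_splits: "finite (splits h)"
proof (rule finite_subset)
  let ?X = "{a :: multigraph. \<forall>e. lookup a e \<le> lookup h e}"
  show "splits h \<subseteq> ?X \<times> ?X" by (auto simp: splits_def lookup_add)
  show "finite (?X \<times> ?X)" using finite_below by blast
qed

lemma lookup_mult_splits:
  fixes p q :: "'k::comm_ring_1 edge_poly"
  shows "lookup (p * q) h =
    (\<Sum>(a, b)\<in>splits h. lookup p a * lookup q b)"
proof -
  have mono: "(\<Sum>a\<in>keys r. single a (lookup r a)) = r"
    for r :: "'k edge_poly"
    by (rule poly_mapping_eqI) (auto simp: lookup_sum lookup_single when_def in_keys_iff)
  have "p * q = (\<Sum>a\<in>keys p. \<Sum>b\<in>keys q.
      single (a + b) (lookup p a * lookup q b))"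
  proof -
    have "p * q = (\<Sum>a\<in>keys p. single a (lookup p a)) *
        (\<Sum>b\<in>keys q. single b (lookup q b))"
      by (simp only: mono)
    then show ?thesis by (simp only: sum_product mult_single)
  qed
  then have "lookup (p * q) h = (\<Sum>(a, b)\<in>keys p \<times> keys q.
      if a + b = h then lookup p a * lookup q b else 0)"
    by (simp add: lookup_sum lookup_single when_def sum.cartesian_product case_prod_unfold)
  also have "\<dots> = (\<Sum>x\<in>keys p \<times> keys q. if x \<in> splits h
      then (case x of (a, b) \<Rightarrow> lookup p a * lookup q b) else 0)"
    by (intro sum.cong) (auto simp: splits_def)
  also have "\<dots> = (\<Sum>(a, b)\<in>keys p \<times> keys q \<inter> splits h.
      lookup p a * lookup q b)"
    by (rule sum.inter_restrict[symmetric]) simp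
  also have "\<dots> = (\<Sum>(a, b)\<in>splits h. lookup p a * lookup q b)"
    by (rule sum.mono_neutral_left[OF finite_splits]) (auto simp: in_keys_iff)
  finally show ?thesis .
qed

text \<open>Indexing by the class frees the orbit sum from a representative, as needed for multisets
  of factors. A class contains multigraphs on all of \<open>nat\<close>, hence the
  intersection.\<close>

definition osum :: "nat \<Rightarrow> multigraph set \<Rightarrow> 'k::comm_ring_1 edge_poly" where
  "osum n q = (\<Sum>h\<in>q \<inter> multigraphs n. single h 1)"

lemma finite_class_Int: "finite (mg_class g \<inter> multigraphs n)"
  by (rule finite_subset[OF _ finite_multigraphs_size[of n "mg_size g"]])
    (auto simp: mg_class_def dest: mg_iso_invariants)

lemma lookup_osum:
  "lookup (osum n (mg_class g) :: 'k::comm_ring_1 edge_poly) h =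
    (if h \<in> multigraphs n \<and> mg_iso g h then 1 else 0)"
  using finite_class_Int[of g n]
  by (auto simp: osum_def lookup_sum lookup_single when_def mg_class_def)

lemma keys_osum:
  "keys (osum n (mg_class g) :: 'k::comm_ring_1 edge_poly) = mg_class g \<inter> multigraphs n"
proof (rule set_eqI)
  fix h
  show "h \<in> keys (osum n (mg_class g) :: 'k edge_poly) \<longleftrightarrow> h \<in> mg_class g \<inter> multigraphs n"
    by (simp add: in_keys_iff lookup_osum) (auto simp: mg_class_def)
qed

lemma Var_power:
  "(Var e :: 'k::comm_ring_1 edge_poly) ^ m = single (single e m) 1"
proof (induction m)
  case (Suc m)
  then show ?case by (simp add: Var_def mult_single single_add[symmetric])
qed simp

lemma prod_single:
  "finite A \<Longrightarrow> (\<Prod>e\<in>A. single (f e) (1::'k::comm_ring_1)) =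
    single (\<Sum>e\<in>A. f e) 1"
  by (induction A rule: finite_induct) (simp_all add: mult_single)

lemma prod_Var_relabel:
  assumes "bij s" "finite P" "keys m \<subseteq> P"
  shows "(\<Prod>e\<in>P. (Var (s ` e) :: 'k::comm_ring_1 edge_poly) ^ lookup m e) =
    single (relabel s m) 1"
proof -
  have "(\<Sum>e\<in>P. single (s ` e) (lookup m e)) = relabel s m"
  proof (rule poly_mapping_eqI)
    fix e'
    have "s ` e = e' \<longleftrightarrow> e = inv s ` e'" for e
      using assms(1) by (metis bij_is_inj bij_is_surj image_f_inv_f image_inv_f_f)
    then have "lookup (\<Sum>e\<in>P. single (s ` e) (lookup m e)) e' =
        (\<Sum>e\<in>P. if e = inv s ` e' then lookup m e else 0)"
      by (simp add: lookup_sum lookup_single when_def)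
    also have "\<dots> = lookup m (inv s ` e')"
      using assms(2,3) by (auto simp: in_keys_iff)
    finally show "lookup (\<Sum>e\<in>P. single (s ` e) (lookup m e)) e' =
        lookup (relabel s m) e'" by (simp add: lookup_relabel[OF assms(1)])
  qed
  then show ?thesis using assms(2) by (simp add: Var_power prod_single)
qed

lemma graph_monomial_eq_single:
  assumes "h \<in> multigraphs n"
  shows "(graph_monomial n h :: 'k::comm_ring_1 edge_poly) = single h 1"
proof -
  have "h = relabel id h" using maps_mg_unique[OF maps_mg_id maps_mg_relabel] by simp
  then show ?thesis
    using prod_Var_relabel[of id "pairs n" h] assms finite_pairs
    by (simp add: graph_monomial_def multigraphs_def)
qed

lemma orbit_sum_eq_osum:
  assumes "g \<in> multigraphs n"
  shows "(orbit_sum n g :: 'k::comm_ring_1 edge_poly) = osum n (mg_class g)"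
  unfolding orbit_sum_def osum_def
  using isomorphic_iff_mg_iso[OF assms]
  by (intro sum.cong) (auto simp: graph_monomial_eq_single mg_class_def)

lemma orbit_sum_invariant:
  assumes "g \<in> multigraphs n"
  shows "(orbit_sum n g :: 'k::comm_ring_1 edge_poly) \<in> invariants n"
proof -
  let ?p = "osum n (mg_class g) :: 'k edge_poly" and ?H = "mg_class g \<inter> multigraphs n"
  note keys = keys_osum[of n g, where ?'k = 'k]
  have "act s ?p = ?p" if s: "s permutes {1..n}" for s
  proof -
    note bs = permutes_bij[OF s]
    have "act s ?p = (\<Sum>m\<in>?H. single (relabel s m) 1)"
      unfolding act_def keys
    proof (rule sum.cong[OF refl])
      fix m assume m: "m \<in> ?H"
      then have "mg_iso g m" "m \<in> multigraphs n" by (auto simp: mg_class_def)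
      then have "lookup ?p m = 1" by (simp add: lookup_osum)
      then have "(Const (lookup ?p m) :: 'k edge_poly) = 1"
        by (simp add: Const_def)
      then show "Const (lookup ?p m) *
          (\<Prod>e\<in>keys m. Var (s ` e) ^ lookup m e) =
          (single (relabel s m) 1 :: 'k edge_poly)"
        using prod_Var_relabel[OF bs finite_keys order_refl, of m] by simp
    qed
    also have "\<dots> = (\<Sum>m\<in>relabel s ` ?H. single m 1)"
      using relabel_inj[OF bs] by (subst sum.reindex) (auto simp: inj_on_def)
    also have "relabel s ` ?H = ?H"
    proof (rule endo_inj_surj[OF finite_class_Int])
      have "mg_iso g (relabel s m)" if "mg_iso g m" for m
        using that maps_mg_relabel[OF bs, of m] mg_iso_def mg_iso_trans by blast
      then show "relabel s ` ?H \<subseteq> ?H"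
        using relabel_multigraphs[OF s] by (auto simp: mg_class_def)
      show "inj_on (relabel s) ?H" using relabel_inj[OF bs] by (auto simp: inj_on_def)
    qed
    finally show ?thesis by (simp add: osum_def)
  qed
  then show ?thesis
    by (simp add: orbit_sum_eq_osum[OF assms] invariants_def poly_ring_def keys)
qed

text \<open>Invariance expressed through coefficients. In this form it passes to sums and products
  without any reference to the substitution \<open>act\<close>, and it allows shapes to be renamed
  at will.\<close>

definition class_fun :: "nat \<Rightarrow> 'k::comm_ring_1 edge_poly \<Rightarrow> bool" where
  "class_fun n p \<longleftrightarrow> keys p \<subseteq> multigraphs n \<and>
    (\<forall>g\<in>multigraphs n. \<forall>h\<in>multigraphs n. mg_iso g h \<longrightarrow>
      lookup p g = lookup p h)"

lemma class_fun_osum: "class_fun n (osum n (mg_class g))"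
  unfolding class_fun_def
proof (intro conjI ballI impI)
  show "keys (osum n (mg_class g)) \<subseteq> multigraphs n"
    by (auto simp: in_keys_iff lookup_osum split: if_splits)
  fix h k assume h: "h \<in> multigraphs n" "k \<in> multigraphs n" "mg_iso h k"
  then have "mg_iso g h \<longleftrightarrow> mg_iso g k" using mg_iso_trans mg_iso_sym by metis
  with h show "lookup (osum n (mg_class g)) h = lookup (osum n (mg_class g)) k"
    by (simp add: lookup_osum)
qed

text \<open>Stated through coefficients so as to cover the difference with a scalar multiple in
  \<open>osum_in_span_conn_products\<close> as well as sums, by taking
  \<open>N = - 1\<close>.\<close>

lemma class_fun_lincomb:
  fixes p r s :: "'k::comm_ring_1 edge_poly"
  assumes "class_fun n p" "class_fun n r"
    and s: "\<And>h. lookup s h = lookup p h - N * lookup r h"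
  shows "class_fun n s"
  unfolding class_fun_def
proof (intro conjI ballI impI subsetI)
  fix h assume h: "h \<in> keys s"
  show "h \<in> multigraphs n"
  proof (rule ccontr)
    assume "h \<notin> multigraphs n"
    then have "h \<notin> keys p" "h \<notin> keys r"
      using assms(1,2) unfolding class_fun_def by blast+
    then show False using h by (simp add: in_keys_iff s)
  qed
next
  fix g h assume "g \<in> multigraphs n" "h \<in> multigraphs n" "mg_iso g h"
  then have "lookup p g = lookup p h"
    "lookup r g = lookup r h"
    using assms(1,2) unfolding class_fun_def by blast+
  then show "lookup s g = lookup s h" by (simp add: s)
qed

lemma multigraphs_add: "a + b \<in> multigraphs n \<longleftrightarrow> a \<in> multigraphs n \<and> b \<in> multigraphs n"
  by (auto simp: multigraphs_def keys_add_mg)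

text \<open>A relabelling that carries \<open>g\<close> to \<open>h\<close> also carries the ways of
  splitting \<open>g\<close> bijectively to those of splitting \<open>h\<close>, without changing
  the coefficients of the factors.\<close>

lemma class_fun_mult:
  fixes p q :: "'k::comm_ring_1 edge_poly"
  assumes "class_fun n p" "class_fun n q" shows "class_fun n (p * q)"
  unfolding class_fun_def
proof (intro conjI ballI impI)
  have "\<exists>a b. m = a + b \<and> a \<in> keys p \<and> b \<in> keys q"
    if "m \<in> keys (p * q)" for m
    using that keys_mult[of p q] by blast
  then show "keys (p * q) \<subseteq> multigraphs n"
    using assms multigraphs_add unfolding class_fun_def by blast
  fix g h assume gh: "g \<in> multigraphs n" "h \<in> multigraphs n" "mg_iso g h"
  then obtain s where s: "s permutes {1..n}" "maps_mg s g h" by (rule mg_iso_permutes)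
  note bs = permutes_bij[OF s(1)]
  have h: "h = relabel s g" using maps_mg_unique[OF s(2) maps_mg_relabel[OF bs]] .
  have g: "g = relabel (inv s) h"
    using maps_mg_unique[OF maps_mg_inv[OF s(2)] maps_mg_relabel[OF bij_imp_bij_inv[OF bs]]] .
  have inv1: "relabel (inv s) (relabel s a) = a" for a
    using maps_mg_unique[OF maps_mg_relabel[OF bij_imp_bij_inv[OF bs]] maps_mg_inv[OF maps_mg_relabel[OF bs]]] .
  have inv2: "relabel s (relabel (inv s) a) = a" for a
    using inv1 relabel_inj[OF bij_imp_bij_inv[OF bs]] by blast
  have "bij_betw (\<lambda>(a, b). (relabel s a, relabel s b)) (splits g) (splits h)"
  proof (rule bij_betw_byWitness[where f' = "\<lambda>(a, b). (relabel (inv s) a, relabel (inv s) b)"])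
    show "(\<lambda>(a, b). (relabel s a, relabel s b)) ` splits g \<subseteq> splits h"
      by (auto simp: splits_def h relabel_add[OF bs])
    show "(\<lambda>(a, b). (relabel (inv s) a, relabel (inv s) b)) ` splits h \<subseteq> splits g"
      by (auto simp: splits_def g relabel_add[OF bij_imp_bij_inv[OF bs]])
  qed (auto simp: inv1 inv2)
  then have "(\<Sum>x\<in>splits g. case (\<lambda>(a, b). (relabel s a, relabel s b)) x of
        (a, b) \<Rightarrow> lookup p a * lookup q b) =
      (\<Sum>(a, b)\<in>splits h. lookup p a * lookup q b)"
    by (rule sum.reindex_bij_betw)
  moreover have "(\<Sum>x\<in>splits g. case (\<lambda>(a, b). (relabel s a, relabel s b)) x of
        (a, b) \<Rightarrow> lookup p a * lookup q b) =
      (\<Sum>(a, b)\<in>splits g. lookup p a * lookup q b)"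
  proof (rule sum.cong[OF refl])
    fix x assume x: "x \<in> splits g"
    obtain a b where ab: "x = (a, b)" by force
    then have "a \<in> multigraphs n" "b \<in> multigraphs n"
      using x gh(1) multigraphs_add by (auto simp: splits_def)
    moreover have "mg_iso c (relabel s c)" for c
      using maps_mg_relabel[OF bs] mg_iso_def by blast
    ultimately have "lookup p (relabel s a) = lookup p a"
      "lookup q (relabel s b) = lookup q b"
      using assms relabel_multigraphs[OF s(1)] unfolding class_fun_def by metis+
    then show "(case (\<lambda>(a, b). (relabel s a, relabel s b)) x of
        (a, b) \<Rightarrow> lookup p a * lookup q b) =
      (case x of (a, b) \<Rightarrow> lookup p a * lookup q b)"
      by (simp add: ab)
  qed
  ultimately show "lookup (p * q) g = lookup (p * q) h"
    by (simp add: lookup_mult_splits)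
qed

section \<open>Linear span of the products of connected orbit sums\<close>

interpretation edge_poly: vector_space "\<lambda>(c::'k::field) (p::'k edge_poly). Const c * p"
proof
  fix a b :: 'k and x y :: "'k edge_poly"
  show "Const a * (x + y) = Const a * x + Const a * y" by (rule distrib_left)
  show "Const (a + b) * x = Const a * x + Const b * x"
    by (simp add: Const_def single_add distrib_right)
  show "Const a * (Const b * x) = Const (a * b) * x"
    by (simp add: Const_def mult_single mult.assoc[symmetric])
  show "Const 1 * x = x" by (simp add: Const_def)
qed

lemma lookup_Const_mult:
  "lookup (Const c * p) h = c * lookup (p :: 'k::comm_ring_1 edge_poly) h"
proof -
  have "lookup (Const c * p) h =
      (\<Sum>(a, b)\<in>splits h. if a = 0 then c * lookup p b else 0)"
    unfolding lookup_mult_splits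
    by (intro sum.cong) (auto simp: Const_def lookup_single when_def)
  also have "\<dots> = (\<Sum>(a, b)\<in>{(0 :: multigraph, h)}. if a = 0 then c * lookup p b else 0)"
    by (rule sum.mono_neutral_right[OF finite_splits]) (auto simp: splits_def split: if_splits)
  finally show ?thesis by simp
qed

lemma class_fun_span:
  fixes p :: "'k::field edge_poly"
  assumes "class_fun n p"
  shows "p \<in> edge_poly.span (osum n ` mg_class ` keys p)"
proof -
  let ?c = "\<lambda>q. lookup p (SOME g. g \<in> q \<and> g \<in> multigraphs n)"
  have c: "?c (mg_class g) = lookup p g" if g: "g \<in> multigraphs n" for g
  proof -
    define t where "t = (SOME h. h \<in> mg_class g \<and> h \<in> multigraphs n)"
    have "t \<in> mg_class g \<and> t \<in> multigraphs n"
      unfolding t_def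
      by (rule someI[of "\<lambda>h. h \<in> mg_class g \<and> h \<in> multigraphs n" g])
        (use g mem_mg_class_self in blast)
    then have t: "mg_iso g t" "t \<in> multigraphs n" by (auto simp: mg_class_def)
    then have "lookup p g = lookup p t"
      using assms g unfolding class_fun_def by blast
    then show ?thesis by (simp add: t_def)
  qed
  have "p = (\<Sum>q\<in>mg_class ` keys p. Const (?c q) * osum n q)"
  proof (rule poly_mapping_eqI)
    fix h
    have "lookup (\<Sum>q\<in>mg_class ` keys p. Const (?c q) * osum n q) h =
        (\<Sum>q\<in>mg_class ` keys p. if q = mg_class h then
          (if h \<in> multigraphs n then lookup p h else 0) else 0)"
      unfolding lookup_sum lookup_Const_mult
    proof (rule sum.cong[OF refl])
      fix q assume "q \<in> mg_class ` keys p"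
      then obtain g where "q = mg_class g" by blast
      then show "?c q * lookup (osum n q) h = (if q = mg_class h then
          (if h \<in> multigraphs n then lookup p h else 0) else 0)"
        using c[of h] mg_class_eq_iff[of g h] by (auto simp: lookup_osum)
    qed
    also have "\<dots> = (if mg_class h \<in> mg_class ` keys p \<and> h \<in> multigraphs n
        then lookup p h else 0)"
      by simp
    also have "\<dots> = lookup p h"
      using assms unfolding class_fun_def by (auto simp: in_keys_iff)
    finally show "lookup p h =
      lookup (\<Sum>q\<in>mg_class ` keys p. Const (?c q) * osum n q) h" ..
  qed
  also have "\<dots> \<in> edge_poly.span (osum n ` mg_class ` keys p)"
    by (intro edge_poly.span_sum edge_poly.span_scale edge_poly.span_base) blast
  finally show ?thesis .
qed

text \<open>Only the individual factors are bounded by \<open>V\<close>. Together they may have more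
  than \<open>n\<close> vertices, in which case their copies overlap in every term of the
  product.\<close>

definition conn_products :: "nat \<Rightarrow> nat \<Rightarrow> 'k::comm_ring_1 edge_poly set" where
  "conn_products n V = (\<lambda>M. \<Prod>q\<in>#M. osum n q) `
    {M. set_mset M \<subseteq> {mg_class c | c. mg_connected c \<and> card (verts c) \<le> V}}"

lemma conn_products_one: "1 \<in> conn_products n V"
  unfolding conn_products_def by (rule image_eqI[of _ _ "{#}"]) auto

lemma conn_products_mult:
  "x \<in> conn_products n V \<Longrightarrow> y \<in> conn_products n V \<Longrightarrow> x * y \<in> conn_products n V"
  unfolding conn_products_def
proof (elim imageE)
  fix M N assume h: "x = (\<Prod>q\<in>#M. osum n q)" "y = (\<Prod>q\<in>#N. osum n q)"
    "M \<in> {M. set_mset M \<subseteq> {mg_class c | c. mg_connected c \<and> card (verts c) \<le> V}}"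
    "N \<in> {M. set_mset M \<subseteq> {mg_class c | c. mg_connected c \<and> card (verts c) \<le> V}}"
  show "x * y \<in> (\<lambda>M. \<Prod>q\<in>#M. osum n q) `
    {M. set_mset M \<subseteq> {mg_class c | c. mg_connected c \<and> card (verts c) \<le> V}}"
    using h by (intro image_eqI[of _ _ "M + N"]) auto
qed

lemma span_mult_closed:
  fixes Z :: "'k::field edge_poly set"
  assumes Z: "\<And>x y. x \<in> Z \<Longrightarrow> y \<in> Z \<Longrightarrow> x * y \<in> Z"
    and p: "p \<in> edge_poly.span Z" and q: "q \<in> edge_poly.span Z"
  shows "p * q \<in> edge_poly.span Z"
proof -
  have one: "z * q \<in> edge_poly.span Z" if z: "z \<in> Z" for z
    using q
  proof (induction rule: edge_poly.span_induct)
    case base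
    show ?case
    proof (rule edge_poly.subspaceI, goal_cases)
      case (3 c x)
      then have "Const c * (z * x) \<in> edge_poly.span Z" by (auto intro: edge_poly.span_scale)
      then show ?case by (simp add: mult.left_commute)
    qed (auto simp: distrib_left intro: edge_poly.span_add edge_poly.span_zero)
  qed (use z Z in \<open>auto intro: edge_poly.span_base\<close>)
  show ?thesis
    using p
  proof (induction rule: edge_poly.span_induct)
    case base
    show ?case
    proof (rule edge_poly.subspaceI, goal_cases)
      case (3 c x)
      then have "Const c * (x * q) \<in> edge_poly.span Z" by (auto intro: edge_poly.span_scale)
      then show ?case by (simp add: mult.assoc)
    qed (auto simp: distrib_right intro: edge_poly.span_add edge_poly.span_zero)
  qed (rule one)
qed

text \<open>Up to graphs on fewer vertices and a nonzero factor, the product of the orbit sums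
  of \<open>a\<close> and \<open>b\<close> is the orbit sum of their disjoint union.\<close>

lemma osum_in_span_conn_products:
  assumes "g \<in> multigraphs n" "card (verts g) \<le> V"
  shows "(osum n (mg_class g) :: 'k::field_char_0 edge_poly) \<in> edge_poly.span (conn_products n V)"
  using assms
proof (induction "card (verts g)" arbitrary: g rule: less_induct)
  case less
  let ?Z = "conn_products n V :: 'k edge_poly set"
  have wf: "wf_mg g" using less.prems by (simp add: multigraphs_alt)
  consider "g = 0" | "mg_connected g" | S where "closed_in g S" "S \<noteq> {}" "S \<noteq> verts g"
    using wf by (auto simp: mg_connected_def)
  then show ?case
  proof cases
    case 1
    have "mg_iso 0 h \<longleftrightarrow> h = 0" for h
      using mg_iso_invariants(2) mg_iso_refl mg_size_eq_0_iff by (metis mg_size_zero)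
    then have "(osum n (mg_class g) :: 'k edge_poly) = 1"
      using less.prems 1 by (intro poly_mapping_eqI) (auto simp: lookup_osum lookup_one when_def)
    then show ?thesis using conn_products_one edge_poly.span_base by metis
  next
    case 2
    then have "(osum n (mg_class g) :: 'k edge_poly) \<in> ?Z"
      using less.prems unfolding conn_products_def
      by (intro image_eqI[of _ _ "{#mg_class g#}"]) auto
    then show ?thesis by (rule edge_poly.span_base)
  next
    case 3
    then obtain a b where ab: "g = a + b" "a \<noteq> 0" "b \<noteq> 0" "verts a \<inter> verts b = {}"
      using split_closed[OF wf] by metis
    have mab: "a \<in> multigraphs n" "b \<in> multigraphs n" and wab: "wf_mg a" "wf_mg b"
      using less.prems(1) wf ab by (auto simp: multigraphs_add wf_mg_add)
    have cv: "card (verts g) = card (verts a) + card (verts b)"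
      using ab finite_verts wab by (simp add: verts_add card_Un_disjoint)
    moreover have "card (verts a) > 0" "card (verts b) > 0"
      using verts_nonempty wab ab finite_verts by (auto simp: card_gt_0_iff)
    ultimately have small: "card (verts a) < card (verts g)" "card (verts b) < card (verts g)" by auto
    let ?A = "osum n (mg_class a) :: 'k edge_poly" and ?B = "osum n (mg_class b) :: 'k edge_poly"
    let ?G = "osum n (mg_class g) :: 'k edge_poly"
    have AB: "?A \<in> edge_poly.span ?Z" "?B \<in> edge_poly.span ?Z"
      using less.hyps mab small less.prems(2) by auto
    \<comment> \<open>The number of ways in which \<open>g\<close> arises as a copy of
      \<open>a\<close> plus a copy of \<open>b\<close>; subtracting \<open>N\<close> times the orbit
      sum removes the class of \<open>g\<close> from the product.\<close>
    define N where "N = lookup (?A * ?B) g"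
    let ?Q = "?A * ?B - Const N * ?G"
    have cf: "class_fun n (?A * ?B)" using class_fun_mult class_fun_osum by blast
    have lQ: "lookup ?Q h =
        lookup (?A * ?B) h - N * lookup ?G h" for h
      by (simp add: lookup_minus lookup_Const_mult)
    have cfQ: "class_fun n ?Q"
      by (rule class_fun_lincomb[OF cf class_fun_osum lQ])
    \<comment> \<open>Every term of the product is a copy of \<open>a\<close> plus a copy of
      \<open>b\<close>. If these are disjoint, the term is isomorphic to \<open>g\<close> and has
      been cancelled; otherwise they share a vertex and the total number of vertices drops.\<close>
    have smallQ: "card (verts h) < card (verts g)" if h: "h \<in> keys ?Q" for h
    proof -
      have hn: "h \<in> multigraphs n" using h cfQ by (auto simp: class_fun_def)
      have notg: "\<not> mg_iso g h"
      proof
        assume "mg_iso g h"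
        then have "lookup ?Q h = lookup ?Q g"
          using cfQ hn less.prems(1) unfolding class_fun_def by metis
        also have "\<dots> = 0"
          unfolding lQ using less.prems(1) by (simp add: lookup_osum mg_iso_refl N_def[symmetric])
        finally show False using h by (simp add: in_keys_iff)
      qed
      then have "lookup (?A * ?B) h \<noteq> 0"
        using h by (auto simp: in_keys_iff lQ lookup_osum)
      then have "(\<Sum>(a', b')\<in>splits h. lookup ?A a' * lookup ?B b') \<noteq> 0"
        by (simp only: lookup_mult_splits not_False_eq_True)
      then obtain x where x: "x \<in> splits h"
        "(case x of (a', b') \<Rightarrow> lookup ?A a' * lookup ?B b') \<noteq> 0"
        by (rule sum.not_neutral_contains_not_neutral)
      obtain a' b' where "x = (a', b')" by force
      with x have "(a', b') \<in> splits h"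
        "lookup ?A a' * lookup ?B b' \<noteq> 0" by auto
      then have h': "h = a' + b'" "mg_iso a a'" "mg_iso b b'"
        by (auto simp: splits_def lookup_osum split: if_splits)
      have fin: "finite (verts a')" "finite (verts b')"
        using mg_iso_invariants(3) h' wab finite_verts by blast+
      have "card (verts a') = card (verts a)" "card (verts b') = card (verts b)"
        using mg_iso_invariants(1) h' by blast+
      moreover have "verts a' \<inter> verts b' \<noteq> {}"
        using mg_iso_add[OF h'(2,3) ab(4) _ wab] notg ab(1) h'(1) by blast
      then have "card (verts a' \<inter> verts b') > 0" using fin by (simp add: card_gt_0_iff)
      ultimately show ?thesis
        using card_Un_Int[OF fin] cv by (simp add: h'(1) verts_add)
    qed
    have "osum n ` mg_class ` keys ?Q \<subseteq> edge_poly.span ?Z"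
    proof -
      have "osum n (mg_class h) \<in> edge_poly.span ?Z" if h: "h \<in> keys ?Q" for h
        using less.hyps[of h] smallQ[OF h] h cfQ less.prems(2) by (auto simp: class_fun_def)
      then show ?thesis by blast
    qed
    then have Q: "?Q \<in> edge_poly.span ?Z"
      using class_fun_span[OF cfQ]
      by (rule subsetD[OF edge_poly.span_minimal[OF _ edge_poly.subspace_span]])
    \<comment> \<open>The splitting \<open>(a, b)\<close> itself is counted, so \<open>N\<close> is
      a positive integer, and characteristic zero makes it invertible.\<close>
    define R where "R x \<longleftrightarrow> fst x \<in> multigraphs n \<and> mg_iso a (fst x) \<and>
      snd x \<in> multigraphs n \<and> mg_iso b (snd x)" for x
    have "N = (\<Sum>x\<in>splits g. if R x then 1 else 0)"
      unfolding N_def lookup_mult_splits R_def by (intro sum.cong) (auto simp: lookup_osum)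
    also have "\<dots> = of_nat (card {x \<in> splits g. R x})"
      using finite_splits[of g] by (simp add: sum.If_cases Int_def)
    finally have "N = of_nat (card {x \<in> splits g. R x})" .
    moreover have "(a, b) \<in> {x \<in> splits g. R x}"
      using ab mab mg_iso_refl by (auto simp: splits_def R_def)
    then have "card {x \<in> splits g. R x} \<noteq> 0"
      using finite_splits[of g] by (auto simp: card_eq_0_iff)
    ultimately have N: "N \<noteq> 0" by simp
    have "Const N * ?G = ?A * ?B - ?Q" by simp
    also have "?A * ?B \<in> edge_poly.span ?Z"
      by (rule span_mult_closed[OF _ AB]) (rule conn_products_mult)
    then have "?A * ?B - ?Q \<in> edge_poly.span ?Z" using Q by (rule edge_poly.span_diff)
    finally have "Const (inverse N) * (Const N * ?G) \<in> edge_poly.span ?Z"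
      by (rule edge_poly.span_scale)
    moreover have "Const (inverse N) * (Const N * ?G) = ?G"
      by (simp only: edge_poly.scale_scale left_inverse[OF N] edge_poly.scale_one)
    ultimately show ?thesis by simp
  qed
qed

lemma keys_prod_osum:
  assumes "set_mset M \<subseteq> {mg_class c | c. True}"
    "h \<in> keys (\<Prod>q\<in>#M. osum n q :: 'k::comm_ring_1 edge_poly)"
  shows "mg_size h = (\<Sum>q\<in>#M. ne q)"
  using assms
proof (induction M arbitrary: h)
  case empty
  then show ?case by (auto simp: in_keys_iff lookup_one when_def split: if_splits)
next
  case (add q M)
  then obtain a b where ab: "h = a + b" "a \<in> keys (osum n q :: 'k edge_poly)"
    "b \<in> keys (\<Prod>q\<in>#M. osum n q :: 'k edge_poly)"
    using keys_mult[of "osum n q :: 'k edge_poly" "\<Prod>q\<in>#M. osum n q"] by auto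
  obtain c where c: "q = mg_class c" using add.prems(1) by auto
  have "mg_iso c a" using ab(2) by (auto simp: c in_keys_iff lookup_osum split: if_splits)
  then have "mg_size a = ne q" by (simp add: c ne_class mg_iso_invariants)
  moreover have "mg_size b = (\<Sum>q\<in>#M. ne q)" using add.IH ab(3) add.prems(1) by simp
  ultimately show ?case by (simp add: ab(1) mg_size_add)
qed

text \<open>A comparison of dimensions in degree \<open>d\<close>: the orbit sums of multigraphs
  with \<open>d\<close> edges are linearly independent, and under the assumption they lie in the
  span of the products of degree \<open>d\<close>.\<close>

theorem unl_le_card_emsets:
  assumes "generates_algebra {orbit_sum n g | g. g \<in> multigraphs n \<and> (\<exists>i\<in>{1..n}. isolated n g i)}
      (invariants n :: 'k::field_char_0 edge_poly set)"
  shows "unl n d \<le> card (emsets (conn_classes (n - 1) d) ne d)"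
proof -
  let ?Z = "conn_products n (n - 1) :: 'k edge_poly set"
  let ?E = "emsets (conn_classes (n - 1) d) ne d"
  let ?Zd = "(\<lambda>M. \<Prod>q\<in>#M. osum n q :: 'k edge_poly) ` ?E"
  let ?X = "{g \<in> multigraphs n. mg_size g = d}"
  have "is_subalgebra (edge_poly.span ?Z)"
    unfolding is_subalgebra_def
  proof (intro conjI allI ballI)
    fix c :: 'k
    have "Const c * 1 \<in> edge_poly.span ?Z"
      by (intro edge_poly.span_scale edge_poly.span_base conn_products_one)
    then show "Const c \<in> edge_poly.span ?Z" by simp
  qed (auto intro: edge_poly.span_add span_mult_closed conn_products_mult)
  moreover have "{orbit_sum n g | g. g \<in> multigraphs n \<and> (\<exists>i\<in>{1..n}. isolated n g i)} \<subseteq> edge_poly.span ?Z"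
  proof clarify
    fix g i assume g: "g \<in> multigraphs n" and i: "i \<in> {1..n}" "isolated n g i"
    have "i \<notin> verts g"
    proof
      assume "i \<in> verts g"
      then obtain e where e: "e \<in> keys g" "i \<in> e" by (auto simp: verts_def)
      then have "e \<in> pairs n" using g by (auto simp: multigraphs_def)
      then obtain x y where xy: "e = {x, y}" "x \<noteq> y" "x \<in> {1..n}" "y \<in> {1..n}"
        by (auto simp: pairs_alt card_2_iff)
      then obtain j where "e = {i, j}" "j \<noteq> i" "j \<in> {1..n}"
        using e(2) by (metis insert_commute insertE singletonD)
      then show False using i(2) e(1) by (simp add: isolated_def in_keys_iff)
    qed
    then have "verts g \<subseteq> {1..n} - {i}" using g by (auto simp: multigraphs_alt)
    then have "card (verts g) \<le> n - 1"
      using card_mono[of "{1..n} - {i}" "verts g"] i(1) by simp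
    then show "orbit_sum n g \<in> edge_poly.span ?Z"
      using osum_in_span_conn_products[OF g] by (simp add: orbit_sum_eq_osum[OF g])
  qed
  ultimately have "is_subalgebra hull
      {orbit_sum n g | g. g \<in> multigraphs n \<and> (\<exists>i\<in>{1..n}. isolated n g i)} \<subseteq> edge_poly.span ?Z"
    by (intro hull_minimal)
  then have sub: "invariants n \<subseteq> edge_poly.span ?Z"
    using assms by (simp only: generates_algebra_def)
  \<comment> \<open>Projection to degree \<open>d\<close>: each product is homogeneous, so it is
    either kept or replaced by 0.\<close>
  have agree: "\<exists>r \<in> edge_poly.span ?Zd. \<forall>m. mg_size m = d \<longrightarrow> lookup r m = lookup p m"
    if "p \<in> edge_poly.span ?Z" for p
    using that
  proof (induction rule: edge_poly.span_induct)
    case base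
    show ?case
    proof (rule edge_poly.subspaceI, goal_cases)
      case 1
      show ?case using edge_poly.span_zero by force
    next
      case (2 x y)
      then obtain r s where "r \<in> edge_poly.span ?Zd" "s \<in> edge_poly.span ?Zd"
        "\<forall>m. mg_size m = d \<longrightarrow> lookup r m = lookup x m"
        "\<forall>m. mg_size m = d \<longrightarrow> lookup s m = lookup y m" by blast
      then show ?case
        by (intro CollectI bexI[of _ "r + s"]) (auto simp: lookup_add intro: edge_poly.span_add)
    next
      case (3 c x)
      then obtain r where "r \<in> edge_poly.span ?Zd"
        "\<forall>m. mg_size m = d \<longrightarrow> lookup r m = lookup x m" by blast
      then show ?case
        by (intro CollectI bexI[of _ "Const c * r"]) (auto simp: lookup_Const_mult intro: edge_poly.span_scale)
    qed
  next
    case (step z)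
    then obtain M where M: "z = (\<Prod>q\<in>#M. osum n q)"
      "set_mset M \<subseteq> {mg_class c | c. mg_connected c \<and> card (verts c) \<le> n - 1}"
      by (auto simp: conn_products_def)
    show ?case
    proof (cases "(\<Sum>q\<in>#M. ne q) = d")
      case True
      have "q \<in> conn_classes (n - 1) d" if q: "q \<in># M" for q
      proof -
        have "ne q \<le> d" using True q count_mult_le_sum_mset[of M q ne]
          by (metis count_greater_zero_iff le_trans mult_le_mono1 mult_1 Suc_leI One_nat_def)
        moreover obtain c where "q = mg_class c" "mg_connected c" "card (verts c) \<le> n - 1"
          using M(2) q by blast
        ultimately show ?thesis by (auto simp: conn_classes_def ne_class)
      qed
      then have "z \<in> ?Zd" using True M(1) by (auto simp: emsets_def)
      then show ?thesis by (intro bexI[of _ z] edge_poly.span_base) auto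
    next
      case False
      have "lookup z m = 0" if "mg_size m = d" for m
        using keys_prod_osum[of M m n] M False that by (auto simp: in_keys_iff)
      then show ?thesis by (intro bexI[of _ 0] edge_poly.span_zero) simp
    qed
  qed
  \<comment> \<open>Together with \<open>agree\<close>, this shows that an orbit sum of degree
    \<open>d\<close> is equal to its projection.\<close>
  have hom: "mg_size m = d" if "r \<in> edge_poly.span ?Zd" "lookup r m \<noteq> 0" for r m
    using that
  proof (induction arbitrary: m rule: edge_poly.span_induct)
    case base
    show ?case
      by (rule edge_poly.subspaceI)
        (auto simp: lookup_add lookup_Const_mult, metis add.left_neutral)
  next
    case (step z)
    then obtain M where M: "z = (\<Prod>q\<in>#M. osum n q)" "M \<in> ?E" by blast
    moreover have "set_mset M \<subseteq> {mg_class c | c. True}"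
      using M(2) by (auto simp: emsets_def conn_classes_def)
    ultimately show ?case using keys_prod_osum[of M m n] step by (auto simp: in_keys_iff emsets_def)
  qed
  let ?B = "osum n ` mg_class ` ?X :: 'k edge_poly set"
  have "?B \<subseteq> edge_poly.span ?Zd"
  proof
    fix b assume "b \<in> ?B"
    then obtain g where g: "g \<in> multigraphs n" "d = mg_size g" "b = osum n (mg_class g)" by blast
    have "(osum n (mg_class g) :: 'k edge_poly) \<in> edge_poly.span ?Z"
      using sub orbit_sum_invariant[OF g(1)] orbit_sum_eq_osum[OF g(1)] by (metis subsetD)
    then obtain r where r: "r \<in> edge_poly.span ?Zd"
      "\<And>m. mg_size m = d \<Longrightarrow> lookup r m = lookup (osum n (mg_class g)) m"
      using agree by blast
    have "r = osum n (mg_class g)"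
    proof (rule poly_mapping_eqI)
      fix m
      show "lookup r m = lookup (osum n (mg_class g)) m"
      proof (cases "mg_size m = d")
        case False
        then have "\<not> mg_iso g m" using mg_iso_invariants(2) g(2) by metis
        then show ?thesis using hom[OF r(1), of m] False by (auto simp: lookup_osum)
      qed (rule r(2))
    qed
    then show "b \<in> edge_poly.span ?Zd" using r(1) g(3) by (simp only:)
  qed
  moreover have "edge_poly.independent ?B"
    unfolding edge_poly.dependent_explicit
  proof (intro notI, elim exE conjE bexE)
    fix t u v assume t: "finite t" "t \<subseteq> ?B" "(\<Sum>v\<in>t. Const (u v) * v) = 0" "v \<in> t" "u v \<noteq> 0"
    then obtain g where g: "g \<in> multigraphs n" "v = osum n (mg_class g)" by blast
    have "0 = lookup (\<Sum>v\<in>t. Const (u v) * v) g" using t(3) by simp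
    also have "\<dots> = (\<Sum>w\<in>t. if w = v then u v else 0)"
      unfolding lookup_sum lookup_Const_mult
    proof (rule sum.cong[OF refl])
      fix w assume "w \<in> t"
      then obtain h where h: "h \<in> multigraphs n" "w = osum n (mg_class h)" using t(2) by blast
      show "u w * lookup w g = (if w = v then u v else 0)"
      proof (cases "mg_iso h g")
        case True
        then have "w = v" using h g mg_class_eq_iff by metis
        then show ?thesis using g by (simp add: lookup_osum mg_iso_refl)
      next
        case False
        then have "w \<noteq> v" using h g
          by (metis lookup_osum mg_iso_refl zero_neq_one)
        then show ?thesis using False by (simp add: h lookup_osum)
      qed
    qed
    also have "\<dots> = u v" using t(1,4) by simp
    finally show False using t(5) by simp
  qed
  moreover have finE: "finite ?E"
    unfolding emsets_eq_wmsets using ne_conn_classes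
    by (intro finite_wmsets finite_conn_classes) blast
  ultimately have "card ?B \<le> card ?Zd" using edge_poly.independent_span_bound by blast
  also have "\<dots> \<le> card ?E" using finE by (rule card_image_le)
  also have "card ?B = unl n d"
    unfolding unl_def
  proof (rule card_image, rule inj_onI, elim imageE)
    fix q r g h assume h: "osum n q = (osum n r :: 'k edge_poly)" "q = mg_class g" "g \<in> ?X" "r = mg_class h" "h \<in> ?X"
    then have "lookup (osum n (mg_class h) :: 'k edge_poly) g = 1"
      by (metis (no_types, lifting) lookup_osum mem_Collect_eq mg_iso_refl)
    then have "mg_iso h g" by (auto simp: lookup_osum split: if_splits)
    then show "q = r" using h mg_class_eq_iff mg_iso_sym by blast
  qed
  finally show ?thesis .
qed

section \<open>Orbit sums of simple graphs\<close>

abbreviation medge :: "nat \<Rightarrow> nat \<Rightarrow> nat \<Rightarrow> multigraph" where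
  "medge a b m \<equiv> single {a, b} m"

lemma splits_0: "splits 0 = {(0, 0)}"
proof -
  have zero: "a = 0 \<and> b = 0" if "a + b = 0" for a b :: multigraph
  proof -
    have "lookup a e + lookup b e = 0" for e
      using that by (metis lookup_add lookup_zero)
    then show ?thesis by (auto intro!: poly_mapping_eqI)
  qed
  show ?thesis by (auto simp: splits_def dest: zero)
qed

text \<open>As \<open>e\<close> does not occur in \<open>h\<close>, the copies of \<open>e\<close>
  are distributed between the two parts independently of the rest. Peeling off one edge at a time
  turns a coefficient of a product into an explicit finite sum.\<close>

lemma sum_splits_single_add:
  assumes e: "lookup h e = 0"
  shows "(\<Sum>x\<in>splits (single e m + h). F x) =
    (\<Sum>i\<le>m. \<Sum>(a, b)\<in>splits h. F (single e i + a, single e (m - i) + b))"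
proof -
  let ?s = "\<lambda>i. single e i :: multigraph"
  let ?r = "\<lambda>(i, a, b). (?s i + a, ?s (m - i) + b)"
  let ?cut = "\<lambda>a :: multigraph. a - ?s (lookup a e)"
  have part: "lookup a e = 0 \<and> lookup b e = 0" if "(a, b) \<in> splits h" for a b
    using that e by (auto simp: splits_def lookup_add)
  have dec: "?s (lookup a e) + ?cut a = a" for a :: multigraph
    by (rule poly_mapping_eqI) (auto simp: lookup_add lookup_minus lookup_single when_def)
  have "(\<Sum>x\<in>splits (?s m + h). F x) = (\<Sum>x\<in>Sigma {..m} (\<lambda>_. splits h). F (?r x))"
  proof (rule sum.reindex_bij_witness[of _ ?r "\<lambda>(a, b). (lookup a e, ?cut a, ?cut b)"], goal_cases)
    case (1 x)
    obtain a b where x: "x = (a, b)" by (cases x)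
    have ab: "a + b = ?s m + h" using 1 x by (simp add: splits_def)
    then have "lookup a e + lookup b e = m"
      using e by (metis lookup_add lookup_single_eq add.right_neutral)
    then have "m - lookup a e = lookup b e" by simp
    then show ?case using dec x by simp
  next
    case (2 x)
    obtain a b where x: "x = (a, b)" by (cases x)
    have ab: "a + b = ?s m + h" using 2 x by (simp add: splits_def)
    then have m: "lookup a e + lookup b e = m"
      using e by (metis lookup_add lookup_single_eq add.right_neutral)
    have "?cut a + ?cut b = h"
    proof (rule poly_mapping_eqI)
      fix f
      have "lookup a f + lookup b f = lookup (?s m + h) f"
        using ab by (metis lookup_add)
      then show "lookup (?cut a + ?cut b) f = lookup h f"
        using e m by (auto simp: lookup_add lookup_minus lookup_single when_def split: if_splits)
    qed
    then show ?case using m x by (auto simp: splits_def)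
  next
    case (3 y)
    then show ?case using part by (auto simp: lookup_add)
  next
    case (4 y)
    obtain i a b where y: "y = (i, a, b)" by (cases y)
    have "i \<le> m" "a + b = h" using y 4 by (auto simp: splits_def)
    have "?s i + a + (?s (m - i) + b) = (?s i + ?s (m - i)) + (a + b)" by (simp add: ac_simps)
    also have "\<dots> = ?s m + h" using \<open>i \<le> m\<close> \<open>a + b = h\<close> by (simp flip: single_add)
    finally have "?s i + a + (?s (m - i) + b) = ?s m + h" .
    then show ?case using y by (simp add: splits_def)
  next
    case (5 x)
    obtain a b where x: "x = (a, b)" by (cases x)
    have ab: "a + b = ?s m + h" using 5 x by (simp add: splits_def)
    then have "lookup a e + lookup b e = m"
      using e by (metis lookup_add lookup_single_eq add.right_neutral)
    then have "m - lookup a e = lookup b e" by simp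
    then show ?case using dec x by simp
  qed
  also have "\<dots> = (\<Sum>i\<le>m. \<Sum>(a, b)\<in>splits h. F (?s i + a, ?s (m - i) + b))"
    by (simp add: sum.cartesian_product case_prod_unfold)
  finally show ?thesis .
qed

lemma lookup_mult_two_edges:
  fixes p q :: "'k::comm_ring_1 edge_poly"
  assumes "e \<noteq> f"
  shows "lookup (p * q) (single e m + single f k) =
    (\<Sum>i\<le>m. \<Sum>j\<le>k.
      lookup p (single e i + single f j) *
      lookup q (single e (m - i) + single f (k - j)))"
proof -
  have f0: "single f k = single f k + (0 :: multigraph)" by simp
  show ?thesis
    unfolding lookup_mult_splits using assms
    by (subst sum_splits_single_add) (simp add: lookup_single when_def,
      subst f0, subst sum_splits_single_add, simp_all add: splits_0)
qed

lemma lookup_mult_three_edges: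
  fixes p q :: "'k::comm_ring_1 edge_poly"
  assumes "e \<noteq> f" "e \<noteq> g" "f \<noteq> g"
  shows "lookup (p * q)
      (single e m + (single f k + single g l)) =
    (\<Sum>i\<le>m. \<Sum>j\<le>k. \<Sum>t\<le>l.
      lookup p
        (single e i + (single f j + single g t)) *
      lookup q
        (single e (m - i) + (single f (k - j) + single g (l - t))))"
proof -
  have g0: "single g l = single g l + (0 :: multigraph)" by simp
  show ?thesis
    unfolding lookup_mult_splits using assms
    by (subst sum_splits_single_add) (simp add: lookup_single lookup_add when_def,
      subst sum_splits_single_add, simp add: lookup_single when_def,
      subst g0, subst sum_splits_single_add, simp_all add: splits_0)
qed

lemma medge_multigraphs:
  "a \<noteq> b \<Longrightarrow> a \<in> {1..n} \<Longrightarrow> b \<in> {1..n} \<Longrightarrow> medge a b m \<in> multigraphs n"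
  by (auto simp: multigraphs_def pairs_alt)

text \<open>The multigraph is given by a list of edges, so that renaming its vertices by a partial
  injection \<open>f\<close> is visible in the term; \<open>f\<close> is extended to a permutation
  of \<open>{1..n}\<close>.\<close>

lemma class_fun_map_edges:
  assumes p: "class_fun n p"
    and inj: "inj_on f S" and S: "S \<subseteq> {1..n}" "f ` S \<subseteq> {1..n}"
    and es: "\<And>a b m. (a, b, m) \<in> set es \<Longrightarrow> a \<in> S \<and> b \<in> S \<and> a \<noteq> b"
  shows "lookup p (\<Sum>(a, b, m)\<leftarrow>es. medge (f a) (f b) m) =
    lookup p (\<Sum>(a, b, m)\<leftarrow>es. medge a b m)"
proof -
  obtain s where s: "s permutes {1..n}" "\<And>x. x \<in> S \<Longrightarrow> s x = f x"
    using extend_permutation[OF _ S inj] by (metis finite_atLeastAtMost)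
  let ?g = "\<Sum>(a, b, m)\<leftarrow>es. medge a b m"
  have bij: "bij s" using s(1) by (rule permutes_bij)
  have "maps_mg s ?g (\<Sum>(a, b, m)\<leftarrow>es. medge (s a) (s b) m)"
    unfolding maps_mg_def
  proof (intro conjI allI bij)
    fix e
    have "({s a, s b} = s ` e) = ({a, b} = e)" for a b
      using bij inj_image_eq_iff[OF bij_is_inj[OF bij], of "{a, b}" e] by simp
    then show "lookup (\<Sum>(a, b, m)\<leftarrow>es. medge (s a) (s b) m) (s ` e) =
        lookup ?g e"
      by (induction es) (auto simp: lookup_add lookup_single when_def)
  qed
  moreover have "(\<Sum>(a, b, m)\<leftarrow>es. medge (s a) (s b) m) = (\<Sum>(a, b, m)\<leftarrow>es. medge (f a) (f b) m)"
    using es s(2) by (intro arg_cong[of _ _ sum_list] map_cong) auto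
  ultimately have "mg_iso ?g (\<Sum>(a, b, m)\<leftarrow>es. medge (f a) (f b) m)"
    by (auto simp: mg_iso_def)
  moreover have "(\<Sum>(a, b, m)\<leftarrow>es. medge (g a) (g b) m) \<in> multigraphs n"
    if "\<And>a b m. (a, b, m) \<in> set es \<Longrightarrow> g a \<noteq> g b \<and> g a \<in> {1..n} \<and> g b \<in> {1..n}" for g
    using that
  proof (induction es)
    case Nil
    then show ?case by (simp add: multigraphs_def)
  next
    case (Cons x es)
    obtain a b m where x: "x = (a, b, m)" by (cases x)
    then have "medge (g a) (g b) m \<in> multigraphs n" using Cons.prems[of a b m] by (simp add: medge_multigraphs)
    moreover have "(\<Sum>(a, b, m)\<leftarrow>es. medge (g a) (g b) m) \<in> multigraphs n"
      using Cons.prems by (intro Cons.IH) auto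
    ultimately show ?case by (simp add: x multigraphs_add)
  qed
  from this[of "\<lambda>x. x"] this[of f] have
    "?g \<in> multigraphs n" "(\<Sum>(a, b, m)\<leftarrow>es. medge (f a) (f b) m) \<in> multigraphs n"
    using es S inj by (blast dest: inj_onD)+
  ultimately show ?thesis using p by (simp add: class_fun_def)
qed

text \<open>The coefficients solve the linear system that makes all terms with two factors of positive
  degree cancel in \<open>square_form a b c d e (p * q)\<close> when \<open>p\<close> and \<open>q\<close> are constant on isomorphism classes.\<close>

definition square_form :: "nat \<Rightarrow> nat \<Rightarrow> nat \<Rightarrow> nat \<Rightarrow> nat \<Rightarrow> 'k::comm_ring_1 edge_poly \<Rightarrow> 'k" where
  "square_form a b c d e p = (let l = lookup p in
      2 * l (medge a b 3 + medge c d 1) - 2 * l (medge a b 3 + medge a c 1)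
    + 2 * l (medge a b 2 + medge a c 2) - 2 * l (medge a b 2 + medge c d 2)
    + l (medge a b 2 + (medge a c 1 + medge c d 1)) - l (medge a b 2 + (medge a c 1 + medge b d 1))
    + l (medge a b 2 + (medge c d 1 + medge c e 1)) - l (medge a b 2 + (medge a c 1 + medge d e 1)))"

lemma class_fun_shapes:
  assumes p: "class_fun n p" and V: "distinct [a, b, c, d, e]" "set [a, b, c, d, e] \<subseteq> {1..n}"
    and W: "distinct [a', b', c', d', e']" "set [a', b', c', d', e'] \<subseteq> {1..n}"
  shows "lookup p (medge a' b' m) = lookup p (medge a b m)"
    "lookup p (medge a' b' m + medge a' c' k) = lookup p (medge a b m + medge a c k)"
    "lookup p (medge a' b' m + medge c' d' k) = lookup p (medge a b m + medge c d k)"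
    "lookup p (medge a' b' m + (medge a' c' k + medge b' d' i)) =
      lookup p (medge a b m + (medge a c k + medge b d i))"
    "lookup p (medge a' b' m + (medge a' c' k + medge d' e' i)) =
      lookup p (medge a b m + (medge a c k + medge d e i))"
proof -
  define f where "f x = (if x = a then a' else if x = b then b' else if x = c then c'
    else if x = d then d' else e')" for x
  have f: "f a = a'" "f b = b'" "f c = c'" "f d = d'" "f e = e'"
    using V(1) by (auto simp: f_def)
  have inj: "inj_on f {a, b, c, d, e}" using V(1) W(1) by (simp add: f)
  have sub: "{a, b, c, d, e} \<subseteq> {1..n}" "f ` {a, b, c, d, e} \<subseteq> {1..n}"
    using V(2) W(2) by (simp_all add: f)
  have D: "a \<noteq> b" "a \<noteq> c" "b \<noteq> d" "c \<noteq> d" "d \<noteq> e" using V(1) by auto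
  note relabel = class_fun_map_edges[OF p inj sub]
  show "lookup p (medge a' b' m) = lookup p (medge a b m)"
    using relabel[of "[(a, b, m)]"] D by (force simp: f)
  show "lookup p (medge a' b' m + medge a' c' k) = lookup p (medge a b m + medge a c k)"
    using relabel[of "[(a, b, m), (a, c, k)]"] D by (force simp: f)
  show "lookup p (medge a' b' m + medge c' d' k) = lookup p (medge a b m + medge c d k)"
    using relabel[of "[(a, b, m), (c, d, k)]"] D by (force simp: f)
  show "lookup p (medge a' b' m + (medge a' c' k + medge b' d' i)) =
      lookup p (medge a b m + (medge a c k + medge b d i))"
    using relabel[of "[(a, b, m), (a, c, k), (b, d, i)]"] D by (force simp: f)
  show "lookup p (medge a' b' m + (medge a' c' k + medge d' e' i)) =
      lookup p (medge a b m + (medge a c k + medge d e i))"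
    using relabel[of "[(a, b, m), (a, c, k), (d, e, i)]"] D by (force simp: f)
qed

text \<open>Rewrite rules taking each factor that occurs in the expansions below to one
  representative of its shape. The two exchange rules are stated for multiplicities 1 and 2 only and
  move the larger one to the first edge; numerals appear as successors because the sums over
  splittings are unfolded that way.\<close>

lemma class_fun_canonical:
  assumes "class_fun n r" "distinct [a, b, c, d, e]" "set [a, b, c, d, e] \<subseteq> {1..n}"
  shows
    "lookup r (medge a c m) =
      lookup r (medge a b m)"
    "lookup r (medge c d m) =
      lookup r (medge a b m)"
    "lookup r (medge b d m) =
      lookup r (medge a b m)"
    "lookup r (medge d e m) =
      lookup r (medge a b m)"
    "lookup r (medge c e m) =
      lookup r (medge a b m)"
    "lookup r (medge a b m + medge b d k) =
      lookup r (medge a b m + medge a c k)"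
    "lookup r (medge a c m + medge c d k) =
      lookup r (medge a b m + medge a c k)"
    "lookup r (medge c d m + medge c e k) =
      lookup r (medge a b m + medge a c k)"
    "lookup r (medge a b (Suc 0) + medge a c (Suc (Suc 0))) =
      lookup r (medge a b (Suc (Suc 0)) + medge a c (Suc 0))"
    "lookup r (medge a c m + medge b d k) =
      lookup r (medge a b m + medge c d k)"
    "lookup r (medge a c m + medge d e k) =
      lookup r (medge a b m + medge c d k)"
    "lookup r (medge a b m + medge d e k) =
      lookup r (medge a b m + medge c d k)"
    "lookup r (medge a b m + medge c e k) =
      lookup r (medge a b m + medge c d k)"
    "lookup r (medge a b (Suc 0) + medge c d (Suc (Suc 0))) =
      lookup r (medge a b (Suc (Suc 0)) + medge c d (Suc 0))"
    "lookup r (medge a b k + (medge a c m + medge c d i)) =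
      lookup r (medge a b m + (medge a c k + medge b d i))"
    "lookup r (medge a b i + (medge c d m + medge c e k)) =
      lookup r (medge a b m + (medge a c k + medge d e i))"
  supply shapes = class_fun_shapes[OF assms]
  subgoal using shapes(1)[of a c b d e m] assms(2,3)
    by (auto simp: insert_commute ac_simps)
  subgoal using shapes(1)[of c d a b e m] assms(2,3)
    by (auto simp: insert_commute ac_simps)
  subgoal using shapes(1)[of b d a c e m] assms(2,3)
    by (auto simp: insert_commute ac_simps)
  subgoal using shapes(1)[of d e a b c m] assms(2,3)
    by (auto simp: insert_commute ac_simps)
  subgoal using shapes(1)[of c e a b d m] assms(2,3)
    by (auto simp: insert_commute ac_simps)
  subgoal using shapes(2)[of b a d c e m k] assms(2,3)
    by (auto simp: insert_commute ac_simps)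
  subgoal using shapes(2)[of c a d b e m k] assms(2,3)
    by (auto simp: insert_commute ac_simps)
  subgoal using shapes(2)[of c d e a b m k] assms(2,3)
    by (auto simp: insert_commute ac_simps)
  subgoal using shapes(2)[of a c b d e "Suc (Suc 0)" "Suc 0"] assms(2,3)
    by (auto simp: insert_commute ac_simps)
  subgoal using shapes(3)[of a c b d e m k] assms(2,3)
    by (auto simp: insert_commute ac_simps)
  subgoal using shapes(3)[of a c d e b m k] assms(2,3)
    by (auto simp: insert_commute ac_simps)
  subgoal using shapes(3)[of a b d e c m k] assms(2,3)
    by (auto simp: insert_commute ac_simps)
  subgoal using shapes(3)[of a b c e d m k] assms(2,3)
    by (auto simp: insert_commute ac_simps)
  subgoal using shapes(3)[of c d a b e "Suc (Suc 0)" "Suc 0"] assms(2,3)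
    by (auto simp: insert_commute ac_simps)
  subgoal using shapes(4)[of a c b d e m k i] assms(2,3)
    by (auto simp: insert_commute ac_simps)
  subgoal using shapes(5)[of c d e a b m k i] assms(2,3)
    by (auto simp: insert_commute ac_simps)
  done

text \<open>Expanded over all splittings, each coefficient of \<open>p * q\<close> is bilinear in
  the coefficients of a few small shapes, and the mixed terms cancel in pairs. For instance, a path
  of three edges times a single edge arises once from a path with doubled end edge and once from a
  path with doubled middle edge, which have opposite signs.\<close>

lemma square_form_mult:
  fixes p q :: "'k::comm_ring_1 edge_poly"
  assumes p: "class_fun n p" and q: "class_fun n q"
    and V: "distinct [a, b, c, d, e]" "set [a, b, c, d, e] \<subseteq> {1..n}"
  shows "square_form a b c d e (p * q) =
    lookup p 0 * square_form a b c d e q + lookup q 0 * square_form a b c d e p"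
proof -
  let ?l = "lookup :: 'k edge_poly \<Rightarrow> multigraph \<Rightarrow> 'k"
  \<comment> \<open>The shapes of all proper factors: an edge, two adjacent edges, two disjoint
    edges, a path of three edges, and two adjacent edges with a disjoint third one.\<close>
  let ?e = "\<lambda>r m. ?l r (medge a b m)"
  let ?c = "\<lambda>r m k. ?l r (medge a b m + medge a c k)"
  let ?m = "\<lambda>r m k. ?l r (medge a b m + medge c d k)"
  let ?t = "\<lambda>r. ?l r (medge a b 1 + (medge a c 1 + medge b d 1))"
  let ?u = "\<lambda>r. ?l r (medge a b 1 + (medge a c 1 + medge d e 1))"
  have D: "a \<noteq> b" "a \<noteq> c" "a \<noteq> d" "a \<noteq> e" "b \<noteq> c" "b \<noteq> d" "b \<noteq> e" "c \<noteq> d" "c \<noteq> e" "d \<noteq> e"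
    using V(1) by auto
  have neq: "{a, b} \<noteq> {a, c}" "{a, b} \<noteq> {c, d}" "{a, b} \<noteq> {b, d}" "{a, b} \<noteq> {c, e}" "{a, b} \<noteq> {d, e}"
    "{a, c} \<noteq> {c, d}" "{a, c} \<noteq> {b, d}" "{a, c} \<noteq> {d, e}" "{c, d} \<noteq> {c, e}"
    using D by (auto simp: doubleton_eq_iff)
  note expand = lookup_mult_two_edges lookup_mult_three_edges numeral_eq_Suc sum.atMost_Suc neq
    class_fun_canonical[OF p V] class_fun_canonical[OF q V]
  have eq0: "?l (p * q) (medge a b 3 + medge a c 1) =
      ?l p 0 * ?l q (medge a b 3 + medge a c 1) + ?e p 1 * ?e q 3 + ?e p 1 * ?c q 2 1 +
      ?c p 1 1 * ?e q 2 + ?e p 2 * ?c q 1 1 + ?c p 2 1 * ?e q 1 + ?e p 3 * ?e q 1 + ?l p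
      (medge a b 3 + medge a c 1) * ?l q 0"
    by (simp add: expand)
  have eq1: "?l (p * q) (medge a b 3 + medge c d 1) =
      ?l p 0 * ?l q (medge a b 3 + medge c d 1) + ?e p 1 * ?e q 3 + ?e p 1 * ?m q 2 1 +
      ?m p 1 1 * ?e q 2 + ?e p 2 * ?m q 1 1 + ?m p 2 1 * ?e q 1 + ?e p 3 * ?e q 1 + ?l p
      (medge a b 3 + medge c d 1) * ?l q 0"
    by (simp add: expand)
  have eq2: "?l (p * q) (medge a b 2 + medge a c 2) =
      ?l p 0 * ?l q (medge a b 2 + medge a c 2) + ?e p 1 * ?c q 2 1 + ?e p 2 * ?e q 2 +
      ?e p 1 * ?c q 2 1 + ?c p 1 1 * ?c q 1 1 + ?c p 2 1 * ?e q 1 + ?e p 2 * ?e q 2 + ?c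
      p 2 1 * ?e q 1 + ?l p (medge a b 2 + medge a c 2) * ?l q 0"
    by (simp add: expand)
  have eq3: "?l (p * q) (medge a b 2 + (medge a c 1 + medge b d 1)) =
      ?l p 0 * ?l q (medge a b 2 + (medge a c 1 + medge b d 1)) + ?e p 1 * ?c q 2 1 + ?e
      p 1 * ?c q 2 1 + ?m p 1 1 * ?e q 2 + ?e p 1 * ?t q + ?c p 1 1 * ?c q 1 1 + ?c p 1
      1 * ?c q 1 1 + ?t p * ?e q 1 + ?e p 2 * ?m q 1 1 + ?c p 2 1 * ?e q 1 + ?c p 2 1 *
      ?e q 1 + ?l p (medge a b 2 + (medge a c 1 + medge b d 1)) * ?l q 0"
    by (simp add: expand)
  have eq4: "?l (p * q) (medge a b 2 + (medge a c 1 + medge c d 1)) =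
      ?l p 0 * ?l q (medge a b 2 + (medge a c 1 + medge c d 1)) + ?e p 1 * ?c q 2 1 + ?e
      p 1 * ?m q 2 1 + ?c p 1 1 * ?e q 2 + ?e p 1 * ?t q + ?m p 1 1 * ?c q 1 1 + ?c p 1
      1 * ?m q 1 1 + ?t p * ?e q 1 + ?e p 2 * ?c q 1 1 + ?m p 2 1 * ?e q 1 + ?c p 2 1 *
      ?e q 1 + ?l p (medge a b 2 + (medge a c 1 + medge c d 1)) * ?l q 0"
    by (simp add: expand)
  have eq5: "?l (p * q) (medge a b 2 + (medge a c 1 + medge d e 1)) =
      ?l p 0 * ?l q (medge a b 2 + (medge a c 1 + medge d e 1)) + ?e p 1 * ?c q 2 1 + ?e
      p 1 * ?m q 2 1 + ?m p 1 1 * ?e q 2 + ?e p 1 * ?u q + ?m p 1 1 * ?c q 1 1 + ?c p 1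
      1 * ?m q 1 1 + ?u p * ?e q 1 + ?e p 2 * ?m q 1 1 + ?m p 2 1 * ?e q 1 + ?c p 2 1 *
      ?e q 1 + ?l p (medge a b 2 + (medge a c 1 + medge d e 1)) * ?l q 0"
    by (simp add: expand)
  have eq6: "?l (p * q) (medge a b 2 + medge c d 2) =
      ?l p 0 * ?l q (medge a b 2 + medge c d 2) + ?e p 1 * ?m q 2 1 + ?e p 2 * ?e q 2 +
      ?e p 1 * ?m q 2 1 + ?m p 1 1 * ?m q 1 1 + ?m p 2 1 * ?e q 1 + ?e p 2 * ?e q 2 + ?m
      p 2 1 * ?e q 1 + ?l p (medge a b 2 + medge c d 2) * ?l q 0"
    by (simp add: expand)
  have eq7: "?l (p * q) (medge a b 2 + (medge c d 1 + medge c e 1)) =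
      ?l p 0 * ?l q (medge a b 2 + (medge c d 1 + medge c e 1)) + ?e p 1 * ?m q 2 1 + ?e
      p 1 * ?m q 2 1 + ?c p 1 1 * ?e q 2 + ?e p 1 * ?u q + ?m p 1 1 * ?m q 1 1 + ?m p 1
      1 * ?m q 1 1 + ?u p * ?e q 1 + ?e p 2 * ?c q 1 1 + ?m p 2 1 * ?e q 1 + ?m p 2 1 *
      ?e q 1 + ?l p (medge a b 2 + (medge c d 1 + medge c e 1)) * ?l q 0"
    by (simp add: expand)
  show ?thesis
    unfolding square_form_def Let_def eq0 eq1 eq2 eq3 eq4 eq5 eq6 eq7
    by (simp add: algebra_simps)
qed

text \<open>All eight multigraphs in the form contain the edge \<open>{a, b}\<close> at least twice,
  so simple graphs and constants contribute nothing.\<close>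

lemma square_form_zero:
  assumes "\<And>h. 2 \<le> lookup h {a, b} \<Longrightarrow> lookup p h = 0"
  shows "square_form a b c d e p = 0"
  using assms by (simp add: square_form_def Let_def lookup_add)

lemma class_fun_Const: "class_fun n (Const c)"
  unfolding class_fun_def
proof (intro conjI ballI impI)
  show "keys (Const c) \<subseteq> multigraphs n"
    by (auto simp: Const_def multigraphs_def split: if_splits)
next
  fix g h assume "mg_iso g h"
  then obtain s where "keys h = (\<lambda>e. s ` e) ` keys g"
    using keys_maps_mg mg_iso_def by blast
  then have "g = 0 \<longleftrightarrow> h = 0" by (metis image_is_empty keys_eq_empty)
  then show "lookup (Const c) g = lookup (Const c) h"
    by (auto simp: Const_def lookup_single when_def)
qed

theorem simple_orbit_sums_not_generating:
  assumes "5 \<le> n"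
  shows "\<not> generates_algebra {orbit_sum n g | g. g \<in> simple_graphs n}
    (invariants n :: 'k::field_char_0 edge_poly set)"
proof
  let ?S = "{orbit_sum n g | g. g \<in> simple_graphs n} :: 'k edge_poly set"
  let ?L = "square_form 1 2 3 4 5 :: 'k edge_poly \<Rightarrow> 'k"
  let ?T = "{p. class_fun n p \<and> ?L p = 0}"
  \<comment> \<open>One of the eight shapes in the form, with coefficient 2; the other seven belong
    to other classes, so the form has value 2 on its orbit sum, which is nonzero in characteristic
    zero.\<close>
  let ?g = "medge 1 2 3 + medge 3 4 1"
  assume gen: "generates_algebra ?S (invariants n :: 'k edge_poly set)"
  have "is_subalgebra ?T"
    unfolding is_subalgebra_def
  proof (intro conjI allI ballI)
    fix c :: 'k
    show "Const c \<in> ?T"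
      using class_fun_Const by (auto simp: Const_def lookup_single when_def intro!: square_form_zero)
  next
    fix p q :: "'k edge_poly" assume "p \<in> ?T" "q \<in> ?T"
    moreover have "?L (p + q) = ?L p + ?L q"
      by (simp add: square_form_def Let_def lookup_add algebra_simps)
    moreover have "class_fun n (p + q)" if "class_fun n p" "class_fun n q"
      using that class_fun_lincomb[of n p q "p + q" "- 1"] by (simp add: lookup_add)
    moreover have "?L (p * q) = lookup p 0 * ?L q + lookup q 0 * ?L p"
      if "class_fun n p" "class_fun n q"
      using assms by (intro square_form_mult[OF that]) auto
    ultimately show "p + q \<in> ?T" "p * q \<in> ?T" using class_fun_mult by auto
  qed
  moreover have "?S \<subseteq> ?T"
  proof
    fix p :: "'k edge_poly" assume "p \<in> ?S"
    then obtain g where g: "g \<in> simple_graphs n" and p: "p = orbit_sum n g" by auto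
    have gn: "g \<in> multigraphs n" using g by (simp add: simple_graphs_def)
    have le: "lookup g e \<le> 1" for e
    proof (cases "e \<in> pairs n")
      case True
      then show ?thesis using g by (auto simp: simple_graphs_def)
    next
      case False
      then have "e \<notin> keys g" using gn by (auto simp: multigraphs_def)
      then show ?thesis by (simp add: in_keys_iff)
    qed
    have "?L p = 0"
    proof (rule square_form_zero)
      fix h :: multigraph assume h: "2 \<le> lookup h {1, 2}"
      have "\<not> mg_iso g h"
      proof
        assume "mg_iso g h"
        then obtain s where "maps_mg s h g" using mg_iso_sym mg_iso_def by blast
        then have "lookup g (s ` {1, 2}) = lookup h {1, 2}"
          unfolding maps_mg_def by blast
        then show False using h le[of "s ` {1, 2}"] by linarith
      qed
      then show "lookup p h = 0"
        by (simp add: p orbit_sum_eq_osum[OF gn] lookup_osum)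
    qed
    then show "p \<in> ?T" by (simp add: p orbit_sum_eq_osum[OF gn] class_fun_osum)
  qed
  ultimately have sub: "invariants n \<subseteq> ?T"
    using gen hull_minimal[of ?S ?T is_subalgebra] unfolding generates_algebra_def by simp

  have medge: "medge i j m \<in> multigraphs n" if "i \<noteq> j" "1 \<le> i" "1 \<le> j" "i \<le> 5" "j \<le> 5" for i j m
    using that assms by (intro medge_multigraphs) auto
  have gn: "?g \<in> multigraphs n" by (simp add: multigraphs_add medge)
  \<comment> \<open>The triple edge survives in every isomorphic copy, which rules out the six
    shapes whose multiplicities are at most 2.\<close>
  have other: "\<not> mg_iso ?g h" if h: "\<And>e. lookup h e \<noteq> 3" for h
  proof
    assume "mg_iso ?g h"
    then obtain s where "maps_mg s ?g h" by (auto simp: mg_iso_def)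
    then have "lookup h (s ` {1, 2}) = lookup ?g {1, 2}"
      unfolding maps_mg_def by blast
    then show False using h by (simp add: lookup_add lookup_single when_def doubleton_eq_iff)
  qed
  let ?o = "lookup (orbit_sum n ?g :: 'k edge_poly)"
  have o: "?o h = (if h \<in> multigraphs n \<and> mg_iso ?g h then 1 else 0)" for h
    by (simp only: orbit_sum_eq_osum[OF gn] lookup_osum)
  have self: "?o ?g = 1" unfolding o using gn mg_iso_refl by simp
  \<comment> \<open>The remaining shape with a triple edge has three vertices instead of
    four.\<close>
  have three: "?o (medge 1 2 3 + medge 1 3 1) = 0"
  proof -
    have "card (verts (medge 1 2 3 + medge 1 3 1)) \<noteq> card (verts ?g)"
      by (simp add: verts_def keys_add_mg insert_commute)
    then have "\<not> mg_iso ?g (medge 1 2 3 + medge 1 3 1)" using mg_iso_invariants(1) by blast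
    then show ?thesis by (simp only: o simp_thms if_False)
  qed
  have zero: "?o h = 0" if "\<And>e. lookup h e \<noteq> 3" for h
    unfolding o using other[OF that] by simp
  have two2: "lookup (single x 2 + single y 2) e \<noteq> (3 :: nat)"
    if "x \<noteq> y" for x y e :: "nat set"
    using that by (simp add: lookup_add lookup_single when_def)
  have two1: "lookup (single x 2 +
      (single y 1 + single z 1)) e \<noteq> (3 :: nat)"
    if "x \<noteq> y" "x \<noteq> z" for x y z e :: "nat set"
    using that by (auto simp add: lookup_add lookup_single when_def)
  have "?o (medge 1 2 2 + medge 1 3 2) = 0" "?o (medge 1 2 2 + medge 3 4 2) = 0"
    "?o (medge 1 2 2 + (medge 1 3 1 + medge 3 4 1)) = 0"
    "?o (medge 1 2 2 + (medge 1 3 1 + medge 2 4 1)) = 0"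
    "?o (medge 1 2 2 + (medge 3 4 1 + medge 3 5 1)) = 0"
    "?o (medge 1 2 2 + (medge 1 3 1 + medge 4 5 1)) = 0"
    by (intro zero two2 two1; simp add: doubleton_eq_iff)+
  then have "?L (orbit_sum n ?g) = 2"
    unfolding square_form_def Let_def self three by (simp only:) simp
  moreover have "orbit_sum n ?g \<in> ?T" using sub orbit_sum_invariant[OF gn] by blast
  ultimately show False by simp
qed

section \<open>Numbers of multigraphs and of products\<close>

fun geo_aux :: "nat list \<Rightarrow> nat list \<Rightarrow> nat list" where
  "geo_aux (p # ps) (x # xs) = (let y = x + p in y # geo_aux (ps @ [y]) xs)"
| "geo_aux ps xs = xs"

text \<open>Multiplication by \<open>1 / (1 - x ^ l)\<close>. The first argument of
  \<open>geo_aux\<close> is a queue of the last \<open>l\<close> output coefficients, initially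
  zero; its head is the one \<open>l\<close> places back.\<close>

definition geo :: "nat \<Rightarrow> nat list \<Rightarrow> nat list" where
  "geo l s = geo_aux (replicate l 0) s"

definition represents :: "nat list \<Rightarrow> nat list \<Rightarrow> bool" where
  "represents s L \<longleftrightarrow> (\<forall>k<length s. s ! k = ser_coeff L k)"

lemma length_geo_aux [simp]: "length (geo_aux ps xs) = length xs"
  by (induction ps xs rule: geo_aux.induct) (auto simp: Let_def)

text \<open>The queue followed by the output is the output delayed by the length of the queue, which
  gives the recurrence for the geometric factor.\<close>

lemma geo_aux_nth:
  assumes "ps \<noteq> []" "k < length xs"
  shows "geo_aux ps xs ! k = xs ! k + (ps @ geo_aux ps xs) ! k"
  using assms
proof (induction ps xs arbitrary: k rule: geo_aux.induct)
  case (1 p ps x xs)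
  show ?case
  proof (cases k)
    case (Suc i)
    then show ?thesis
      using "1.IH"[OF refl, of i] "1.prems" by (simp add: Let_def)
  qed (simp add: Let_def)
qed auto

lemma represents_geo:
  assumes "represents s L" "0 < l"
  shows "represents (geo l s) (l # L)"
  unfolding represents_def
proof (intro allI impI)
  fix k assume "k < length (geo l s)"
  then show "geo l s ! k = ser_coeff (l # L) k"
  proof (induction k rule: less_induct)
    case (less k)
    have "replicate l 0 \<noteq> ([] :: nat list)" using assms(2) by simp
    then have "geo l s ! k = s ! k + (replicate l 0 @ geo l s) ! k"
      unfolding geo_def using less.prems by (intro geo_aux_nth) (auto simp: geo_def)
    then show ?case
      using less assms by (auto simp: nth_append represents_def geo_def)
  qed
qed

lemma represents_large:
  assumes "represents s L" "length s \<le> l" shows "represents s (l # L)"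
  using assms by (auto simp: represents_def)

text \<open>A factor \<open>1 / (1 - x ^ l)\<close> with \<open>24 < l\<close> equals 1 up to degree
  24, where all series are cut off.\<close>

definition mult_groups :: "(nat \<times> nat) list \<Rightarrow> nat list \<Rightarrow> nat list" where
  "mult_groups gs s = foldr (\<lambda>(l, c) s. if 24 < l then s else (geo l ^^ c) s) gs s"

lemma length_geo_funpow [simp]: "length ((geo l ^^ c) s) = length s"
  by (induction c) (simp_all add: geo_def)

lemma length_mult_groups [simp]: "length (mult_groups gs s) = length s"
  by (induction gs) (auto simp: mult_groups_def)

lemma represents_mult_groups:
  assumes "represents s L" "length s \<le> 25" "\<And>l c. (l, c) \<in> set gs \<Longrightarrow> 0 < c \<Longrightarrow> 0 < l"
  shows "represents (mult_groups gs s) (expand_groups gs @ L)"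
  using assms(3)
proof (induction gs)
  case Nil
  then show ?case using assms(1) by (simp add: mult_groups_def expand_groups_def)
next
  case (Cons g gs)
  obtain l c where g: "g = (l, c)" by force
  have IH: "represents (mult_groups gs s) (expand_groups gs @ L)"
    using Cons by auto
  have pos: "0 < c \<Longrightarrow> 0 < l" using Cons.prems[of l c] g by simp
  have len: "length (mult_groups gs s) \<le> 25" using assms(2) by simp
  have "represents (if 24 < l then t else (geo l ^^ i) t) (replicate i l @ M)"
    if "represents t M" "i \<le> c" "length t \<le> 25" for i t M
    using that(2)
  proof (induction i)
    case 0
    then show ?case using that by simp
  next
    case (Suc i)
    then show ?case
      using represents_geo[of "(geo l ^^ i) t"] represents_large[of t] pos that(3)
      by (auto split: if_splits)
  qed
  from this[OF IH order_refl len]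
  have "represents (if 24 < l then mult_groups gs s else (geo l ^^ c) (mult_groups gs s))
      (replicate c l @ expand_groups gs @ L)" .
  moreover have "mult_groups (g # gs) s =
      (if 24 < l then mult_groups gs s else (geo l ^^ c) (mult_groups gs s))"
    by (simp add: g mult_groups_def)
  moreover have "expand_groups (g # gs) @ L = replicate c l @ expand_groups gs @ L"
    by (simp add: g expand_groups_def)
  ultimately show ?case by (simp only:)
qed

text \<open>The orbits of pairs gained with a cycle of length \<open>a\<close>: those within the
  cycle, for even \<open>a\<close> including the orbit of opposite points, and those joining it to
  each earlier cycle.\<close>

definition new_groups :: "nat \<Rightarrow> nat list \<Rightarrow> (nat \<times> nat) list" where
  "new_groups a as = (a, (a - 1) div 2) # (a div 2, if even a then 1 else 0) #
     map (\<lambda>b. (lcm a b, gcd a b)) as"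

lemma pair_lens_Cons: "pair_lens (a # as) = expand_groups (new_groups a as) @ pair_lens as"
  by (simp add: pair_lens_def expand_groups_def new_groups_def comp_def)

definition fact_tab :: "nat list" where
  "fact_tab = [1, 1, 2, 6, 24, 120, 720, 5040, 40320, 362880, 3628800, 39916800, 479001600,
     6227020800, 87178291200, 1307674368000, 20922789888000, 355687428096000, 6402373705728000]"

lemma fact_tab: "v \<le> 18 \<Longrightarrow> fact_tab ! v = fact v"
proof -
  have "\<forall>v\<in>set [0..<19]. fact_tab ! v = fact v"
    by code_simp
  then show "v \<le> 18 \<Longrightarrow> ?thesis" by auto
qed

section \<open>Burnside's sum as a traversal of partitions\<close>

fun add_lists :: "nat list \<Rightarrow> nat list \<Rightarrow> nat list" where
  "add_lists (x # xs) (y # ys) = (x + y) # add_lists xs ys"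
| "add_lists [] ys = ys"
| "add_lists xs [] = xs"

fun add_rows :: "nat list list \<Rightarrow> nat list list \<Rightarrow> nat list list" where
  "add_rows (x # xs) (y # ys) = add_lists x y # add_rows xs ys"
| "add_rows [] ys = ys"
| "add_rows xs [] = xs"

definition entry :: "nat list \<Rightarrow> nat \<Rightarrow> nat" where
  "entry xs k = (if k < length xs then xs ! k else 0)"

definition entry2 :: "nat list list \<Rightarrow> nat \<Rightarrow> nat \<Rightarrow> nat" where
  "entry2 xss j k = (if j < length xss then entry (xss ! j) k else 0)"

lemma entry_simps [simp]:
  "entry [] k = 0" "entry (x # xs) 0 = x" "entry (x # xs) (Suc k) = entry xs k"
  "entry2 [] j k = 0" "entry2 (r # rs) 0 k = entry r k" "entry2 (r # rs) (Suc j) k = entry2 rs j k"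
  by (simp_all add: entry_def entry2_def)

lemma entry_add_lists: "entry (add_lists xs ys) k = entry xs k + entry ys k"
proof (induction xs ys arbitrary: k rule: add_lists.induct)
  case (1 x xs y ys)
  then show ?case by (cases k) auto
qed auto

lemma entry2_add_rows: "entry2 (add_rows xs ys) j k = entry2 xs j k + entry2 ys j k"
proof (induction xs ys arbitrary: j rule: add_rows.induct)
  case (1 x xs y ys)
  then show ?case by (cases j) (auto simp: entry_add_lists)
qed auto

lemma entry2_shift:
  "entry2 (replicate a [] @ xs) j k = (if j < a then 0 else entry2 xs (j - a) k)"
  by (auto simp: entry2_def entry_def nth_append)

text \<open>Depth-first traversal of the partitions of the numbers up to 18: \<open>as\<close> lists the parts
  chosen so far, \<open>r\<close> is the remaining budget, \<open>s\<close> the series of \<open>as\<close> up to degree 24 and \<open>z\<close> its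
  centralizer order. Row \<open>j\<close> of the result collects the partitions whose sum exceeds that of
  \<open>as\<close> by \<open>Suc j\<close>.\<close>

fun ptree :: "nat \<Rightarrow> nat \<Rightarrow> nat list \<Rightarrow> nat list \<Rightarrow> nat \<Rightarrow> nat list list" where
  "ptree 0 r as s z = []"
| "ptree (Suc a) r as s z = (if Suc a \<le> r
     then (let s1 = mult_groups (new_groups (Suc a) as) s;
               z1 = z * (Suc a * Suc (count_list as (Suc a)));
               w = fact_tab ! (18 - (r - Suc a)) div z1
           in add_rows (ptree a r as s z)
             (replicate a [] @ map ((*) w) s1 # ptree (Suc a) (r - Suc a) (Suc a # as) s1 z1))
     else ptree a r as s z)"

definition part_term :: "nat \<Rightarrow> nat \<Rightarrow> nat list \<Rightarrow> nat" where
  "part_term v k as = fact v div centralizer_order (mset as) * ser_coeff (pair_lens as) k"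

text \<open>New parts go in front and are at most \<open>a\<close>, matching the traversal, which
  chooses parts in decreasing order. The empty extension is excluded, since the entry for
  \<open>as\<close> itself is made one level up.\<close>

definition extensions :: "nat \<Rightarrow> nat list \<Rightarrow> nat \<Rightarrow> nat list set" where
  "extensions a as v = (\<lambda>ps. ps @ as) `
     {ps. ps \<noteq> [] \<and> sorted ps \<and> set ps \<subseteq> {1..a} \<and> sum_list ps + sum_list as = v}"

lemma finite_extensions: "finite (extensions a as v)"
proof -
  have "{ps. ps \<noteq> [] \<and> sorted ps \<and> set ps \<subseteq> {1..a} \<and> sum_list ps + sum_list as = v} \<subseteq>
      (\<Union>n\<le>v. partition_lists n)"
    by (auto simp: partition_lists_def)
  moreover have "finite (\<Union>n\<le>v. partition_lists n)" by (simp add: finite_partition_lists)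
  ultimately show ?thesis
    unfolding extensions_def by (intro finite_imageI) (rule finite_subset)
qed

text \<open>The largest new part stands last in \<open>ps\<close>. If it is \<open>Suc a\<close>, it
  is moved over to \<open>as\<close>, with or without further parts in front of it; otherwise all
  new parts are at most \<open>a\<close>.\<close>

lemma extensions_Suc:
  "extensions (Suc a) as v = extensions a as v \<union>
     ((if Suc a + sum_list as = v then {Suc a # as} else {}) \<union> extensions (Suc a) (Suc a # as) v)"
  (is "?L = ?R")
proof (intro equalityI subsetI)
  fix bs assume "bs \<in> ?L"
  then obtain ps where ps: "bs = ps @ as" "ps \<noteq> []" "sorted ps" "set ps \<subseteq> {1..Suc a}"
    "sum_list ps + sum_list as = v" by (auto simp: extensions_def)
  obtain qs x where qx: "ps = qs @ [x]" using ps(2) by (metis rev_exhaust)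
  show "bs \<in> ?R"
  proof (cases "x = Suc a")
    case True
    show ?thesis
    proof (cases "qs = []")
      case True
      then show ?thesis using ps qx \<open>x = Suc a\<close> by simp
    next
      case False
      then have "bs \<in> extensions (Suc a) (Suc a # as) v"
        using ps qx \<open>x = Suc a\<close> unfolding extensions_def
        by (intro image_eqI[of _ _ qs]) (auto simp: sorted_append)
      then show ?thesis by blast
    qed
  next
    case False
    then have "x \<le> a" using ps(4) qx by auto
    then have "set ps \<subseteq> {1..a}" using ps(3,4) qx by (fastforce simp: sorted_append)
    then have "bs \<in> extensions a as v" using ps unfolding extensions_def by blast
    then show ?thesis by blast
  qed
next
  fix bs assume "bs \<in> ?R"
  then consider "bs \<in> extensions a as v" | "Suc a + sum_list as = v" "bs = Suc a # as"
    | "bs \<in> extensions (Suc a) (Suc a # as) v" by (auto split: if_splits)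
  then show "bs \<in> ?L"
  proof cases
    case 1
    then show ?thesis unfolding extensions_def by fastforce
  next
    case 2
    then show ?thesis unfolding extensions_def by (intro image_eqI[of _ _ "[Suc a]"]) auto
  next
    case 3
    then obtain qs where qs: "bs = qs @ Suc a # as" "sorted qs" "set qs \<subseteq> {1..Suc a}"
      "sum_list qs + sum_list (Suc a # as) = v" by (auto simp: extensions_def)
    then show ?thesis unfolding extensions_def
      by (intro image_eqI[of _ _ "qs @ [Suc a]"]) (auto simp: sorted_append)
  qed
qed

lemma extensions_disjoint:
  "extensions a as v \<inter>
     ((if Suc a + sum_list as = v then {Suc a # as} else {}) \<union> extensions (Suc a) (Suc a # as) v) = {}"
  "(if Suc a + sum_list as = v then {Suc a # as} else {}) \<inter> extensions (Suc a) (Suc a # as) v = {}"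
  by (fastforce simp: extensions_def append_eq_append_conv2 append_eq_Cons_conv split: if_splits)+

lemma sum_extensions_Suc:
  "(\<Sum>bs\<in>extensions (Suc a) as v. f bs) = (\<Sum>bs\<in>extensions a as v. f bs) +
     ((if Suc a + sum_list as = v then f (Suc a # as) else 0) +
      (\<Sum>bs\<in>extensions (Suc a) (Suc a # as) v. f bs))"
proof -
  let ?B = "if Suc a + sum_list as = v then {Suc a # as} else {}"
  have B: "finite ?B" by simp
  have "sum f (extensions (Suc a) as v) =
      sum f (extensions a as v) + sum f (?B \<union> extensions (Suc a) (Suc a # as) v)"
    unfolding extensions_Suc[of a as v] using B finite_extensions extensions_disjoint(1)
    by (intro sum.union_disjoint) blast+
  also have "sum f (?B \<union> extensions (Suc a) (Suc a # as) v) =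
      sum f ?B + sum f (extensions (Suc a) (Suc a # as) v)"
    using B finite_extensions extensions_disjoint(2) by (intro sum.union_disjoint)
  finally show ?thesis by simp
qed

lemma extensions_trivial:
  assumes "v \<le> sum_list as" shows "extensions a as v = {}"
proof -
  have "0 < sum_list ps" if "ps \<noteq> []" "set ps \<subseteq> {1..a}" for ps
    using that by (cases ps) auto
  then have "\<not> (ps \<noteq> [] \<and> sorted ps \<and> set ps \<subseteq> {1..a} \<and> sum_list ps + sum_list as = v)" for ps
    using assms by (metis add_le_same_cancel2 le_zero_eq less_irrefl)
  then show ?thesis by (simp add: extensions_def)
qed

lemma extensions_empty:
  assumes "r < Suc a" "v \<le> r + sum_list as" shows "extensions (Suc a) (Suc a # as) v = {}"
  using assms by (auto simp: extensions_def)

lemma ptree_correct: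
  assumes "represents s (pair_lens as)" "length s = 25" "z = centralizer_order (mset as)"
    "r + sum_list as = 18" "0 \<notin> set as" "j < r" "k \<le> 24"
  shows "entry2 (ptree a r as s z) j k =
    (\<Sum>bs\<in>extensions a as (Suc j + sum_list as). part_term (Suc j + sum_list as) k bs)"
  using assms
proof (induction a r as s z arbitrary: j rule: ptree.induct)
  case (1 r as s z)
  have "extensions 0 as v = {}" for v by (auto simp: extensions_def)
  then show ?case by simp
next
  case (2 a r as s z)
  let ?v = "Suc j + sum_list as"
  show ?case
  proof (cases "Suc a \<le> r")
    case False
    have "extensions (Suc a) (Suc a # as) ?v = {}" "Suc a + sum_list as \<noteq> ?v"
      using extensions_empty[of r a ?v as] False "2.prems" by auto
    then have "(\<Sum>bs\<in>extensions (Suc a) as ?v. part_term ?v k bs) =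
        (\<Sum>bs\<in>extensions a as ?v. part_term ?v k bs)"
      using sum_extensions_Suc[of "part_term ?v k" a as ?v] by simp
    then show ?thesis using "2.IH"(3)[OF False "2.prems"] False by simp
  next
    case True
    define s1 where "s1 = mult_groups (new_groups (Suc a) as) s"
    define z1 where "z1 = z * (Suc a * Suc (count_list as (Suc a)))"
    \<comment> \<open>Budget and sum of the chosen parts always add up to 18, so this is the sum of
      \<open>Suc a # as\<close>, the degree of the permutations concerned.\<close>
    define v1 where "v1 = 18 - (r - Suc a)"
    define w where "w = fact_tab ! v1 div z1"
    have v1: "v1 = Suc a + sum_list as" "v1 \<le> 18" using True "2.prems"(4) by (auto simp: v1_def)
    have P: "ptree (Suc a) r as s z = add_rows (ptree a r as s z)
        (replicate a [] @ map ((*) w) s1 # ptree (Suc a) (r - Suc a) (Suc a # as) s1 z1)"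
      using True by (simp add: s1_def z1_def w_def v1_def Let_def)
    have pos: "0 < l" if "(l, c) \<in> set (new_groups (Suc a) as)" "0 < c" for l c
      using that "2.prems"(5)
      by (auto simp: new_groups_def split: if_splits intro!: lcm_pos_nat intro: gr0I elim!: evenE)
    have s1: "represents s1 (pair_lens (Suc a # as))" "length s1 = 25"
      unfolding s1_def pair_lens_Cons
      using represents_mult_groups[OF "2.prems"(1) _ pos] "2.prems"(2) by auto
    have z1: "z1 = centralizer_order (mset (Suc a # as))"
      by (simp add: z1_def "2.prems"(3) centralizer_order_add count_mset)
    have self: "entry (map ((*) w) s1) k = part_term v1 k (Suc a # as)"
      using s1 "2.prems"(7) v1(2)
      by (simp add: entry_def represents_def part_term_def w_def fact_tab z1)
    have sub: "entry2 (ptree (Suc a) (r - Suc a) (Suc a # as) s1 z1) i k =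
        (\<Sum>bs\<in>extensions (Suc a) (Suc a # as) (Suc i + v1). part_term (Suc i + v1) k bs)"
      if "i < r - Suc a" for i
    proof -
      have "r - Suc a + sum_list (Suc a # as) = 18" "0 \<notin> set (Suc a # as)"
        using True "2.prems"(4,5) by auto
      from "2.IH"(2)[OF True s1_def z1_def w_def[unfolded v1_def] s1 z1 this that "2.prems"(7)]
      show ?thesis by (simp only: v1(1) sum_list.Cons)
    qed
    have left: "entry2 (ptree a r as s z) j k =
        (\<Sum>bs\<in>extensions a as ?v. part_term ?v k bs)"
      using "2.IH"(1)[OF True s1_def z1_def w_def[unfolded v1_def] "2.prems"] .
    have right: "entry2 (replicate a [] @ map ((*) w) s1 #
          ptree (Suc a) (r - Suc a) (Suc a # as) s1 z1) j k =
        (if Suc a + sum_list as = ?v then part_term ?v k (Suc a # as) else 0) +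
        (\<Sum>bs\<in>extensions (Suc a) (Suc a # as) ?v. part_term ?v k bs)"
    proof -
      \<comment> \<open>Row \<open>j\<close> stands for an increase of the sum by
        \<open>Suc j\<close>. Below \<open>a\<close> this is too little for the part
        \<open>Suc a\<close>, at \<open>a\<close> it is that part alone, and beyond it the recursive
        call applies, shifted by \<open>Suc a\<close> rows.\<close>
      consider "j < a" | "j = a" | i where "j = Suc a + i" by (metis less_iff_Suc_add linorder_neqE_nat add_Suc)
      then show ?thesis
      proof cases
        case 1
        then have "extensions (Suc a) (Suc a # as) ?v = {}" by (intro extensions_trivial) simp
        then show ?thesis using 1 by (simp add: entry2_shift)
      next
        case 2
        then have "extensions (Suc a) (Suc a # as) ?v = {}" by (intro extensions_trivial) simp
        then show ?thesis using 2 self by (simp add: entry2_shift v1(1))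
      next
        case (3 i)
        then have i: "i < r - Suc a" and v: "?v = Suc i + v1" and ne: "Suc a + sum_list as \<noteq> ?v"
          using "2.prems"(6) v1(1) by auto
        have lhs: "entry2 (replicate a [] @ map ((*) w) s1 #
            ptree (Suc a) (r - Suc a) (Suc a # as) s1 z1) j k =
          entry2 (ptree (Suc a) (r - Suc a) (Suc a # as) s1 z1) i k"
          using 3 by (simp add: entry2_shift del: ptree.simps)
        show ?thesis
          unfolding lhs if_not_P[OF ne] unfolding v sub[OF i] by simp
      qed
    qed
    show ?thesis
      unfolding P entry2_add_rows left right sum_extensions_Suc[of _ a as] by simp
  qed
qed

definition series_one :: "nat list" where
  "series_one = [1, 0, 0, 0, 0, 0, 0, 0, 0, 0, 0, 0, 0, 0, 0, 0, 0, 0, 0, 0, 0, 0, 0, 0, 0]"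

theorem unl_eq_ptree:
  assumes "j < 18" "k \<le> 24"
  shows "fact (Suc j) * unl (Suc j) k = entry2 (ptree 18 18 [] series_one 1) j k"
proof -
  let ?n = "Suc j"
  have ex: "extensions 18 [] ?n = partition_lists ?n"
  proof (intro equalityI subsetI)
    fix bs assume "bs \<in> partition_lists ?n"
    then have bs: "sorted bs" "0 \<notin> set bs" "sum_list bs = ?n" by (auto simp: partition_lists_def)
    have "set bs \<subseteq> {1..18}"
    proof
      fix b assume b: "b \<in> set bs"
      then have "b \<noteq> 0" using bs(2) by metis
      moreover have "b \<le> ?n" using b bs(3) member_le_sum_list by fastforce
      ultimately show "b \<in> {1..18}" using assms(1) by simp
    qed
    moreover have "bs \<noteq> []" using bs(3) by auto
    ultimately show "bs \<in> extensions 18 [] ?n" using bs by (simp add: extensions_def)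
  qed (auto simp: extensions_def partition_lists_def)
  have "represents series_one (pair_lens [])" "length series_one = 25"
    by (auto simp: represents_def series_one_def pair_lens_def expand_groups_def less_Suc_eq_0_disj nth_Cons')
  then have "entry2 (ptree 18 18 [] series_one 1) j k =
      (\<Sum>bs\<in>extensions 18 [] (Suc j + sum_list []). part_term (Suc j + sum_list []) k bs)"
    using assms by (intro ptree_correct) (auto simp: centralizer_order_empty)
  also have "\<dots> = (\<Sum>bs\<in>partition_lists ?n. part_term ?n k bs)" by (simp only: sum_list.Nil add_0_right ex)
  also have "\<dots> = fact ?n * unl ?n k" unfolding unl_formula part_term_def ..
  finally show ?thesis ..
qed

text \<open>Row \<open>v\<close>, column \<open>k\<close> holds \<open>unl v k\<close> for
  \<open>v \<le> 18\<close> and \<open>k \<le> 24\<close>, as \<open>unl_eq_tab\<close>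
  proves.\<close>

definition unl_tab :: "nat list list" where
  "unl_tab = [
    [1, 0, 0, 0, 0, 0, 0, 0, 0, 0, 0, 0, 0, 0, 0, 0, 0, 0, 0, 0, 0, 0, 0, 0, 0],
    [1, 0, 0, 0, 0, 0, 0, 0, 0, 0, 0, 0, 0, 0, 0, 0, 0, 0, 0, 0, 0, 0, 0, 0, 0],
    [1, 1, 1, 1, 1, 1, 1, 1, 1, 1, 1, 1, 1, 1, 1, 1, 1, 1, 1, 1, 1, 1, 1, 1, 1],
    [1, 1, 2, 3, 4, 5, 7, 8, 10, 12, 14, 16, 19, 21, 24, 27, 30, 33, 37, 40, 44, 48, 52, 56, 61],
    [1, 1, 3, 6, 11, 18, 32, 48, 75, 111, 160, 224, 313, 420, 562, 738, 956, 1221, 1550, 1936,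
     2405, 2958, 3609, 4368, 5260],
    [1, 1, 3, 7, 17, 35, 76, 149, 291, 539, 974, 1691, 2874, 4730, 7620, 11986, 18485, 27944,
     41550, 60744, 87527, 124338, 174403, 241650, 331153],
    [1, 1, 3, 8, 21, 52, 132, 313, 741, 1684, 3711, 7895, 16310, 32604, 63363, 119745, 220546,
     396428, 696750, 1198812, 2022503, 3349574, 5452496, 8732932, 13776366],
    [1, 1, 3, 8, 22, 60, 173, 471, 1303, 3510, 9234, 23574, 58464, 140340, 326792, 738090,
     1619321, 3455129, 7180856, 14555856, 28819926, 55808840, 105834657, 196779279, 359124362],
    [1, 1, 3, 8, 23, 64, 197, 588, 1806, 5509, 16677, 49505, 143761, 406091, 1114890, 2970964,
     7685972, 19311709, 47170674, 112123118, 259662333, 586583731, 1294143065, 2791716176,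
     5895027869],
    [1, 1, 3, 8, 23, 65, 206, 645, 2121, 7042, 23615, 78845, 260526, 844911, 2679422, 8280672,
     24900625, 72797692, 206906004, 571913238, 1538467541, 4031036974, 10297548027, 25672985025,
     62529921261],
    [1, 1, 3, 8, 23, 66, 210, 671, 2283, 7964, 28494, 103220, 375543, 1358128, 4851060, 17015285,
     58389489, 195533148, 638081578, 2027677587, 6273874644, 18905818588, 55513798559,
     158944901223, 444090638818],
    [1, 1, 3, 8, 23, 66, 211, 680, 2347, 8392, 31153, 118662, 460621, 1802421, 7053679, 27396123,
     104991688, 395243518, 1457002920, 5248431818, 18451338205, 63267199041, 211546181264,
     689877613525, 2195041381401],
    [1, 1, 3, 8, 23, 66, 212, 684, 2374, 8574, 32380, 126643, 510517, 2100956, 8759231, 36687382,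
     153270352, 634767848, 2593453320, 10414568349, 40996981328, 157916042319, 594531003482,
     2186405971716, 7852313265055],
    [1, 1, 3, 8, 23, 66, 212, 685, 2383, 8640, 32862, 130101, 534585, 2262738, 9806336, 43185448,
     191866801, 854072028, 3786041295, 16628259281, 72061201563, 307174979025, 1284995735610,
     5266885517761, 21129580153018],
    [1, 1, 3, 8, 23, 66, 212, 686, 2387, 8667, 33051, 131475, 544733, 2336972, 10337474, 46870463,
     216513479, 1012472046, 4762923216, 22408475683, 104895265170, 486419697203, 2226638815944,
     10034253212971, 44425461000724],
    [1, 1, 3, 8, 23, 66, 212, 686, 2388, 8676, 33118, 131977, 548592, 2366896, 10568563, 48625631,
     229504968, 1105569954, 5406307498, 26687837080, 132271197561, 654885981486, 3224607536303,
     15730980749377, 75798867587554],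
    [1, 1, 3, 8, 23, 66, 212, 686, 2389, 8680, 33145, 132168, 550025, 2378128, 10658921, 49356177,
     235357470, 1151511724, 5757021559, 29279157755, 150754030065, 781993798674, 4067208823034,
     21117044709032, 109021835999775],
    [1, 1, 3, 8, 23, 66, 212, 686, 2389, 8681, 33154, 132235, 550534, 2382146, 10691797, 49631881,
     237690821, 1171163995, 5919927877, 30597607768, 161117575784, 860861701558, 4647327637637,
     25238742466714, 137308825145011],
    [1, 1, 3, 8, 23, 66, 212, 686, 2389, 8682, 33158, 132262, 550726, 2383599, 10703477, 49730320,
     238546300, 1178706266, 5986424739, 31177136505, 166067982291, 902070815511, 4980408204813,
     27847269013532, 157082354010176]]"

text \<open>Row \<open>a\<close>, column \<open>b\<close> is for the connected classes with
  \<open>a\<close> vertices and \<open>b\<close> edges. The first nonzero entries of the rows, in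
  column \<open>a - 1\<close>, are the numbers of trees: 1, 1, 2, 3, 6, 11, 23 and so on.\<close>

definition conn_tab :: "nat list list" where
  "conn_tab = [
    [0, 0, 0, 0, 0, 0, 0, 0, 0, 0, 0, 0, 0, 0, 0, 0, 0, 0, 0, 0, 0, 0, 0, 0, 0],
    [0, 0, 0, 0, 0, 0, 0, 0, 0, 0, 0, 0, 0, 0, 0, 0, 0, 0, 0, 0, 0, 0, 0, 0, 0],
    [0, 1, 1, 1, 1, 1, 1, 1, 1, 1, 1, 1, 1, 1, 1, 1, 1, 1, 1, 1, 1, 1, 1, 1, 1],
    [0, 0, 1, 2, 3, 4, 6, 7, 9, 11, 13, 15, 18, 20, 23, 26, 29, 32, 36, 39, 43, 47, 51, 55, 60],
    [0, 0, 0, 2, 5, 11, 22, 37, 61, 95, 141, 203, 288, 393, 531, 704, 918, 1180, 1504, 1887, 2351,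
     2900, 3546, 4301, 5187],
    [0, 0, 0, 0, 3, 11, 34, 85, 193, 396, 771, 1411, 2490, 4221, 6949, 11116, 17371, 26536, 39781,
     58553, 84828, 121043, 170410, 236847, 325403],
    [0, 0, 0, 0, 0, 6, 29, 110, 348, 969, 2445, 5746, 12736, 26843, 54256, 105669, 199170, 364565,
     649956, 1131159, 1925974, 3213653, 5263326, 8472653, 13421898],
    [0, 0, 0, 0, 0, 0, 11, 70, 339, 1318, 4457, 13572, 38201, 100622, 251078, 597554, 1364722,
     3004250, 6398915, 13226339, 26600435, 52167176, 99955523, 187431741, 344473926],
    [0, 0, 0, 0, 0, 0, 0, 23, 185, 1067, 4940, 19753, 70930, 234096, 721332, 2097462, 5801091,
     15351493, 39054916, 95879452, 227863718, 525627224, 1179582797, 2580410577, 5512121962],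
    [0, 0, 0, 0, 0, 0, 0, 0, 47, 479, 3294, 17927, 83732, 349156, 1333992, 4743843, 15881206,
     50455727, 153070783, 445562689, 1249252040, 3384596070, 8884978643, 22652027734, 56200120477],
    [0, 0, 0, 0, 0, 0, 0, 0, 0, 106, 1279, 10218, 64182, 344070, 1643022, 7169559, 29067481,
     110754990, 399907209, 1376897712, 4542633166, 14417080816, 44158527181, 130888576125,
     376316200226],
    [0, 0, 0, 0, 0, 0, 0, 0, 0, 0, 235, 3413, 31455, 225567, 1373921, 7430359, 36645872,
     167659453, 720003511, 2926921776, 11334739937, 42021634061, 149729817677, 514429402039,
     1708871120541],
    [0, 0, 0, 0, 0, 0, 0, 0, 0, 0, 0, 551, 9261, 96807, 783229, 5361580, 32516178, 179544427,
     918629994, 4407747054, 20004863139, 86433959396, 357288943135, 1418605192960, 5427757446233],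
    [0, 0, 0, 0, 0, 0, 0, 0, 0, 0, 0, 0, 1301, 25184, 296762, 2686412, 20499779, 138283088,
     848095079, 4814970946, 25617875768, 128852138104, 616684906096, 2822493486501,
     12403062313404],
    [0, 0, 0, 0, 0, 0, 0, 0, 0, 0, 0, 0, 0, 3159, 69122, 908418, 9124992, 77031590, 573794691,
     3881316558, 24284574649, 142310908166, 788067937167, 4151129607765, 20904506409357],
    [0, 0, 0, 0, 0, 0, 0, 0, 0, 0, 0, 0, 0, 0, 7741, 190451, 2773772, 30716622, 285048956,
     2330057270, 17277449155, 118417694383, 759813073515, 4605461016965, 26546767056472],
    [0, 0, 0, 0, 0, 0, 0, 0, 0, 0, 0, 0, 0, 0, 0, 19320, 527641, 8456064, 102605186, 1040711148,
     9283913001, 75054416644, 560501106278, 3917022879083, 25852248812418],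
    [0, 0, 0, 0, 0, 0, 0, 0, 0, 0, 0, 0, 0, 0, 0, 0, 48629, 1467058, 25732055, 340351420,
     3754365670, 36372017628, 319046297120, 2583741479514, 19573556191833]]"

text \<open>The link between the two previous tables: it is related to \<open>unl_tab\<close> by a
  convolution and to \<open>conn_tab\<close> by divisor sums, and each relation can be solved
  separately.\<close>

definition wdiv_tab :: "nat list list" where
  "wdiv_tab = [
    [0, 0, 0, 0, 0, 0, 0, 0, 0, 0, 0, 0, 0, 0, 0, 0, 0, 0, 0, 0, 0, 0, 0, 0, 0],
    [0, 0, 0, 0, 0, 0, 0, 0, 0, 0, 0, 0, 0, 0, 0, 0, 0, 0, 0, 0, 0, 0, 0, 0, 0],
    [0, 1, 2, 3, 4, 5, 6, 7, 8, 9, 10, 11, 12, 13, 14, 15, 16, 17, 18, 19, 20, 21, 22, 23, 24],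
    [0, 0, 2, 6, 12, 20, 36, 49, 72, 99, 130, 165, 216, 260, 322, 390, 464, 544, 648, 741, 860,
     987, 1122, 1265, 1440],
    [0, 0, 1, 6, 22, 55, 135, 259, 492, 855, 1415, 2233, 3462, 5109, 7441, 10560, 14696, 20060,
     27081, 35853, 47030, 60900, 78023, 98923, 124500],
    [0, 0, 0, 0, 12, 55, 204, 595, 1544, 3564, 7710, 15521, 29880, 54873, 97286, 166740, 277936,
     451112, 716058, 1112507, 1696560, 2541903, 3749020, 5447481, 7809672],
    [0, 0, 0, 1, 2, 30, 182, 770, 2796, 8724, 24470, 63206, 152872, 348959, 759633, 1585040,
     3186792, 6197605, 11699313, 21492021, 38519610, 67486720, 115793337, 194871019, 322125776],
    [0, 0, 0, 0, 0, 0, 66, 490, 2712, 11862, 44570, 149292, 458412, 1308086, 3515092, 8963310,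
     21835552, 51072250, 115180470, 251300441, 532008700, 1095510696, 2199021506, 4310930043,
     8267374224],
    [0, 0, 0, 0, 1, 0, 6, 161, 1502, 9603, 49455, 217283, 851295, 3043248, 10098907, 31461930,
     92817948, 260975381, 702989343, 1821709588, 4557275775, 11038171704, 25950823767,
     59349443271, 132290930550],
    [0, 0, 0, 0, 0, 0, 2, 0, 376, 4317, 32940, 197197, 1004796, 4539028, 18675888, 71157665,
     254099296, 857747359, 2755274130, 8465691091, 24985040800, 71076517519, 195469530146,
     520996637882, 1348802891520],
    [0, 0, 0, 0, 0, 1, 0, 0, 12, 954, 12847, 112398, 770388, 4472910, 23002903, 107543388,
     465081240, 1882834830, 7198333326, 26161056528, 90852671034, 302758697136, 971487613503,
     3010437250875, 9031588835304],
    [0, 0, 0, 0, 0, 0, 0, 0, 0, 0, 2350, 37543, 377460, 2932371, 19234894, 111455385, 586333952,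
     2850210701, 12960063198, 55611513744, 226694798740, 882454315281, 3294055988894,
     11831876246897, 41012906892984],
    [0, 0, 0, 0, 0, 0, 1, 0, 2, 6, 30, 6061, 111334, 1258491, 10965976, 80423755, 520261644,
     3052255259, 16535348748, 83747194026, 400097287250, 1815113147575, 7860356812176,
     32627919438080, 130266178862952],
    [0, 0, 0, 0, 0, 0, 0, 0, 0, 0, 0, 0, 15612, 327392, 4154668, 40296180, 327996464, 2350812496,
     15265711422, 91484447974, 512357515360, 2705894900184, 13567067934112, 64917350189523,
     297673495521696],
    [0, 0, 0, 0, 0, 0, 0, 1, 0, 0, 0, 0, 66, 41067, 968200, 13626270, 146002584, 1309537030,
     10328316300, 73745014602, 485691537550, 2988529071489, 17337494766966, 95475980978595,
     501708154282980],
    [0, 0, 0, 0, 0, 0, 0, 0, 0, 0, 2, 0, 12, 0, 108374, 2856826, 44380352, 522182574, 5130881412,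
     44271088130, 345548983112, 2486771582638, 16715887617330, 105925603390195, 637122409356872],
    [0, 0, 0, 0, 0, 0, 0, 0, 1, 0, 0, 0, 6, 0, 161, 289800, 8443758, 143753088, 1846902951,
     19773511812, 185678309475, 1576142749524, 12331024555399, 90091526218909, 620453972349327],
    [0, 0, 0, 0, 0, 0, 0, 0, 0, 0, 0, 0, 0, 0, 0, 0, 778064, 24939986, 463176990, 6466676980,
     75087313400, 763812370188, 7019018536640, 59426054028822, 469765348603992]]"

text \<open>The rows are multiplied by factorials, as Burnside's sums are. The first row is dropped
  because the traversal yields nonempty partitions only; \<open>unl_0\<close> supplies it.\<close>

lemma unl_tab_check:
  "ptree 18 18 [] series_one 1 = map2 (\<lambda>f. map ((*) f)) (tl fact_tab) (tl unl_tab)"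
  by code_simp

lemma unl_tab_shape: "length unl_tab = 19 \<and> (\<forall>row\<in>set unl_tab. length row = 25)"
  by code_simp

lemma unl_tab_zero: "unl_tab ! 0 = 1 # replicate 24 0"
  by code_simp

lemma unl_0: "unl 0 k = (if k = 0 then 1 else 0)"
proof -
  have "as = []" if "as \<in> partition_lists 0" for as
    using that by (cases as) (auto simp: partition_lists_def)
  then have "partition_lists 0 = {[]}" by (auto simp: partition_lists_def)
  then show ?thesis
    using unl_formula[of 0 k]
    by (simp add: centralizer_order_empty pair_lens_def expand_groups_def)
qed

theorem unl_eq_tab:
  assumes "v \<le> 18" "k \<le> 24"
  shows "unl v k = unl_tab ! v ! k"
proof (cases v)
  case 0
  then show ?thesis using assms by (simp add: unl_0 unl_tab_zero nth_Cons')
next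
  case (Suc j)
  have shape: "length (unl_tab ! v) = 25" using unl_tab_shape assms(1) by simp
  have lens: "length (tl fact_tab) = 18" "length (tl unl_tab) = 18"
    using unl_tab_shape by (simp_all add: fact_tab_def)
  have "fact v * unl v k = entry2 (ptree 18 18 [] series_one 1) j k"
    unfolding Suc using assms Suc by (intro unl_eq_ptree) auto
  also have "\<dots> = tl fact_tab ! j * (tl unl_tab ! j) ! k"
    unfolding unl_tab_check using assms Suc lens shape
    by (simp add: entry2_def entry_def nth_tl)
  also have "\<dots> = fact v * unl_tab ! v ! k"
  proof -
    have "tl fact_tab ! j = fact v"
      using assms Suc lens fact_tab[of v] by (simp add: nth_tl del: fact_Suc)
    moreover have "tl unl_tab ! j = unl_tab ! v" using assms Suc lens by (simp add: nth_tl)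
    ultimately show ?thesis by (simp only:)
  qed
  finally show ?thesis by simp
qed

section \<open>Numbers of connected classes\<close>

fun conv :: "nat list \<Rightarrow> nat list \<Rightarrow> nat list" where
  "conv [] u = []"
| "conv (b # bs) u = add_lists (if b = 0 then [] else map ((*) b) u) (0 # conv bs (butlast u))"

text \<open>The Cauchy product, exact up to the length of \<open>u\<close>: each shift by one place
  is compensated by dropping the last entry of \<open>u\<close>.\<close>

lemma entry_conv:
  "k < length u \<Longrightarrow> entry (conv b u) k = (\<Sum>j\<in>{0..k}. entry b j * u ! (k - j))"
proof (induction b u arbitrary: k rule: conv.induct)
  case (2 b bs u)
  have first: "entry (if b = 0 then [] else map ((*) b) u) k = b * u ! k"
    using "2.prems" by (simp add: entry_def)
  show ?case
  proof (cases k)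
    case 0
    then show ?thesis using first by (simp add: entry_add_lists)
  next
    case (Suc i)
    then have i: "i < length (butlast u)" using "2.prems" by simp
    have "entry (conv bs (butlast u)) i = (\<Sum>j\<in>{0..i}. entry bs j * butlast u ! (i - j))"
      by (rule "2.IH"[OF i])
    also have "\<dots> = (\<Sum>j\<in>{0..i}. entry bs j * u ! (i - j))"
      using i by (intro sum.cong) (auto simp: nth_butlast)
    also have "\<dots> = (\<Sum>j\<in>{Suc 0..Suc i}. entry (b # bs) j * u ! (Suc i - j))"
      by (subst sum.shift_bounds_cl_Suc_ivl) simp
    finally have rest: "entry (conv bs (butlast u)) i = \<dots>" .
    have "(\<Sum>j\<in>{0..k}. entry (b # bs) j * u ! (k - j)) =
        b * u ! k + (\<Sum>j\<in>{Suc 0..Suc i}. entry (b # bs) j * u ! (Suc i - j))"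
      unfolding Suc by (subst sum.atLeast_Suc_atMost) simp_all
    then show ?thesis
      using first rest unfolding Suc by (simp only: conv.simps entry_add_lists) simp
  qed
qed simp

lemma entry_foldr_add_lists:
  "entry (foldr (\<lambda>w. add_lists (g w)) ws []) k = (\<Sum>w\<leftarrow>ws. entry (g w) k)"
  by (induction ws) (auto simp: entry_add_lists)

definition conv_total :: "nat \<Rightarrow> nat list" where
  "conv_total v = foldr (\<lambda>w. add_lists (conv (wdiv_tab ! w) (unl_tab ! (v - w)))) [0..<Suc v] []"

text \<open>The recurrence of \<open>card_wmsets_wdiv\<close> for the tabulated numbers; the factor
  \<open>k\<close> on its left-hand side is supplied by \<open>[0..<25]\<close>.\<close>

lemma conv_total_check:
  "map (\<lambda>v. conv_total v) [0..<18] = map (\<lambda>v. map2 (*) [0..<25] (unl_tab ! v)) [0..<18]"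
  by code_simp

lemma wdiv_tab_shape: "length wdiv_tab = 18 \<and> (\<forall>row\<in>set wdiv_tab. length row = 25 \<and> row ! 0 = 0)"
  by code_simp

lemma conn_tab_shape: "length conn_tab = 18 \<and> (\<forall>row\<in>set conn_tab. length row = 25)"
  by code_simp

definition wdiv_list :: "(nat \<Rightarrow> nat \<Rightarrow> nat) \<Rightarrow> nat \<Rightarrow> nat \<Rightarrow> nat" where
  "wdiv_list c w j = sum_list (map (\<lambda>i. if j mod i = 0
     then if w mod i = 0 then (j div i) * c (w div i) (j div i) else 0 else 0) [1..<Suc j])"

lemma wdiv_list_eq: "wdiv_list c w j = wdiv c w j"
proof -
  have "wdiv_list c w j = (\<Sum>i\<in>{1..<Suc j}. if j mod i = 0
     then if w mod i = 0 then (j div i) * c (w div i) (j div i) else 0 else 0)"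
    unfolding wdiv_list_def by (simp only: interv_sum_list_conv_sum_set_nat set_upt)
  also have "\<dots> = wdiv c w j"
    unfolding wdiv_def by (intro sum.cong) (auto simp: dvd_eq_mod_eq_0)
  finally show ?thesis .
qed

lemma wdiv_tab_check:
  "map (\<lambda>w. map (wdiv_list (\<lambda>a b. conn_tab ! a ! b) w) [0..<25]) [0..<18] = wdiv_tab"
  by code_simp

abbreviation conn_count :: "nat \<Rightarrow> nat \<Rightarrow> nat" where
  "conn_count a b \<equiv> card {q \<in> conn_classes 17 24. nv q = a \<and> ne q = b}"

text \<open>The true values and the tabulated ones satisfy the same recurrence, and in the equation
  for \<open>(v, k)\<close> every summand with \<open>w < v\<close> is known by induction on
  \<open>v\<close>.\<close>

lemma wdiv_conn_count:
  assumes "v \<le> 17" "1 \<le> k" "k \<le> 24"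
  shows "wdiv conn_count v k = wdiv_tab ! v ! k"
  using assms
proof (induction v arbitrary: k rule: less_induct)
  case (less v)
  let ?f = "\<lambda>b w. \<Sum>j\<in>{1..k}. b w j * unl_tab ! (v - w) ! (k - j)"
  have split: "{0..v} = insert v {0..<v}" by auto
  have "k * unl v k = (\<Sum>w\<in>{0..v}. \<Sum>j\<in>{1..k}. wdiv conn_count w j * unl (v - w) (k - j))"
    using card_wmsets_wdiv[of "conn_classes 17 24" ne k nv v] less.prems
      finite_conn_classes[of 17 24] ne_conn_classes[of _ 17 24]
    by (simp add: unl_eq_card_wmsets[of _ 17 _ 24])
  also have "\<dots> = (\<Sum>w\<in>{0..v}. ?f (wdiv conn_count) w)"
    using less.prems by (intro sum.cong refl) (simp add: unl_eq_tab)
  also have "\<dots> = ?f (wdiv conn_count) v + (\<Sum>w\<in>{0..<v}. ?f (wdiv conn_count) w)"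
    unfolding split by simp
  also have "(\<Sum>w\<in>{0..<v}. ?f (wdiv conn_count) w) = (\<Sum>w\<in>{0..<v}. ?f (\<lambda>w j. wdiv_tab ! w ! j) w)"
    using less by (intro sum.cong refl) simp
  finally have eq1: "k * unl v k = ?f (wdiv conn_count) v +
      (\<Sum>w\<in>{0..<v}. ?f (\<lambda>w j. wdiv_tab ! w ! j) w)" .

  have lenU: "length (unl_tab ! u) = 25" if "u \<le> 18" for u using unl_tab_shape that by simp
  have W: "length (wdiv_tab ! w) = 25" "wdiv_tab ! w ! 0 = 0" if "w \<le> 17" for w
    using wdiv_tab_shape that by (auto simp: all_set_conv_all_nth)
  have "entry (conv_total v) k = k * unl_tab ! v ! k"
  proof -
    have "conv_total v = map2 (*) [0..<25] (unl_tab ! v)"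
      using arg_cong[OF conv_total_check, of "\<lambda>xs. xs ! v"] less.prems by simp
    then show ?thesis using less.prems lenU[of v] by (simp add: entry_def)
  qed
  moreover have "entry (conv_total v) k = (\<Sum>w\<in>{0..<Suc v}. entry (conv (wdiv_tab ! w) (unl_tab ! (v - w))) k)"
    unfolding conv_total_def
    by (simp only: entry_foldr_add_lists interv_sum_list_conv_sum_set_nat set_upt)
  moreover have "entry (conv (wdiv_tab ! w) (unl_tab ! (v - w))) k = ?f (\<lambda>w j. wdiv_tab ! w ! j) w"
    if "w \<le> v" for w
  proof -
    have "entry (conv (wdiv_tab ! w) (unl_tab ! (v - w))) k =
        (\<Sum>j\<in>{0..k}. entry (wdiv_tab ! w) j * unl_tab ! (v - w) ! (k - j))"
      using less.prems lenU[of "v - w"] by (intro entry_conv) simp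
    also have "\<dots> = ?f (\<lambda>w j. wdiv_tab ! w ! j) w"
      using that less.prems W[of w] by (auto simp: sum.atLeast_Suc_atMost[of 0 k] entry_def intro!: sum.cong)
    finally show ?thesis .
  qed
  ultimately have "k * unl_tab ! v ! k = (\<Sum>w\<in>{0..<Suc v}. ?f (\<lambda>w j. wdiv_tab ! w ! j) w)"
    by simp
  then have eq2: "k * unl_tab ! v ! k = ?f (\<lambda>w j. wdiv_tab ! w ! j) v +
      (\<Sum>w\<in>{0..<v}. ?f (\<lambda>w j. wdiv_tab ! w ! j) w)" by simp
  \<comment> \<open>For \<open>w = v\<close> the other factor comes from the row for 0 vertices,
    which is the series 1, so only \<open>j = k\<close> survives.\<close>
  have single: "?f b v = b v k" for b :: "nat \<Rightarrow> nat \<Rightarrow> nat"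
  proof -
    have "?f b v = (\<Sum>j\<in>{1..k}. if j = k then b v k else 0)"
      using less.prems by (intro sum.cong) (auto simp: unl_tab_zero nth_Cons')
    then show ?thesis using less.prems by simp
  qed
  show ?case
    using eq1 eq2 unl_eq_tab[of v k] less.prems single[of "wdiv conn_count"]
      single[of "\<lambda>w j. wdiv_tab ! w ! j"] by simp
qed

text \<open>In the divisor sum the term \<open>i = 1\<close> is \<open>j\<close> times the unknown
  count, and all others concern \<open>j div i < j\<close>; so induction on \<open>j\<close> inverts
  the divisor sum.\<close>

lemma conn_count_eq_tab:
  assumes "w \<le> 17" "1 \<le> j" "j \<le> 24"
  shows "conn_count w j = conn_tab ! w ! j"
  using assms
proof (induction j arbitrary: w rule: less_induct)
  case (less j)
  let ?t = "\<lambda>c i. if i dvd w \<and> i dvd j then (j div i) * c (w div i) (j div i) else (0::nat)"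
  have split: "wdiv c w j = j * c w j + (\<Sum>i\<in>{2..j}. ?t c i)" for c
    unfolding wdiv_def using less.prems by (simp add: sum.atLeast_Suc_atMost numeral_2_eq_2)
  have "wdiv conn_count w j = wdiv (\<lambda>a b. conn_tab ! a ! b) w j"
  proof -
    have "wdiv_tab ! w ! j = wdiv_list (\<lambda>a b. conn_tab ! a ! b) w j"
      using arg_cong[OF wdiv_tab_check, of "\<lambda>xs. xs ! w ! j"] less.prems by simp
    then show ?thesis using wdiv_conn_count less.prems by (simp add: wdiv_list_eq)
  qed
  moreover have "(\<Sum>i\<in>{2..j}. ?t conn_count i) = (\<Sum>i\<in>{2..j}. ?t (\<lambda>a b. conn_tab ! a ! b) i)"
  proof (rule sum.cong[OF refl])
    fix i assume i: "i \<in> {2..j}"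
    then have "j div i < j" "j div i \<ge> 1" "w div i \<le> 17"
      using less.prems by (auto simp: div_greater_zero_iff Suc_le_eq intro: le_trans[OF div_le_dividend])
    then show "?t conn_count i = ?t (\<lambda>a b. conn_tab ! a ! b) i"
      using less.IH[of "j div i" "w div i"] less.prems by simp
  qed
  ultimately have "j * conn_count w j = j * conn_tab ! w ! j" unfolding split by simp
  then show ?case using less.prems by simp
qed

section \<open>Numbers of products of connected orbit sums\<close>

definition gen_list :: "nat \<Rightarrow> nat list" where
  "gen_list n = foldr (\<lambda>v. add_lists (conn_tab ! v)) [0..<n] []"

lemma card_conn_classes_eq:
  assumes "n \<le> 18" "1 \<le> n" "1 \<le> b" "b \<le> d" "d \<le> 24"
  shows "card {q \<in> conn_classes (n - 1) d. ne q = b} = entry (gen_list n) b"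
proof -
  have "{q \<in> conn_classes (n - 1) d. ne q = b} = (\<Union>v\<in>{0..<n}. {q \<in> conn_classes 17 24. nv q = v \<and> ne q = b})"
    using assms by (fastforce simp: conn_classes_def nv_class ne_class)
  also have "card \<dots> = (\<Sum>v\<in>{0..<n}. conn_count v b)"
    using finite_conn_classes[of 17 24] by (intro card_UN_disjoint) auto
  also have "\<dots> = (\<Sum>v\<in>{0..<n}. entry (conn_tab ! v) b)"
    using assms conn_tab_shape by (intro sum.cong) (auto simp: conn_count_eq_tab entry_def)
  finally show ?thesis
    unfolding gen_list_def
    by (simp only: entry_foldr_add_lists interv_sum_list_conv_sum_set_nat set_upt)
qed

text \<open>The number of vertices is forgotten by giving every class vertex weight 0. As every
  \<open>i\<close> divides 0, \<open>wdiv\<close> becomes the divisor sum in one variable; the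
  leading 0 fills the place of degree 0.\<close>

definition gen_divs :: "nat list \<Rightarrow> nat \<Rightarrow> nat list" where
  "gen_divs c d = 0 # map (wdiv_list (\<lambda>_. entry c) 0) [1..<Suc d]"

text \<open>\<open>A\<close> proposes the numbers of products in degrees 0 to \<open>d\<close>. The
  first entry and the logarithmic derivative identity determine the list; the final inequality is
  the desired deficit.\<close>

definition mono_check :: "nat \<Rightarrow> nat \<Rightarrow> nat list \<Rightarrow> bool" where
  "mono_check n d A \<longleftrightarrow> length A = Suc d \<and> A ! 0 = 1 \<and>
    conv (gen_divs (gen_list n) d) A = map2 (*) [0..<Suc d] A \<and>
    A ! d < unl_tab ! n ! d"

text \<open>For \<open>0 < k\<close> the recurrence expresses \<open>k\<close> times the number in
  degree \<open>k\<close> through those in lower degrees, so induction identifies it with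
  \<open>A ! k\<close>.\<close>

theorem mono_check_correct:
  assumes "mono_check n d A" "n \<le> 18" "1 \<le> n" "d \<le> 24"
  shows "card (emsets (conn_classes (n - 1) d) ne d) < unl n d"
proof -
  let ?C = "conn_classes (n - 1) d"
  let ?B = "gen_divs (gen_list n) d"
  have A: "length A = Suc d" "A ! 0 = 1" "conv ?B A = map2 (*) [0..<Suc d] A"
    "A ! d < unl_tab ! n ! d" using assms(1) by (auto simp: mono_check_def)
  have "card (emsets ?C ne k) = A ! k" if "k \<le> d" for k
    using that
  proof (induction k rule: less_induct)
    case (less k)
    show ?case
    proof (cases "k = 0")
      case True
      have "emsets ?C ne 0 = {{#}}"
      proof -
        have "M = {#}" if "set_mset M \<subseteq> ?C" "(\<Sum>q\<in>#M. ne q) = 0" for M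
          using that ne_conn_classes[of _ "n - 1" d] by (cases M) force+
        then show ?thesis by (auto simp: emsets_def)
      qed
      then show ?thesis using True A(2) by simp
    next
      case False
      \<comment> \<open>The equation \<open>0 = a\<close> is the condition on the constant vertex
        weight 0 under which \<open>emsets\<close> is an instance of \<open>wmsets\<close>.\<close>
      let ?c = "\<lambda>a b. card {c \<in> ?C. 0 = a \<and> ne c = b}"
      have "k * card (emsets ?C ne k) =
          (\<Sum>j\<in>{1..k}. wdiv ?c 0 j * card (emsets ?C ne (k - j)))"
        using card_wmsets_wdiv[OF finite_conn_classes, of "n - 1" d ne k "\<lambda>_. 0" 0]
          ne_conn_classes[of _ "n - 1" d]
        by (simp add: emsets_eq_wmsets)
      also have "\<dots> = (\<Sum>j\<in>{1..k}. wdiv (\<lambda>_. entry (gen_list n)) 0 j * A ! (k - j))"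
      proof (rule sum.cong[OF refl])
        fix j assume j: "j \<in> {1..k}"
        have "wdiv ?c 0 j = wdiv (\<lambda>_. entry (gen_list n)) 0 j"
          unfolding wdiv_def
        proof (rule sum.cong[OF refl])
          fix i assume i: "i \<in> {1..j}"
          then have "1 \<le> j div i" "j div i \<le> d"
            using j less.prems by (auto simp: div_greater_zero_iff Suc_le_eq intro: le_trans[OF div_le_dividend])
          then have "?c 0 (j div i) = entry (gen_list n) (j div i)"
            using card_conn_classes_eq[of n "j div i" d] assms by simp
          then show "(if i dvd 0 \<and> i dvd j then j div i * ?c (0 div i) (j div i) else 0) =
            (if i dvd 0 \<and> i dvd j then j div i * entry (gen_list n) (j div i) else 0)" by simp
        qed
        then show "wdiv ?c 0 j * card (emsets ?C ne (k - j)) =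
            wdiv (\<lambda>_. entry (gen_list n)) 0 j * A ! (k - j)"
          using less.IH[of "k - j"] less.prems j by simp
      qed
      also have "\<dots> = (\<Sum>j\<in>{0..k}. entry ?B j * A ! (k - j))"
      proof -
        have "entry ?B j = wdiv (\<lambda>_. entry (gen_list n)) 0 j" if "j \<in> {1..k}" for j
          using that less.prems by (auto simp: gen_divs_def entry_def nth_Cons' wdiv_list_eq simp del: upt_Suc)
        then show ?thesis by (simp add: sum.atLeast_Suc_atMost[of 0 k] gen_divs_def)
      qed
      also have "\<dots> = entry (conv ?B A) k" using less.prems A(1) by (intro entry_conv[symmetric]) simp
      also have "\<dots> = k * A ! k"
        unfolding A(3) using less.prems A(1) by (simp add: entry_def del: upt_Suc)
      finally show ?thesis using False by simp
    qed
  qed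
  then show ?thesis using A(4) assms by (simp add: unl_eq_tab)
qed

definition mono_tab_11 :: "nat list" where
  "mono_tab_11 =
    [1, 1, 3, 8, 23, 66, 212, 686, 2389, 8682, 32925, 128078, 504149, 1977905, 7665167, 29160353,
     108589611, 395476321, 1409529308]"

definition mono_tab_12 :: "nat list" where
  "mono_tab_12 =
    [1, 1, 3, 8, 23, 66, 212, 686, 2389, 8682, 33160, 131726, 539722, 2247046, 9391729, 38986983,
     159590684, 641212928, 2522631558]"

definition mono_tab_13 :: "nat list" where
  "mono_tab_13 =
    [1, 1, 3, 8, 23, 66, 212, 686, 2389, 8682, 33160, 132277, 549534, 2354767, 10303956, 45508974,
     200841954, 878578704, 3787992000, 16037105375]"

definition mono_tab_14 :: "nat list" where
  "mono_tab_14 =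
    [1, 1, 3, 8, 23, 66, 212, 686, 2389, 8682, 33160, 132277, 550835, 2381252, 10629805, 48578108,
     225149826, 1048460001, 4866124282, 22366624158]"

definition mono_tab_15 :: "nat list" where
  "mono_tab_15 =
    [1, 1, 3, 8, 23, 66, 212, 686, 2389, 8682, 33160, 132277, 550835, 2384411, 10702086, 49565125,
     235415874, 1137967470, 5553391183, 27151955487, 132133010630]"

definition mono_tab_16 :: "nat list" where
  "mono_tab_16 =
    [1, 1, 3, 8, 23, 66, 212, 686, 2389, 8682, 33160, 132277, 550835, 2384411, 10709827, 49763317,
     238403320, 1172091145, 5879179728, 29886293034, 152919404513, 782576765371, 3983697196123]"

definition mono_tab_17 :: "nat list" where
  "mono_tab_17 =
    [1, 1, 3, 8, 23, 66, 212, 686, 2389, 8682, 33160, 132277, 550835, 2384411, 10709827, 49782637,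
     238950281, 1181132810, 5991978461, 31059643048, 163632903595, 871091479566, 4658473280146,
     24892197923973]"

definition mono_tab_18 :: "nat list" where
  "mono_tab_18 =
    [1, 1, 3, 8, 23, 66, 212, 686, 2389, 8682, 33160, 132277, 550835, 2384411, 10709827, 49782637,
     238998910, 1182648497, 6019323461, 31430516729, 167817671781, 912481725412, 5028576475705,
     27944007452931, 155797909029831]"

text \<open>The degrees 18, 18, 19, 19, 20, 22, 23, 24 for \<open>n\<close> from 11 to 18 cannot be
  lowered by one: in degree \<open>d - 1\<close> each table of products still exceeds the number of
  classes.\<close>

lemma mono_check_11: "mono_check 11 18 mono_tab_11"
  by code_simp

lemma mono_check_12: "mono_check 12 18 mono_tab_12"
  by code_simp

lemma mono_check_13: "mono_check 13 19 mono_tab_13"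
  by code_simp

lemma mono_check_14: "mono_check 14 19 mono_tab_14"
  by code_simp

lemma mono_check_15: "mono_check 15 20 mono_tab_15"
  by code_simp

lemma mono_check_16: "mono_check 16 22 mono_tab_16"
  by code_simp

lemma mono_check_17: "mono_check 17 23 mono_tab_17"
  by code_simp

lemma mono_check_18: "mono_check 18 24 mono_tab_18"
  by code_simp

theorem few_products:
  assumes "11 \<le> n" "n \<le> 18"
  shows "\<exists>d. card (emsets (conn_classes (n - 1) d) ne d) < unl n d"
proof -
  consider "n = 11" | "n = 12" | "n = 13" | "n = 14" | "n = 15" | "n = 16" | "n = 17" | "n = 18"
    using assms by linarith
  then show ?thesis
    using mono_check_correct[OF mono_check_11] mono_check_correct[OF mono_check_12]
      mono_check_correct[OF mono_check_13] mono_check_correct[OF mono_check_14]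
      mono_check_correct[OF mono_check_15] mono_check_correct[OF mono_check_16]
      mono_check_correct[OF mono_check_17] mono_check_correct[OF mono_check_18]
    by cases auto
qed

theorem theorem2p3:
  "(\<forall>n \<ge> 5.
      \<not> generates_algebra {orbit_sum n g | g. g \<in> simple_graphs n}
          (invariants n :: 'k::field_char_0 edge_poly set)) \<and>
   (\<forall>n. 11 \<le> n \<and> n \<le> 18 \<longrightarrow>
      \<not> generates_algebra
          {orbit_sum n g | g. g \<in> multigraphs n \<and> (\<exists>i \<in> {1..n}. isolated n g i)}
          (invariants n :: 'k edge_poly set))"
proof (intro conjI allI impI)
  fix n :: nat assume "5 \<le> n"
  then show "\<not> generates_algebra {orbit_sum n g | g. g \<in> simple_graphs n}
      (invariants n :: 'k edge_poly set)"
    by (rule simple_orbit_sums_not_generating)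
next
  fix n :: nat assume "11 \<le> n \<and> n \<le> 18"
  then obtain d where "card (emsets (conn_classes (n - 1) d) ne d) < unl n d"
    using few_products by blast
  then show "\<not> generates_algebra
      {orbit_sum n g | g. g \<in> multigraphs n \<and> (\<exists>i \<in> {1..n}. isolated n g i)}
      (invariants n :: 'k edge_poly set)"
    using unl_le_card_emsets[of n d] by fastforce
qed

end
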